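(* Let $\mu>0$, let $\phi:\mathbb R_+\to\mathbb R_+$ be locally bounded with $\int_0^\infty\phi(t)dt=1$ and $\int_0^\infty t\phi(t)dt=m<\infty$. For $T>1$ let $a_T\in(0,1)$ be given by $T(1-a_T)=1$, let $\phi^T=a_T\phi$, and let $\lambda^T$ be the intensity of the nearly unstable linear Hawkes process with empty history, $$\lambda^T_t=\mu+\iint_{(0,t)\times\mathbb R_+}\phi^T(t-s)\mathbf 1_{\{\theta\le\lambda^T_s\}}N(ds,d\theta),\qquad t\in[0,T].$$ Set $$\hat F^T=\iint_{[0,T]\times\mathbb R_+}\frac{\mathbf 1_{\{\theta\le\mathbb E[\lambda^T_t]\}}}{\sqrt{T\,\mathbb E[\lambda^T_t]}}\,(N(dt,d\theta)-dt\,d\theta).$$ Then there exists $C>0$, depending on $\|\phi\|_1$, $\int_0^\infty t\phi(t)dt$ and $\mu$, such that for any $T>1$, $$d_W(\hat F^T,G)\le\frac{C}{\sqrt T},\qquad G\sim\mathcal N(0,1).$$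
   Context: $\mathbb R_+=[0,\infty)$. $N$ is a Poisson random measure on $\mathbb R\times\mathbb R_+$ with intensity the Lebesgue measure $dt\,d\theta$, with natural filtration $\mathbb F^N$; $\lambda^T$ is the unique $\mathbb F^N$-predictable solution of the displayed equation. Wasserstein distance: $d_W(F,G)=\sup_u|\mathbb E[u(F)]-\mathbb E[u(G)]|$ over $1$-Lipschitz $u:\mathbb R\to\mathbb R$. *)

theory Defs
  imports "HOL-Probability.Probability"
begin

text \<open>Only intended for integrable \<open>F\<close> and \<open>G\<close>. Should \<open>F\<close> alone fail to be integrable, the
  maps \<open>x \<mapsto> x + c\<close> have Bochner integral 0 against \<open>F\<close>, so the supremum is \<open>\<infinity>\<close>: a finite
  bound never arises from the junk value of the integral.\<close>

definition wasserstein_dist ::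
  "'a measure \<Rightarrow> ('a \<Rightarrow> real) \<Rightarrow> 'b measure \<Rightarrow> ('b \<Rightarrow> real) \<Rightarrow> ennreal" where
  "wasserstein_dist M F M' G =
     (SUP u\<in>{u :: real \<Rightarrow> real. 1-lipschitz_on UNIV u}.
        ennreal \<bar>(\<integral>\<omega>. u (F \<omega>) \<partial>M) - (\<integral>\<omega>. u (G \<omega>) \<partial>M')\<bar>)"

text \<open>\<open>I\<close> is the intensity measure. The independence clause uses infinite sequences; finite
  disjoint families are covered by padding with empty sets.\<close>

definition poisson_random_measure ::
  "'w measure \<Rightarrow> 'a measure \<Rightarrow> ('w \<Rightarrow> 'a measure) \<Rightarrow> bool" where
  "poisson_random_measure M I N \<longleftrightarrow>
     prob_space M \<and>
     (\<forall>\<omega>\<in>space M. sets (N \<omega>) = sets I) \<and>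
     (\<forall>A\<in>sets I. (\<lambda>\<omega>. emeasure (N \<omega>) A) \<in> borel_measurable M) \<and>
     (\<forall>A\<in>sets I. emeasure I A < \<infinity> \<longrightarrow>
        (\<forall>k::nat. measure M {\<omega>\<in>space M. emeasure (N \<omega>) A = of_nat k} =
           measure I A ^ k / fact k * exp (- measure I A))) \<and>
     (\<forall>A\<in>sets I. emeasure I A = \<infinity> \<longrightarrow> (AE \<omega> in M. emeasure (N \<omega>) A = \<infinity>)) \<and>
     (\<forall>A :: nat \<Rightarrow> 'a set. range A \<subseteq> sets I \<and> disjoint_family A \<longrightarrow>
        prob_space.indep_vars M (\<lambda>_. borel) (\<lambda>i \<omega>. emeasure (N \<omega>) (A i)) UNIV)"

text \<open>The integral of \<open>f\<close> against \<open>N - I\<close>, for \<open>f\<close> integrable with respect to \<open>I\<close>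
  (then \<open>f\<close> is also almost surely integrable with respect to \<open>N\<close>).\<close>

definition compensated_integral ::
  "'a measure \<Rightarrow> ('w \<Rightarrow> 'a measure) \<Rightarrow> ('a \<Rightarrow> real) \<Rightarrow> 'w \<Rightarrow> real" where
  "compensated_integral I N f \<omega> = (\<integral>x. f x \<partial>N \<omega>) - (\<integral>x. f x \<partial>I)"

text \<open>Lebesgue measure \<open>dt d\<theta>\<close> on \<open>\<real> \<times> [0,\<infinity>)\<close>; the first coordinate is time.\<close>

definition dt_d\<theta> :: "(real \<times> real) measure" where
  "dt_d\<theta> = restrict_space lborel (UNIV \<times> {0..})"

definition natural_filtration ::
  "'w measure \<Rightarrow> ('w \<Rightarrow> (real \<times> real) measure) \<Rightarrow> real \<Rightarrow> 'w measure" where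
  "natural_filtration M N t = sigma (space M)
     {(\<lambda>\<omega>. emeasure (N \<omega>) A) -` B \<inter> space M | A B.
        A \<in> sets dt_d\<theta> \<and> A \<subseteq> {..t} \<times> UNIV \<and> B \<in> sets borel}"

definition predictable_sigma ::
  "'w set \<Rightarrow> (real \<Rightarrow> 'w measure) \<Rightarrow> real \<Rightarrow> (real \<times> 'w) measure" where
  "predictable_sigma \<Omega> F T = sigma ({0..T} \<times> \<Omega>)
     ({{0} \<times> A | A. A \<in> sets (F 0)} \<union>
      {{s<..t} \<times> A | s t A. 0 \<le> s \<and> s < t \<and> t \<le> T \<and> A \<in> sets (F s)})"

text \<open>The equation is read in \<open>[0,\<infinity>]\<close>, so that the integral on the right is always defined; since
  the left-hand side is finite, so is the integral. The kernel is only evaluated on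
  \<open>(0,\<infinity>)\<close>, and \<open>\<Lambda> s \<omega>\<close> only for \<open>s \<in> [0,T]\<close>.\<close>

definition hawkes_intensity ::
  "'w measure \<Rightarrow> ('w \<Rightarrow> (real \<times> real) measure) \<Rightarrow> real \<Rightarrow> (real \<Rightarrow> real) \<Rightarrow> real \<Rightarrow>
     (real \<Rightarrow> 'w \<Rightarrow> real) \<Rightarrow> bool" where
  "hawkes_intensity M N \<mu> \<phi> T \<Lambda> \<longleftrightarrow>
     (\<lambda>(t, \<omega>). \<Lambda> t \<omega>) \<in>
       borel_measurable (predictable_sigma (space M) (natural_filtration M N) T) \<and>
     (AE \<omega> in M. \<forall>t\<in>{0..T}. ennreal (\<Lambda> t \<omega>) =
        ennreal \<mu> + (\<integral>\<^sup>+(s, \<theta>). ennreal (\<phi> (t - s)) * indicator {0<..<t} s *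
                            indicator {..\<Lambda> s \<omega>} \<theta> \<partial>N \<omega>))"

definition hawkes_F_hat ::
  "'w measure \<Rightarrow> ('w \<Rightarrow> (real \<times> real) measure) \<Rightarrow> real \<Rightarrow> (real \<Rightarrow> 'w \<Rightarrow> real) \<Rightarrow> 'w \<Rightarrow> real" where
  "hawkes_F_hat M N T \<Lambda> = compensated_integral dt_d\<theta> N
     (\<lambda>(t, \<theta>). indicator {0..T} t *
        (indicator {..prob_space.expectation M (\<Lambda> t)} \<theta> /
           sqrt (T * prob_space.expectation M (\<Lambda> t))))"

end

theory Submission
  imports Defs "HOL-Real_Asymp.Real_Asymp"
begin

text \<open>
  The proof is Stein's method on the first Poisson chaos. If \<open>f\<close> solves
  \<open>f' x - x f x = u x - E u(Z)\<close> for a 1-Lipschitz \<open>u\<close>, then \<open>f\<close> is bounded and \<open>f'\<close> is Lipschitz, both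
  with universal constants, and the Poisson size-bias identity gives
  \<open>\<bar>E u(F) - E u(Z)\<bar> \<le> K \<integral> h\<^sup>3\<close> for the compensated integral \<open>F\<close> of a nonnegative \<open>h\<close> with
  \<open>\<integral> h\<^sup>2 = 1\<close>. Here \<open>h\<close> is the indicator of \<open>\<theta> \<le> E \<lambda>\<^sub>t\<close> divided by \<open>sqrt (T * E \<lambda>\<^sub>t)\<close>, so that
  \<open>\<integral> h\<^sup>2 = 1\<close>, while \<open>E \<lambda>\<^sub>t \<ge> \<mu>\<close> gives \<open>\<integral> h\<^sup>3 \<le> 1 / sqrt (\<mu> * T)\<close>.

  What has to be shown about the Hawkes process is that \<open>E \<lambda>\<^sub>t\<close> is finite for almost every \<open>t\<close>.
  Compensation of predictable integrands yields a renewal inequality for the mean of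
  \<open>\<lambda>\<^sub>t\<close> stopped when \<open>\<integral>\<^sub>0\<^sup>t \<lambda>\<close> exceeds \<open>k\<close>, with a bound independent of \<open>k\<close> because the kernel has
  mass \<open>a < 1\<close>. That \<open>\<integral>\<^sub>0\<^sup>t \<lambda>\<close> is finite for \<open>t < T\<close> is a pathwise consequence of the finiteness
  of every \<open>\<lambda>\<^sub>t\<close>.
\<close>

section \<open>Stein equation for Lipschitz test functions\<close>

text \<open>The functional is linear in the Poisson points with a deterministic integrand, so one
  shift identity for finitely many counts suffices: simple integrands come first and the general
  case follows by an L1 limit. The obstacle is the default value of the Bochner integral. At times
  of infinite mean intensity, \<open>expectation\<close> would return 0, division by
  \<open>sqrt 0\<close> would return 0, and the integrand would vanish there, so that the variance
  could fall short of 1; this is why finiteness for almost every time has to be proved. Stopping is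
  forced by the shape of the renewal inequality: \<open>W \<le> c + a * W\<close> bounds
  \<open>W\<close> only if \<open>W\<close> is already finite. Compensation in turn wants a
  predictable integrand, so the running integral of the intensity has to be proved predictable,
  starting from generating rectangles. The number 22 is 2 * (10 + 1): \<open>f\<close> is bounded by
  10, a shift of the argument perturbs the Stein equation by 10 + 1 times the shift, and solving the
  perturbed equation costs the same amount again.\<close>

lemma ou_ode_bound_pos:
  fixes D D' :: "real \<Rightarrow> real"
  assumes deriv: "\<And>x. (D has_real_derivative D' x) (at x)"
    and eq: "\<And>x. \<bar>D' x - x * D x\<bar> \<le> r" and bdd: "\<And>x. \<bar>D x\<bar> \<le> b" and x: "x > 0"
  shows "x * D x \<le> r"
proof -
  define e where "e y = exp (- (y\<^sup>2) / 2)" for y :: real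
  \<comment> \<open>\<open>e\<close> is the integrating factor of the equation and
    \<open>r / y\<close> the comparison function: the extra terms \<open>r\<close> and
    \<open>r / y\<^sup>2\<close> in the derivative absorb the right-hand side, so \<open>H\<close>
    is nondecreasing on the positive axis.\<close>
  define H where "H y = e y * (D y - r / y)" for y
  have r0: "0 \<le> r"
    using eq[of 0] by linarith
  have e': "(e has_real_derivative - y * e y) (at y)" for y
    unfolding e_def by (auto intro!: derivative_eq_intros)
  have H': "(H has_real_derivative (e y * (D' y - y * D y + r + r / y\<^sup>2))) (at y)" if "y > 0" for y
    unfolding H_def
    by (rule derivative_eq_intros e' deriv refl | use that in \<open>simp add: field_simps power2_eq_square\<close>)+
  have mono: "H a \<le> H c" if "0 < a" "a \<le> c" for a c
  proof (rule DERIV_nonneg_imp_nondecreasing[OF that(2)])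
    fix y assume "a \<le> y" "y \<le> c"
    then have "y > 0" using that by simp
    moreover have "0 \<le> e y * (D' y - y * D y + r + r / y\<^sup>2)"
      using eq[of y] r0 by (intro mult_nonneg_nonneg) (auto simp: e_def abs_le_iff intro!: add_nonneg_nonneg)
    ultimately show "\<exists>z. (H has_real_derivative z) (at y) \<and> 0 \<le> z"
      using H' by blast
  qed
  \<comment> \<open>Boundedness of \<open>D\<close> excludes growth like
    \<open>exp (y\<^sup>2 / 2)\<close>: \<open>H\<close> is dominated by a function tending to 0,
    and a nondecreasing function with that property is nonpositive.\<close>
  have lim: "((\<lambda>y. e y * (b + r)) \<longlongrightarrow> 0) at_top"
    unfolding e_def by real_asymp
  have ev: "eventually (\<lambda>y. H x \<le> e y * (b + r)) at_top"
    using eventually_ge_at_top[of "max x 1"]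
  proof eventually_elim
    case (elim y)
    have "H x \<le> H y" using elim x by (intro mono) auto
    also have "\<dots> \<le> e y * (b + r)"
    proof -
      have "r / y \<ge> 0" using r0 elim by (intro divide_nonneg_nonneg) auto
      then have "D y - r / y \<le> b + r" using bdd[of y] r0 by linarith
      then show ?thesis unfolding H_def by (intro mult_left_mono) (auto simp: e_def)
    qed
    finally show ?case .
  qed
  have "H x \<le> 0"
    by (rule tendsto_lowerbound[OF lim ev]) simp
  then have "D x - r / x \<le> 0"
    unfolding H_def e_def by (simp add: mult_le_0_iff)
  then show ?thesis using x by (simp add: field_simps)
qed

text \<open>Up to the sign of the right-hand side, the equation keeps its form when \<open>D\<close>
  is negated and when its argument is reflected. The one-sided bound on the positive axis, applied
  to the four resulting functions, gives both signs on both half-lines.\<close>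

lemma ou_ode_bound:
  fixes D D' :: "real \<Rightarrow> real"
  assumes deriv: "\<And>x. (D has_real_derivative D' x) (at x)"
    and eq: "\<And>x. \<bar>D' x - x * D x\<bar> \<le> r" and bdd: "\<And>x. \<bar>D x\<bar> \<le> b"
  shows "\<bar>x * D x\<bar> \<le> r"
proof -
  have r0: "0 \<le> r"
    using eq[of 0] by linarith
  have pos: "x * g x \<le> r" if "\<And>x. (g has_real_derivative g' x) (at x)"
    "\<And>x. \<bar>g' x - x * g x\<bar> \<le> r" "\<And>x. \<bar>g x\<bar> \<le> b" "x > 0" for g g' :: "real \<Rightarrow> real" and x
    using ou_ode_bound_pos[OF that] .
  have neg': "((\<lambda>x. - D x) has_real_derivative - D' x) (at x)" for x
    by (intro derivative_intros deriv)
  have ref': "((\<lambda>x. D (- x)) has_real_derivative - D' (- x)) (at x)" for x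
    using deriv[of "- x"] by (simp add: DERIV_mirror)
  have refneg': "((\<lambda>x. - D (- x)) has_real_derivative D' (- x)) (at x)" for x
    using DERIV_minus[OF ref'[of x]] by simp
  have 1: "\<bar>- D' x - x * - D x\<bar> \<le> r" for x using eq[of x] by (simp add: abs_minus_commute)
  have 2: "\<bar>- D' (- x) - x * D (- x)\<bar> \<le> r" for x using eq[of "-x"] by (simp add: abs_le_iff)
  have 3: "\<bar>D' (- x) - x * - D (- x)\<bar> \<le> r" for x using eq[of "-x"] by (simp add: abs_le_iff)
  consider "x > 0" | "x = 0" | "- x > 0" by linarith
  then show ?thesis
  proof cases
    case 1
    then show ?thesis
      using pos[OF deriv eq bdd, of x] pos[OF neg' \<open>\<And>x. \<bar>- D' x - x * - D x\<bar> \<le> r\<close>, of x] bdd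
      by (simp add: abs_le_iff)
  next
    case 3
    then show ?thesis
      using pos[OF ref' 2, of "-x"] pos[OF refneg' \<open>\<And>x. \<bar>D' (- x) - x * - D (- x)\<bar> \<le> r\<close>, of "-x"] bdd
      by (simp add: abs_le_iff)
  qed (use r0 in simp)
qed

lemma nn_integral_gaussian_tail:
  assumes "1 \<le> (x::real)"
  shows "(\<integral>\<^sup>+y. ennreal (2 * y * exp (- (y\<^sup>2) / 2)) * indicator {x..} y \<partial>lborel) = ennreal (2 * exp (- (x\<^sup>2) / 2))"
proof -
  have "(\<integral>\<^sup>+y. ennreal (2 * y * exp (- (y\<^sup>2) / 2)) * indicator {x..} y \<partial>lborel)
      = ennreal (0 - (- 2 * exp (- (x\<^sup>2) / 2)))"
  proof (rule nn_integral_FTC_atLeast)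
    show "((\<lambda>y::real. - 2 * exp (- (y\<^sup>2) / 2)) \<longlongrightarrow> 0) at_top"
      by real_asymp
  qed (use assms in \<open>auto intro!: derivative_eq_intros\<close>)
  then show ?thesis by simp
qed

text \<open>From 1 on, \<open>\<bar>y\<bar> + 1\<close> is at most \<open>2 * y\<close>, and
  \<open>2 * y * exp (- (y\<^sup>2) / 2)\<close> has an explicit antiderivative.\<close>

lemma gaussian_tail_bound:
  fixes v :: "real \<Rightarrow> real"
  assumes [measurable]: "v \<in> borel_measurable borel" and v: "\<And>y. \<bar>v y\<bar> \<le> \<bar>y\<bar> + 1" and x: "1 \<le> x"
  shows "\<bar>\<integral>y. v y * exp (- (y\<^sup>2) / 2) * indicator {x..} y \<partial>lborel\<bar> \<le> 2 * exp (- (x\<^sup>2) / 2)"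
proof -
  have "ennreal \<bar>\<integral>y. v y * exp (- (y\<^sup>2) / 2) * indicator {x..} y \<partial>lborel\<bar>
      \<le> (\<integral>\<^sup>+y. norm (v y * exp (- (y\<^sup>2) / 2) * indicator {x..} y) \<partial>lborel)"
    using integral_norm_bound_ennreal[of lborel "\<lambda>y. v y * exp (- (y\<^sup>2) / 2) * indicator {x..} y"]
      not_integrable_integral_eq[of lborel "\<lambda>y. v y * exp (- (y\<^sup>2) / 2) * indicator {x..} y"]
    by (cases "integrable lborel (\<lambda>y. v y * exp (- (y\<^sup>2) / 2) * indicator {x..} y)") auto
  also have "\<dots> \<le> (\<integral>\<^sup>+y. ennreal (2 * y * exp (- (y\<^sup>2) / 2)) * indicator {x..} y \<partial>lborel)"
  proof (rule nn_integral_mono)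
    fix y :: real
    have "\<bar>v y\<bar> * exp (- (y\<^sup>2) / 2) \<le> 2 * y * exp (- (y\<^sup>2) / 2)" if "x \<le> y"
      using v[of y] that x by (intro mult_right_mono) auto
    then show "ennreal (norm (v y * exp (- (y\<^sup>2) / 2) * indicator {x..} y))
        \<le> ennreal (2 * y * exp (- (y\<^sup>2) / 2)) * indicator {x..} y"
      by (auto simp: indicator_def abs_mult intro!: ennreal_leI)
  qed
  also have "\<dots> = ennreal (2 * exp (- (x\<^sup>2) / 2))"
    by (rule nn_integral_gaussian_tail[OF x])
  finally show ?thesis by (simp add: ennreal_le_iff)
qed

lemma lipschitz_measurable:
  fixes u :: "real \<Rightarrow> real"
  assumes "1-lipschitz_on UNIV u"
  shows "u \<in> borel_measurable borel"
  using lipschitz_on_continuous_on[OF assms] by (intro borel_measurable_continuous_onI)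

definition gauss_mean :: "(real \<Rightarrow> real) \<Rightarrow> real" where
  "gauss_mean u = (\<integral>x. std_normal_density x * u x \<partial>lborel)"

lemma integrable_std_normal_lin:
  "integrable lborel (\<lambda>y. std_normal_density y * (\<bar>y\<bar> + 1))"
  using integrable_std_normal_moment_abs[of 1] integrable_std_normal_moment_abs[of 0]
  by (simp add: distrib_left)

text \<open>\<open>\<bar>u x - u y\<bar> \<le> \<bar>x\<bar> + \<bar>y\<bar>\<close> is averaged
  over a Gaussian y, whose mean absolute value is at most 1.\<close>

lemma lipschitz_gauss_mean:
  assumes u: "1-lipschitz_on UNIV (u :: real \<Rightarrow> real)"
  shows "\<bar>u x - gauss_mean u\<bar> \<le> \<bar>x\<bar> + 1"
    and "integrable lborel (\<lambda>y. std_normal_density y * u y)"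
proof -
  note [measurable] = lipschitz_measurable[OF u]
  have lip: "\<bar>u x - u y\<bar> \<le> \<bar>x - y\<bar>" for x y
    using lipschitz_onD[OF u, of x y] by (simp add: dist_real_def)
  show int: "integrable lborel (\<lambda>y. std_normal_density y * u y)"
  proof (rule Bochner_Integration.integrable_bound)
    show "integrable lborel (\<lambda>y. std_normal_density y * ((\<bar>u 0\<bar> + 1) * (\<bar>y\<bar> + 1)))"
      using integrable_std_normal_lin[THEN integrable_mult_right, of "\<bar>u 0\<bar> + 1"] by (simp add: ac_simps)
    have *: "\<bar>u y\<bar> \<le> (\<bar>u 0\<bar> + 1) * (\<bar>y\<bar> + 1)" for y
    proof -
      have "\<bar>u y\<bar> \<le> \<bar>u 0\<bar> + \<bar>y\<bar>" using lip[of y 0] by simp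
      moreover have "0 \<le> \<bar>u 0\<bar> * \<bar>y\<bar>" by simp
      ultimately show ?thesis by (simp only: distrib_left distrib_right)
    qed
    show "AE y in lborel. norm (std_normal_density y * u y) \<le> norm (std_normal_density y * ((\<bar>u 0\<bar> + 1) * (\<bar>y\<bar> + 1)))"
      using * by (intro AE_I2) (auto simp: abs_mult intro!: mult_left_mono)
  qed simp
  have one: "(\<integral>y. std_normal_density y * 1 \<partial>lborel) = 1" by simp
  have i1: "integrable lborel (\<lambda>y. std_normal_density y * u x)" by simp
  have "u x - gauss_mean u = (\<integral>y. std_normal_density y * (u x - u y) \<partial>lborel)"
    using int i1 one unfolding gauss_mean_def by (simp add: right_diff_distrib)
  also have "\<bar>\<dots>\<bar> \<le> (\<integral>y. std_normal_density y * (\<bar>x\<bar> + (1 + y\<^sup>2) / 2) \<partial>lborel)"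
  proof (rule integral_abs_bound_integral)
    show "integrable lborel (\<lambda>y. std_normal_density y * (u x - u y))"
      using int i1 by (simp add: right_diff_distrib)
    show "integrable lborel (\<lambda>y. std_normal_density y * (\<bar>x\<bar> + (1 + y\<^sup>2) / 2))"
      using integrable_std_normal_moment[of 2] by (simp add: distrib_left add_divide_distrib)
    fix y :: real
    \<comment> \<open>This trades the first absolute moment for the variance, so the additive
      constant comes out as exactly 1.\<close>
    have "0 \<le> (\<bar>y\<bar> - 1)\<^sup>2" by simp
    then have "\<bar>y\<bar> \<le> (1 + y\<^sup>2) / 2" by (simp add: power2_eq_square algebra_simps)
    then have "\<bar>u x - u y\<bar> \<le> \<bar>x\<bar> + (1 + y\<^sup>2) / 2" using lip[of x y] by linarith
    then show "\<bar>std_normal_density y * (u x - u y)\<bar> \<le> std_normal_density y * (\<bar>x\<bar> + (1 + y\<^sup>2) / 2)"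
      by (simp add: abs_mult mult_left_mono)
  qed
  also have "(\<integral>y. std_normal_density y * (\<bar>x\<bar> + (1 + y\<^sup>2) / 2) \<partial>lborel) = \<bar>x\<bar> + 1"
    using integrable_std_normal_moment[of 2] integral_std_normal_moment_even[of 1]
    by (simp add: distrib_left add_divide_distrib fact_numeral)
  finally show "\<bar>u x - gauss_mean u\<bar> \<le> \<bar>x\<bar> + 1" .
qed

lemma integrable_lipschitz:
  assumes u: "1-lipschitz_on UNIV (u :: real \<Rightarrow> real)" and M: "finite_measure M" and X: "integrable M X"
  shows "integrable M (\<lambda>\<omega>. u (X \<omega>))"
proof (rule Bochner_Integration.integrable_bound)
  interpret finite_measure M by (rule M)
  show "integrable M (\<lambda>\<omega>. \<bar>X \<omega>\<bar> + (1 + \<bar>gauss_mean u\<bar>))"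
    using X by simp
  show "AE \<omega> in M. norm (u (X \<omega>)) \<le> norm (\<bar>X \<omega>\<bar> + (1 + \<bar>gauss_mean u\<bar>))"
  proof (rule AE_I2)
    fix \<omega> show "norm (u (X \<omega>)) \<le> norm (\<bar>X \<omega>\<bar> + (1 + \<bar>gauss_mean u\<bar>))"
      using lipschitz_gauss_mean(1)[OF u, of "X \<omega>"] unfolding real_norm_def by linarith
  qed
qed (rule measurable_compose[OF borel_measurable_integrable[OF X] lipschitz_measurable[OF u]])

text \<open>The solution is explicit: \<open>exp (x\<^sup>2 / 2)\<close> times the integral of the
  centred \<open>u\<close> against \<open>exp (- (y\<^sup>2) / 2)\<close> over \<open>{..x}\<close>.
  Centring makes the total integral zero, so the same quantity is minus the integral over
  \<open>{x..}\<close>, and each x outside \<open>{-1..1}\<close> can use the tail on its own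
  side.\<close>

lemma stein_solution_exists:
  assumes u: "1-lipschitz_on UNIV (u :: real \<Rightarrow> real)"
  shows "\<exists>f f'. (\<forall>x. (f has_real_derivative f' x) (at x)) \<and>
     (\<forall>x. f' x = x * f x + (u x - gauss_mean u)) \<and> (\<forall>x. \<bar>f x\<bar> \<le> 10)"
proof -
  define v where "v x = u x - gauss_mean u" for x
  define w where "w x = v x * exp (- (x\<^sup>2) / 2)" for x
  have cu: "continuous_on UNIV u"
    by (rule lipschitz_on_continuous_on[OF u])
  note [measurable] = lipschitz_measurable[OF u]
  have v: "\<bar>v x\<bar> \<le> \<bar>x\<bar> + 1" for x
    unfolding v_def by (rule lipschitz_gauss_mean(1)[OF u])
  have [measurable]: "v \<in> borel_measurable borel" "w \<in> borel_measurable borel"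
    by (simp_all add: v_def[abs_def] w_def[abs_def])
  have w_alt: "w x = sqrt (2 * pi) * (std_normal_density x * v x)" for x
    by (simp add: w_def std_normal_density_def field_simps)
  have ints: "integrable lborel (\<lambda>x. std_normal_density x * v x)"
    using lipschitz_gauss_mean(2)[OF u] by (simp add: v_def right_diff_distrib)
  have int: "integrable lborel w"
    unfolding w_alt[abs_def] by (intro integrable_mult_right ints)
  have "(\<integral>x. std_normal_density x * v x \<partial>lborel) = 0"
    using lipschitz_gauss_mean(2)[OF u] by (simp add: v_def right_diff_distrib gauss_mean_def)
  then have zero: "(\<integral>x. w x \<partial>lborel) = 0"
    unfolding w_alt by simp
  have cw: "isCont w x" for x
    using cu by (auto simp: w_def[abs_def] v_def[abs_def] continuous_on_eq_continuous_at
        intro!: continuous_intros)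
  \<comment> \<open>Some antiderivative of the continuous \<open>w\<close>; comparing increments
    identifies it with \<open>E\<close> up to a constant, and this is how \<open>E\<close> inherits
    the derivative \<open>w\<close>.\<close>
  obtain E0 where E0: "\<And>x. (E0 has_vector_derivative w x) (at x)"
    using einterval_antiderivative[of "-\<infinity>" "\<infinity>" w] cw by auto
  define E where "E x = (\<integral>y. w y * indicator {..x} y \<partial>lborel)" for x
  have int_on [simp]: "integrable lborel (\<lambda>y. w y * indicator A y)" if "A \<in> sets borel" for A
    using that int by (intro integrable_real_mult_indicator) auto
  have E_diff: "E b - E a = E0 b - E0 a" if "a \<le> b" for a b
  proof -
    have "E b - E a = (\<integral>y. w y * indicator {..b} y - w y * indicator {..a} y \<partial>lborel)"
      unfolding E_def by (subst Bochner_Integration.integral_diff) auto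
    also have "\<dots> = (\<integral>y. indicator {a..b} y *\<^sub>R w y \<partial>lborel)"
    proof (rule integral_cong_AE)
      show "AE y in lborel. w y * indicator {..b} y - w y * indicator {..a} y = indicator {a..b} y *\<^sub>R w y"
        using AE_lborel_singleton[of a] by eventually_elim (use that in \<open>auto simp: indicator_def\<close>)
    qed auto
    also have "\<dots> = E0 b - E0 a"
      by (rule integral_FTC_atLeastAtMost[OF that])
        (use E0 cw in \<open>auto intro: has_vector_derivative_at_within continuous_at_imp_continuous_on\<close>)
    finally show ?thesis .
  qed
  have "E = (\<lambda>x. E0 x + (E 0 - E0 0))"
  proof
    fix x show "E x = E0 x + (E 0 - E0 0)"
      using E_diff[of 0 x] E_diff[of x 0] by (cases "0 \<le> x") auto
  qed
  moreover have "((\<lambda>x. E0 x + (E 0 - E0 0)) has_real_derivative w x) (at x)" for x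
    using E0[of x] unfolding has_real_derivative_iff_has_vector_derivative[symmetric]
    by (auto intro!: derivative_eq_intros)
  ultimately have E': "(E has_real_derivative w x) (at x)" for x
    by metis
  have E_alt: "E x = - (\<integral>y. w y * indicator {x..} y \<partial>lborel)" for x
  proof -
    have "E x + (\<integral>y. w y * indicator {x..} y \<partial>lborel)
        = (\<integral>y. w y * indicator {..x} y + w y * indicator {x..} y \<partial>lborel)"
      unfolding E_def by (subst Bochner_Integration.integral_add) auto
    also have "\<dots> = (\<integral>y. w y \<partial>lborel)"
    proof (rule integral_cong_AE)
      show "AE y in lborel. w y * indicator {..x} y + w y * indicator {x..} y = w y"
        using AE_lborel_singleton[of x] by eventually_elim (auto simp: indicator_def)
    qed auto
    finally show ?thesis using zero by simp
  qed
  have E_refl: "E x = (\<integral>y. v (- y) * exp (- (y\<^sup>2) / 2) * indicator {- x..} y \<partial>lborel)" for x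
    unfolding E_def w_def
    by (subst lborel_integral_real_affine[where c="-1" and t=0]) (auto simp: indicator_def intro!: Bochner_Integration.integral_cong)
  have E_pos: "\<bar>E x\<bar> \<le> 2 * exp (- (x\<^sup>2) / 2)" if "1 \<le> x" for x
    unfolding E_alt w_def abs_minus_cancel by (rule gaussian_tail_bound) (use v that in auto)
  have E_neg: "\<bar>E x\<bar> \<le> 2 * exp (- (x\<^sup>2) / 2)" if "x \<le> - 1" for x
    unfolding E_refl using gaussian_tail_bound[of "\<lambda>y. v (- y)" "- x"] v[of "- y" for y] that by simp
  have E_mid: "\<bar>E x\<bar> \<le> 5" if "- 1 \<le> x" "x \<le> 1" for x
  proof -
    have "\<bar>w y\<bar> \<le> 2" if "- 1 \<le> y" "y \<le> 1" for y
    proof -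
      have "\<bar>w y\<bar> = \<bar>v y\<bar> * exp (- (y\<^sup>2) / 2)" by (simp add: w_def abs_mult)
      also have "\<dots> \<le> 2 * 1" by (intro mult_mono) (use v[of y] that in auto)
      finally show ?thesis by simp
    qed
    then have "norm (E 1 - E x) \<le> 2 * norm (1 - x)" if "0 \<le> x"
      using that \<open>x \<le> 1\<close>
      by (intro field_differentiable_bound[of "{-1..1}" E w])
         (auto intro: has_field_derivative_at_within[OF E'])
    moreover have "norm (E x - E (-1)) \<le> 2 * norm (x - (-1))" if "x \<le> 0"
      using that \<open>- 1 \<le> x\<close> \<open>\<And>y. - 1 \<le> y \<Longrightarrow> y \<le> 1 \<Longrightarrow> \<bar>w y\<bar> \<le> 2\<close>
      by (intro field_differentiable_bound[of "{-1..1}" E w])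
         (auto intro: has_field_derivative_at_within[OF E'])
    moreover have "\<bar>E 1\<bar> \<le> 2" "\<bar>E (-1)\<bar> \<le> 2"
      using E_pos[of 1] E_neg[of "-1"] order_trans[of _ "2 * exp (-(1/2)::real)" 2] by auto
    ultimately show ?thesis using that by (cases "0 \<le> x") auto
  qed
  define f where "f x = exp (x\<^sup>2 / 2) * E x" for x
  have f': "(f has_real_derivative (x * f x + v x)) (at x)" for x
  proof -
    have "(f has_real_derivative (x * exp (x\<^sup>2 / 2) * E x + exp (x\<^sup>2 / 2) * w x)) (at x)"
      unfolding f_def by (rule derivative_eq_intros E' refl | simp)+
    moreover have "exp (x\<^sup>2 / 2) * w x = v x"
      by (simp add: w_def exp_minus)
    ultimately show ?thesis by (simp add: f_def mult.assoc)
  qed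
  have "\<bar>f x\<bar> \<le> 10" for x
  proof (cases "\<bar>x\<bar> \<le> 1")
    case True
    have "x\<^sup>2 / 2 \<le> 1 / 2" using True by (simp add: abs_square_le_1)
    then have "exp (x\<^sup>2 / 2) \<le> exp (1 / 2)" by simp
    also have "\<dots> \<le> 2"
      using exp_bound_half[of "1/2::real"] by simp
    \<comment> \<open>The bound 10 originates here; outside \<open>{-1..1}\<close> the weight
      cancels the Gaussian tail exactly and leaves 2.\<close>
    finally have "\<bar>f x\<bar> \<le> 2 * 5"
      unfolding f_def abs_mult using E_mid[of x] True by (intro mult_mono) auto
    then show ?thesis by simp
  next
    case False
    then have "\<bar>E x\<bar> \<le> 2 * exp (- (x\<^sup>2) / 2)" using E_pos[of x] E_neg[of x] by force
    then have "\<bar>f x\<bar> \<le> exp (x\<^sup>2 / 2) * (2 * exp (- (x\<^sup>2) / 2))"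
      unfolding f_def abs_mult by (intro mult_mono) auto
    also have "\<dots> = 2 * exp (x\<^sup>2 / 2 + - (x\<^sup>2) / 2)" by (simp only: exp_add)
    finally show ?thesis by simp
  qed
  then show ?thesis
    by (intro exI[of _ f] exI[of _ "\<lambda>x. x * f x + v x"]) (use f' in \<open>auto simp: v_def\<close>)
qed

lemma stein_solution:
  assumes u: "1-lipschitz_on UNIV (u :: real \<Rightarrow> real)"
  obtains f f' where "\<And>x. (f has_real_derivative f' x) (at x)"
    "\<And>x. f' x = x * f x + (u x - gauss_mean u)" "\<And>x. \<bar>f x\<bar> \<le> 10"
    "22-lipschitz_on UNIV f'"
proof -
  obtain f f' where f: "\<And>x. (f has_real_derivative f' x) (at x)"
    and eq: "\<And>x. f' x = x * f x + (u x - gauss_mean u)" and bdd: "\<And>x. \<bar>f x\<bar> \<le> 10"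
    using stein_solution_exists[OF u] by blast
  have lip: "\<bar>f' (x + d) - f' x\<bar> \<le> 22 * d" if d: "0 \<le> d" for x d
  proof -
    \<comment> \<open>\<open>D\<close> solves the same equation with a right-hand side of order \<open>d\<close>, so that a Lipschitz
      bound for \<open>f'\<close> comes out without differentiating \<open>u\<close>.\<close>
    define D where "D x = f (x + d) - f x" for x
    have D': "(D has_real_derivative (f' (x + d) - f' x)) (at x)" for x
      unfolding D_def using f[of "x + d"] f[of x]
      by (intro DERIV_diff) (simp_all only: DERIV_shift)
    \<comment> \<open>11 is 10 + 1: the bound 10 on \<open>f\<close> multiplies the shift of the
      coefficient, and the Lipschitz constant of \<open>u\<close> adds 1.
      \<open>ou_ode_bound\<close> returns the same \<open>11 * d\<close> for \<open>x * D x\<close>,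
      and the two add up to 22.\<close>
    have R: "\<bar>f' (x + d) - f' x - x * D x\<bar> \<le> 11 * d" for x
    proof -
      have "f' (x + d) - f' x - x * D x = d * f (x + d) + (u (x + d) - u x)"
        by (simp add: eq D_def algebra_simps)
      moreover have "\<bar>d * f (x + d)\<bar> \<le> d * 10"
        using d bdd[of "x + d"] unfolding abs_mult by (intro mult_mono) auto
      moreover have "\<bar>u (x + d) - u x\<bar> \<le> d"
        using lipschitz_onD[OF u, of "x + d" x] d by (simp add: dist_real_def)
      ultimately show ?thesis by linarith
    qed
    have "\<bar>D x\<bar> \<le> 20" for x
      using bdd[of x] bdd[of "x + d"] unfolding D_def by linarith
    from ou_ode_bound[OF D' R this, of x] R[of x] show ?thesis by linarith
  qed
  have "22-lipschitz_on UNIV f'"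
  proof (rule lipschitz_onI)
    fix x y :: real
    show "dist (f' x) (f' y) \<le> 22 * dist x y"
      using lip[of "y - x" x] lip[of "x - y" y] by (cases "x \<le> y") (auto simp: dist_real_def abs_minus_commute)
  qed simp
  then show thesis using that f eq bdd by blast
qed

section \<open>Poisson random measures\<close>

text \<open>The factor k cancels against the factorial, so weighting by k is the same as shifting
  the index by one. This is the size-bias identity of a single Poisson variable.\<close>

lemma poisson_shift_nn:
  fixes h :: "nat \<Rightarrow> ennreal"
  assumes r: "0 \<le> r"
  shows "(\<Sum>k. ennreal (r ^ k / fact k * exp (- r)) * (of_nat k * h k))
    = ennreal r * (\<Sum>k. ennreal (r ^ k / fact k * exp (- r)) * h (Suc k))"
proof -
  have "(\<Sum>k. ennreal (r ^ k / fact k * exp (- r)) * (of_nat k * h k))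
     = (\<Sum>k. ennreal (r ^ Suc k / fact (Suc k) * exp (- r)) * (of_nat (Suc k) * h (Suc k)))"
    by (subst suminf_offset[where i=1]) auto
  also have "\<dots> = (\<Sum>k. ennreal r * (ennreal (r ^ k / fact k * exp (- r)) * h (Suc k)))"
  proof (rule suminf_cong)
    fix k
    have "ennreal (r ^ Suc k / fact (Suc k) * exp (- r)) * of_nat (Suc k)
        = ennreal (r ^ Suc k / fact (Suc k) * exp (- r) * real (Suc k))"
      unfolding ennreal_of_nat_eq_real_of_nat using r by (intro ennreal_mult[symmetric]) auto
    also have "r ^ Suc k / fact (Suc k) * exp (- r) * real (Suc k) = r * (r ^ k / fact k * exp (- r))"
      by (simp add: fact_Suc del: of_nat_Suc)
    also have "ennreal \<dots> = ennreal r * ennreal (r ^ k / fact k * exp (- r))"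
      using r by (intro ennreal_mult) auto
    finally show "ennreal (r ^ Suc k / fact (Suc k) * exp (- r)) * (of_nat (Suc k) * h (Suc k))
        = ennreal r * (ennreal (r ^ k / fact k * exp (- r)) * h (Suc k))"
      by (simp only: mult.assoc[symmetric])
  qed
  also have "\<dots> = ennreal r * (\<Sum>k. ennreal (r ^ k / fact k * exp (- r)) * h (Suc k))"
    by simp
  finally show ?thesis .
qed

text \<open>Tonelli on the joint law. Working in [0,\<infinity>] lets counts multiply test functions
  before any integrability is known.\<close>

lemma (in prob_space) indep_var_nn_integral_mult:
  fixes X Y :: "'a \<Rightarrow> ennreal"
  assumes ind: "indep_var borel X borel Y"
  shows "(\<integral>\<^sup>+\<omega>. X \<omega> * Y \<omega> \<partial>M) = (\<integral>\<^sup>+\<omega>. X \<omega> \<partial>M) * (\<integral>\<^sup>+\<omega>. Y \<omega> \<partial>M)"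
proof -
  have [measurable]: "X \<in> borel_measurable M" "Y \<in> borel_measurable M"
    by (rule indep_var_rv1[OF ind] indep_var_rv2[OF ind])+
  interpret Y: prob_space "distr M borel Y"
    by (rule prob_space_distr) measurable
  have "(\<integral>\<^sup>+\<omega>. X \<omega> * Y \<omega> \<partial>M)
      = (\<integral>\<^sup>+p. fst p * snd p \<partial>distr M (borel \<Otimes>\<^sub>M borel) (\<lambda>\<omega>. (X \<omega>, Y \<omega>)))"
    by (subst nn_integral_distr) auto
  also have "distr M (borel \<Otimes>\<^sub>M borel) (\<lambda>\<omega>. (X \<omega>, Y \<omega>)) = distr M borel X \<Otimes>\<^sub>M distr M borel Y"
    using ind by (simp add: indep_var_distribution_eq)
  also have "(\<integral>\<^sup>+p. fst p * snd p \<partial>(distr M borel X \<Otimes>\<^sub>M distr M borel Y))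
      = (\<integral>\<^sup>+x. (\<integral>\<^sup>+y. x * y \<partial>distr M borel Y) \<partial>distr M borel X)"
    by (subst Y.nn_integral_fst[symmetric]) auto
  also have "\<dots> = (\<integral>\<^sup>+x. x \<partial>distr M borel X) * (\<integral>\<^sup>+y. y \<partial>distr M borel Y)"
    by (simp add: nn_integral_cmult nn_integral_multc)
  finally show ?thesis by (simp add: nn_integral_distr)
qed

text \<open>Measurability and value are bundled in one conjunction, so that each of the inductions
  below can carry both at once.\<close>

lemma measurable_nn_integral_cong:
  assumes "\<And>\<omega>. \<omega> \<in> space M \<Longrightarrow> F \<omega> = G \<omega>"
    and "G \<in> borel_measurable M \<and> (\<integral>\<^sup>+\<omega>. G \<omega> \<partial>M) = r"
  shows "F \<in> borel_measurable M \<and> (\<integral>\<^sup>+\<omega>. F \<omega> \<partial>M) = (r :: ennreal)"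
proof
  show "F \<in> borel_measurable M"
    by (rule measurable_cong[THEN iffD2, OF assms(1)]) (use assms(2) in blast)+
  show "(\<integral>\<^sup>+\<omega>. F \<omega> \<partial>M) = r"
    by (rule trans[OF nn_integral_cong[OF assms(1)]]) (use assms(2) in blast)+
qed

text \<open>Agreement of the averaged kernel with \<open>I\<close> on sets passes to nonnegative
  functions by monotone approximation. It is applied to \<open>N\<close>, to the kernel of lifted
  points in the compensation formula and, with a null measure, as a pure measurability
  statement.\<close>

lemma nn_integral_kernel:
  fixes K :: "'w \<Rightarrow> 'a measure"
  assumes K: "\<And>\<omega>. \<omega> \<in> space M \<Longrightarrow> sets (K \<omega>) = sets I"
    and Km: "\<And>A. A \<in> sets I \<Longrightarrow> (\<lambda>\<omega>. emeasure (K \<omega>) A) \<in> borel_measurable M"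
    and Ki: "\<And>A. A \<in> sets I \<Longrightarrow> (\<integral>\<^sup>+\<omega>. emeasure (K \<omega>) A \<partial>M) = emeasure I A"
    and g: "g \<in> borel_measurable I"
  shows "(\<lambda>\<omega>. \<integral>\<^sup>+x. g x \<partial>K \<omega>) \<in> borel_measurable M"
    and "(\<integral>\<^sup>+\<omega>. (\<integral>\<^sup>+x. g x \<partial>K \<omega>) \<partial>M) = (\<integral>\<^sup>+x. g x \<partial>I)"
proof -
  have "(\<lambda>\<omega>. \<integral>\<^sup>+x. g x \<partial>K \<omega>) \<in> borel_measurable M \<and> (\<integral>\<^sup>+\<omega>. (\<integral>\<^sup>+x. g x \<partial>K \<omega>) \<partial>M) = (\<integral>\<^sup>+x. g x \<partial>I)"
    using g
  proof (induction rule: borel_measurable_induct)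
    case (cong f g)
    have *: "(\<integral>\<^sup>+x. f x \<partial>K \<omega>) = (\<integral>\<^sup>+x. g x \<partial>K \<omega>)" if "\<omega> \<in> space M" for \<omega>
      using cong(3) by (intro nn_integral_cong) (simp add: sets_eq_imp_space_eq[OF K[OF that]])
    have "(\<integral>\<^sup>+x. f x \<partial>I) = (\<integral>\<^sup>+x. g x \<partial>I)"
      using cong(3) by (intro nn_integral_cong)
    with cong(4) have "(\<lambda>\<omega>. \<integral>\<^sup>+x. g x \<partial>K \<omega>) \<in> borel_measurable M \<and>
        (\<integral>\<^sup>+\<omega>. (\<integral>\<^sup>+x. g x \<partial>K \<omega>) \<partial>M) = (\<integral>\<^sup>+x. f x \<partial>I)" by simp
    from measurable_nn_integral_cong[OF * this] show ?case .
  next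
    case (set A)
    have *: "(\<integral>\<^sup>+x. indicator A x \<partial>K \<omega>) = emeasure (K \<omega>) A" if "\<omega> \<in> space M" for \<omega>
      using set by (intro nn_integral_indicator) (simp add: K[OF that])
    have "(\<integral>\<^sup>+\<omega>. emeasure (K \<omega>) A \<partial>M) = (\<integral>\<^sup>+x. indicator A x \<partial>I)"
      using set by (simp add: Ki)
    from measurable_nn_integral_cong[OF * conjI[OF Km[OF set] this]]
    show ?case .
  next
    case (mult u c)
    have *: "(\<integral>\<^sup>+x. c * u x \<partial>K \<omega>) = c * (\<integral>\<^sup>+x. u x \<partial>K \<omega>)" if "\<omega> \<in> space M" for \<omega>
      using mult(2) unfolding measurable_cong_sets[OF K[OF that, symmetric] refl] by (rule nn_integral_cmult)
    have m: "(\<lambda>\<omega>. c * (\<integral>\<^sup>+x. u x \<partial>K \<omega>)) \<in> borel_measurable M"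
      using mult(4) by (intro borel_measurable_times_ennreal borel_measurable_const) blast
    have "(\<integral>\<^sup>+\<omega>. c * (\<integral>\<^sup>+x. u x \<partial>K \<omega>) \<partial>M) = (\<integral>\<^sup>+x. c * u x \<partial>I)"
      using mult(2,4) by (simp add: nn_integral_cmult)
    from measurable_nn_integral_cong[OF * conjI[OF m this]] show ?case .
  next
    case (add u v)
    have *: "(\<integral>\<^sup>+x. v x + u x \<partial>K \<omega>) = (\<integral>\<^sup>+x. v x \<partial>K \<omega>) + (\<integral>\<^sup>+x. u x \<partial>K \<omega>)" if "\<omega> \<in> space M" for \<omega>
      using add(3,1) unfolding measurable_cong_sets[OF K[OF that, symmetric] refl] by (rule nn_integral_add)
    have m: "(\<lambda>\<omega>. (\<integral>\<^sup>+x. v x \<partial>K \<omega>) + (\<integral>\<^sup>+x. u x \<partial>K \<omega>)) \<in> borel_measurable M"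
      using add.IH by (intro borel_measurable_add) blast+
    have "(\<integral>\<^sup>+\<omega>. (\<integral>\<^sup>+x. v x \<partial>K \<omega>) + (\<integral>\<^sup>+x. u x \<partial>K \<omega>) \<partial>M) = (\<integral>\<^sup>+x. v x + u x \<partial>I)"
      using add(1,3) add.IH by (simp add: nn_integral_add)
    from measurable_nn_integral_cong[OF * conjI[OF m this]] show ?case .
  next
    case (seq U)
    have sup: "(\<integral>\<^sup>+x. (SUP i. U i) x \<partial>L) = (SUP i. \<integral>\<^sup>+x. U i x \<partial>L)" if "sets L = sets I" for L
    proof -
      have "(\<integral>\<^sup>+x. (SUP i. U i) x \<partial>L) = (\<integral>\<^sup>+x. (SUP i. U i x) \<partial>L)"
        by (simp only: SUP_apply)
      also have "\<dots> = (SUP i. \<integral>\<^sup>+x. U i x \<partial>L)"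
      proof (rule nn_integral_monotone_convergence_SUP[OF seq(3)])
        show "U i \<in> borel_measurable L" for i
          using seq(1)[of i] unfolding measurable_cong_sets[OF that refl] .
      qed
      finally show ?thesis .
    qed
    have meas: "(\<lambda>\<omega>. \<integral>\<^sup>+x. U i x \<partial>K \<omega>) \<in> borel_measurable M" for i
      using seq.IH[of i] by blast
    have "(\<integral>\<^sup>+\<omega>. (SUP i. \<integral>\<^sup>+x. U i x \<partial>K \<omega>) \<partial>M) = (SUP i. \<integral>\<^sup>+\<omega>. (\<integral>\<^sup>+x. U i x \<partial>K \<omega>) \<partial>M)"
    proof (rule nn_integral_monotone_convergence_SUP[OF _ meas])
      show "incseq (\<lambda>i \<omega>. \<integral>\<^sup>+x. U i x \<partial>K \<omega>)"
      proof (intro incseq_SucI le_funI nn_integral_mono)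
        show "U i x \<le> U (Suc i) x" for i x
          using incseq_SucD[OF seq(3), of i] by (rule le_funD)
      qed
    qed
    also have "\<dots> = (SUP i. \<integral>\<^sup>+x. U i x \<partial>I)"
      using seq.IH by (intro SUP_cong refl) blast
    also have "\<dots> = (\<integral>\<^sup>+x. (SUP i. U i) x \<partial>I)"
      using sup[OF refl] by (rule sym)
    finally have 1: "(\<integral>\<^sup>+\<omega>. (SUP i. \<integral>\<^sup>+x. U i x \<partial>K \<omega>) \<partial>M) = (\<integral>\<^sup>+x. (SUP i. U i) x \<partial>I)" .
    have 2: "(\<lambda>\<omega>. SUP i. \<integral>\<^sup>+x. U i x \<partial>K \<omega>) \<in> borel_measurable M"
      by (intro borel_measurable_SUP meas) auto
    show ?case
      by (rule measurable_nn_integral_cong[OF sup[OF K] conjI[OF 2 1]])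
  qed
  then show "(\<lambda>\<omega>. \<integral>\<^sup>+x. g x \<partial>K \<omega>) \<in> borel_measurable M"
    and "(\<integral>\<^sup>+\<omega>. (\<integral>\<^sup>+x. g x \<partial>K \<omega>) \<partial>M) = (\<integral>\<^sup>+x. g x \<partial>I)" by auto
qed

text \<open>Dynkin's argument from a pi-system. Finiteness of every \<open>K \<omega>\<close> and of
  \<open>I\<close> is what allows complements to be treated by subtraction.\<close>

lemma emeasure_kernel_generator:
  fixes K :: "'w \<Rightarrow> 'a measure"
  assumes K: "\<And>\<omega>. \<omega> \<in> space M \<Longrightarrow> sets (K \<omega>) = sets I"
    and fin: "\<And>\<omega>. \<omega> \<in> space M \<Longrightarrow> emeasure (K \<omega>) (space I) < \<infinity>" "emeasure I (space I) < \<infinity>"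
    and G: "Int_stable G" "G \<subseteq> Pow (space I)" "sets I = sigma_sets (space I) G"
    and gen: "\<And>A. A \<in> G \<or> A = space I \<Longrightarrow> (\<lambda>\<omega>. emeasure (K \<omega>) A) \<in> borel_measurable M \<and>
      (\<integral>\<^sup>+\<omega>. emeasure (K \<omega>) A \<partial>M) = emeasure I A"
    and A: "A \<in> sets I"
  shows "(\<lambda>\<omega>. emeasure (K \<omega>) A) \<in> borel_measurable M \<and>
      (\<integral>\<^sup>+\<omega>. emeasure (K \<omega>) A \<partial>M) = emeasure I A"
  using G(1,2) A[unfolded G(3)]
proof (induction rule: sigma_sets_induct_disjoint)
  case (basic A)
  then show ?case by (intro gen) (rule disjI1)
next
  case empty
  show ?case by simp
next
  case (compl A)
  have A: "A \<in> sets I" unfolding G(3) by (rule compl(1))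
  note top = gen[OF disjI2[OF refl]]
  have le: "emeasure (K \<omega>) A \<le> emeasure (K \<omega>) (space I)" if "\<omega> \<in> space M" for \<omega>
    using A K[OF that] by (intro emeasure_mono sets.sets_into_space) auto
  have Afin: "emeasure I A \<noteq> \<infinity>"
    using fin(2) emeasure_space[of I A] by auto
  have eq: "emeasure (K \<omega>) (space I - A) = emeasure (K \<omega>) (space I) - emeasure (K \<omega>) A" if "\<omega> \<in> space M" for \<omega>
  proof -
    have "emeasure (K \<omega>) A \<noteq> \<infinity>"
      using le[OF that] fin(1)[OF that] by (auto simp: less_top[symmetric] top_unique)
    then show ?thesis
      using A emeasure_compl[of A "K \<omega>"] by (simp add: K[OF that] sets_eq_imp_space_eq[OF K[OF that]])
  qed
  have m: "(\<lambda>\<omega>. emeasure (K \<omega>) (space I) - emeasure (K \<omega>) A) \<in> borel_measurable M"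
    by (intro borel_measurable_minus_ennreal conjunct1[OF top] conjunct1[OF compl.IH])
  have "(\<integral>\<^sup>+\<omega>. emeasure (K \<omega>) (space I) - emeasure (K \<omega>) A \<partial>M)
      = (\<integral>\<^sup>+\<omega>. emeasure (K \<omega>) (space I) \<partial>M) - (\<integral>\<^sup>+\<omega>. emeasure (K \<omega>) A \<partial>M)"
    using Afin le conjunct2[OF compl.IH]
    by (intro nn_integral_diff conjunct1[OF top] conjunct1[OF compl.IH] AE_I2) simp_all
  also have "\<dots> = emeasure I (space I) - emeasure I A"
    by (simp only: conjunct2[OF top] conjunct2[OF compl.IH])
  also have "\<dots> = emeasure I (space I - A)"
    by (rule emeasure_compl[OF A Afin, symmetric])
  finally show ?case
    by (intro measurable_nn_integral_cong[OF eq] conjI m)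
next
  case (union A)
  have sets: "range A \<subseteq> sets I" unfolding G(3) by (rule union(2))
  have eq: "emeasure (K \<omega>) (\<Union>i. A i) = (\<Sum>i. emeasure (K \<omega>) (A i))" if "\<omega> \<in> space M" for \<omega>
    using sets K[OF that] union(1) by (intro suminf_emeasure[symmetric]) auto
  note m = conjunct1[OF union.IH]
  have "(\<integral>\<^sup>+\<omega>. (\<Sum>i. emeasure (K \<omega>) (A i)) \<partial>M) = (\<Sum>i. \<integral>\<^sup>+\<omega>. emeasure (K \<omega>) (A i) \<partial>M)"
    by (rule nn_integral_suminf[OF m])
  also have "\<dots> = (\<Sum>i. emeasure I (A i))"
    by (simp only: conjunct2[OF union.IH])
  also have "\<dots> = emeasure I (\<Union>i. A i)"
    by (rule suminf_emeasure[OF sets union(1)])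
  finally show ?case
    by (intro measurable_nn_integral_cong[OF eq] conjI borel_measurable_suminf_order m)
qed

locale poisson_rm =
  fixes M :: "'w measure" and I :: "'a measure" and N :: "'w \<Rightarrow> 'a measure"
  assumes poisson: "poisson_random_measure M I N"
begin

sublocale prob_space M
  using poisson by (simp add: poisson_random_measure_def)

lemma sets_N: "\<omega> \<in> space M \<Longrightarrow> sets (N \<omega>) = sets I"
  using poisson by (simp add: poisson_random_measure_def)

lemma space_N: "\<omega> \<in> space M \<Longrightarrow> space (N \<omega>) = space I"
  by (rule sets_eq_imp_space_eq[OF sets_N])

lemma measurable_emeasure_N:
  "A \<in> sets I \<Longrightarrow> (\<lambda>\<omega>. emeasure (N \<omega>) A) \<in> borel_measurable M"
  using poisson by (simp add: poisson_random_measure_def)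

lemma prob_N_eq:
  "A \<in> sets I \<Longrightarrow> emeasure I A < \<infinity> \<Longrightarrow> prob {\<omega>\<in>space M. emeasure (N \<omega>) A = of_nat k} =
           measure I A ^ k / fact k * exp (- measure I A)"
  using poisson by (simp add: poisson_random_measure_def)

lemma N_eq_infinity:
  "A \<in> sets I \<Longrightarrow> emeasure I A = \<infinity> \<Longrightarrow> AE \<omega> in M. emeasure (N \<omega>) A = \<infinity>"
  using poisson by (simp add: poisson_random_measure_def)

lemma indep_N:
  fixes A :: "nat \<Rightarrow> 'a set"
  shows "range A \<subseteq> sets I \<Longrightarrow> disjoint_family A \<Longrightarrow> indep_vars (\<lambda>_. borel) (\<lambda>i \<omega>. emeasure (N \<omega>) (A i)) UNIV"
  using poisson by (simp add: poisson_random_measure_def)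

text \<open>The Poisson weights sum to 1, so the events on which the count equals a given natural
  number exhaust the space up to a null set.\<close>

lemma AE_N_nat:
  assumes A: "A \<in> sets I" "emeasure I A < \<infinity>"
  shows "AE \<omega> in M. \<exists>k::nat. emeasure (N \<omega>) A = of_nat k"
proof -
  note [measurable] = measurable_emeasure_N[OF A(1)]
  define S where "S k = {\<omega>\<in>space M. emeasure (N \<omega>) A = of_nat k}" for k :: nat
  have [measurable]: "S k \<in> sets M" for k unfolding S_def by measurable
  have disj: "disjoint_family S"
    by (auto simp: disjoint_family_on_def S_def)
  have 1: "(\<lambda>k. prob (S k)) sums prob (\<Union>k. S k)"
    using disj by (intro finite_measure_UNION) auto
  have 2: "(\<lambda>k. prob (S k)) sums 1"
  proof -
    have "(\<lambda>k. measure I A ^ k / fact k * exp (- measure I A)) sums (exp (measure I A) * exp (- measure I A))"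
      using exp_converges[of "measure I A"] by (intro sums_mult2) (simp add: field_simps)
    then show ?thesis
      using prob_N_eq[OF A] by (simp add: S_def exp_minus)
  qed
  have "prob (\<Union>k. S k) = 1"
    by (rule sums_unique2[OF 1 2])
  then have "AE \<omega> in M. \<omega> \<in> (\<Union>k. S k)"
    by (intro prob_eq_1[THEN iffD1]) auto
  then show ?thesis by eventually_elim (auto simp: S_def)
qed

text \<open>Conditioning on the count of \<open>A\<close>: where it equals k, \<open>G\<close>
  coincides with \<open>g k\<close>, and independence splits each term into a Poisson weight and the
  mean of \<open>g k\<close>.\<close>

lemma nn_integral_N_indep:
  fixes g :: "nat \<Rightarrow> 'w \<Rightarrow> ennreal"
  assumes A: "A \<in> sets I" "emeasure I A < \<infinity>"
    and ind: "\<And>k. indep_var borel (\<lambda>\<omega>. emeasure (N \<omega>) A) borel (g k)"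
    and G: "\<And>\<omega> k. \<omega> \<in> space M \<Longrightarrow> emeasure (N \<omega>) A = of_nat k \<Longrightarrow> G \<omega> = g k \<omega>"
  shows "(\<integral>\<^sup>+\<omega>. G \<omega> \<partial>M)
    = (\<Sum>k. ennreal (measure I A ^ k / fact k * exp (- measure I A)) * (\<integral>\<^sup>+\<omega>. g k \<omega> \<partial>M))"
proof -
  note [measurable] = measurable_emeasure_N[OF A(1)]
  have [measurable]: "g k \<in> borel_measurable M" for k by (rule indep_var_rv2[OF ind])
  let ?S = "\<lambda>k \<omega>. indicator {of_nat k} (emeasure (N \<omega>) A) :: ennreal"
  have measS: "?S k \<in> borel_measurable M" for k
    by (rule measurable_compose[OF measurable_emeasure_N[OF A(1)] borel_measurable_indicator]) simp
  have "(\<integral>\<^sup>+\<omega>. G \<omega> \<partial>M) = (\<integral>\<^sup>+\<omega>. (\<Sum>k. ?S k \<omega> * g k \<omega>) \<partial>M)"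
  proof (rule nn_integral_cong_AE)
    show "AE \<omega> in M. G \<omega> = (\<Sum>k. ?S k \<omega> * g k \<omega>)"
      using AE_N_nat[OF A] AE_space
    proof eventually_elim
      case (elim \<omega>)
      then obtain k where k: "emeasure (N \<omega>) A = of_nat k" by auto
      have "(\<Sum>j. ?S j \<omega> * g j \<omega>) = (\<Sum>j\<in>{k}. ?S j \<omega> * g j \<omega>)"
        by (rule suminf_finite) (simp_all add: k)
      also have "\<dots> = g k \<omega>"
        by (simp add: k)
      finally show ?case using G[OF elim(2) k] by (rule trans[OF _ sym, rotated])
    qed
  qed
  also have "\<dots> = (\<Sum>k. \<integral>\<^sup>+\<omega>. ?S k \<omega> * g k \<omega> \<partial>M)"
    by (rule nn_integral_suminf) (rule borel_measurable_times_ennreal[OF measS \<open>\<And>k. g k \<in> borel_measurable M\<close>])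
  also have "\<dots> = (\<Sum>k. ennreal (measure I A ^ k / fact k * exp (- measure I A)) * (\<integral>\<^sup>+\<omega>. g k \<omega> \<partial>M))"
  proof (rule suminf_cong)
    fix k
    have "indicator {of_nat k} \<in> borel_measurable (borel :: ennreal measure)"
      by (rule borel_measurable_indicator) simp
    from indep_var_compose[OF ind[of k] this measurable_ident]
    have "indep_var borel (?S k) borel (g k)"
      by (simp only: comp_def id_apply)
    note * = indep_var_nn_integral_mult[OF this]
    have "(\<integral>\<^sup>+\<omega>. ?S k \<omega> \<partial>M) = (\<integral>\<^sup>+\<omega>. indicator {\<omega>\<in>space M. emeasure (N \<omega>) A = of_nat k} \<omega> \<partial>M)"
      by (intro nn_integral_cong) (auto simp: indicator_def)
    also have "\<dots> = emeasure M {\<omega>\<in>space M. emeasure (N \<omega>) A = of_nat k}"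
      by (rule nn_integral_indicator) measurable
    also have "\<dots> = ennreal (measure I A ^ k / fact k * exp (- measure I A))"
      by (simp add: emeasure_eq_measure prob_N_eq[OF A])
    finally show "(\<integral>\<^sup>+\<omega>. ?S k \<omega> * g k \<omega> \<partial>M) = ennreal (measure I A ^ k / fact k * exp (- measure I A)) * (\<integral>\<^sup>+\<omega>. g k \<omega> \<partial>M)"
      unfolding * by simp
  qed
  finally show ?thesis .
qed

text \<open>Index 0 is set apart from the rest. Later uses of independence are brought to this form
  by choosing a suitable sequence of disjoint sets.\<close>

lemma indep_N_pair:
  fixes A :: "nat \<Rightarrow> 'a set"
  assumes A: "range A \<subseteq> sets I" "disjoint_family A" and F: "F \<in> borel_measurable (Pi\<^sub>M {1..} (\<lambda>_. borel))"
  shows "indep_var borel (\<lambda>\<omega>. emeasure (N \<omega>) (A 0))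
    borel (\<lambda>\<omega>. F (restrict (\<lambda>i. emeasure (N \<omega>) (A i)) {1..}) :: ennreal)"
proof -
  have "indep_var (Pi\<^sub>M {0} (\<lambda>_. borel)) (\<lambda>\<omega>. restrict (\<lambda>i. emeasure (N \<omega>) (A i)) {0})
      (Pi\<^sub>M {1..} (\<lambda>_. borel)) (\<lambda>\<omega>. restrict (\<lambda>i. emeasure (N \<omega>) (A i)) {1..})"
    by (rule indep_var_restrict[OF indep_N[OF A]]) auto
  from indep_var_compose[OF this, of "\<lambda>x. x 0" borel F borel] F
  show ?thesis by (simp add: comp_def)
qed

lemma indep_N_const:
  assumes A: "A \<in> sets I"
  shows "indep_var borel (\<lambda>\<omega>. emeasure (N \<omega>) A) borel (\<lambda>\<omega>. c :: ennreal)"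
proof -
  have "range (\<lambda>i::nat. if i = 0 then A else {}) \<subseteq> sets I" using A by auto
  moreover have "disjoint_family (\<lambda>i::nat. if i = 0 then A else {})"
    by (auto simp: disjoint_family_on_def)
  ultimately show ?thesis
    using indep_N_pair[of "\<lambda>i. if i = 0 then A else {}" "\<lambda>_. c"] by simp
qed

lemma nn_integral_emeasure_N:
  assumes A: "A \<in> sets I"
  shows "(\<integral>\<^sup>+\<omega>. emeasure (N \<omega>) A \<partial>M) = emeasure I A"
proof (cases "emeasure I A = \<infinity>")
  case True
  then have "(\<integral>\<^sup>+\<omega>. emeasure (N \<omega>) A \<partial>M) = (\<integral>\<^sup>+\<omega>. \<infinity> \<partial>M)"
    using N_eq_infinity[OF A] by (intro nn_integral_cong_AE) auto
  then show ?thesis using True by (simp add: emeasure_space_1)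
next
  case False
  then have fin: "emeasure I A < \<infinity>" by (simp add: less_top)
  have "(\<integral>\<^sup>+\<omega>. emeasure (N \<omega>) A \<partial>M) = (\<Sum>k. ennreal (measure I A ^ k / fact k * exp (- measure I A)) * of_nat k)"
    using nn_integral_N_indep[where g="\<lambda>k _. of_nat k" and G="\<lambda>\<omega>. emeasure (N \<omega>) A", OF A fin indep_N_const[OF A]]
    by (simp add: emeasure_space_1)
  also have "\<dots> = ennreal (measure I A) * (\<Sum>k. ennreal (measure I A ^ k / fact k * exp (- measure I A)))"
    using poisson_shift_nn[OF measure_nonneg, where h="\<lambda>_. 1"] by (simp only: mult_1_right)
  also have "(\<Sum>k. ennreal (measure I A ^ k / fact k * exp (- measure I A))) = 1"
  proof -
    have "(\<lambda>k. measure I A ^ k / fact k * exp (- measure I A)) sums (exp (measure I A) * exp (- measure I A))"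
      using exp_converges[of "measure I A"] by (intro sums_mult2) (simp add: field_simps)
    then have "(\<Sum>k. ennreal (measure I A ^ k / fact k * exp (- measure I A))) = ennreal (exp (measure I A) * exp (- measure I A))"
      by (intro suminf_ennreal_eq) auto
    then show ?thesis by (simp add: exp_minus)
  qed
  finally show ?thesis using False by (simp add: emeasure_eq_ennreal_measure)
qed

text \<open>This is Campbell's formula for the mean of a sum over the points.\<close>

lemma nn_integral_N:
  assumes g: "g \<in> borel_measurable I"
  shows "(\<lambda>\<omega>. \<integral>\<^sup>+x. g x \<partial>N \<omega>) \<in> borel_measurable M"
    and "(\<integral>\<^sup>+\<omega>. (\<integral>\<^sup>+x. g x \<partial>N \<omega>) \<partial>M) = (\<integral>\<^sup>+x. g x \<partial>I)"
  by (rule nn_integral_kernel[where K=N and I=I, OF sets_N measurable_emeasure_N nn_integral_emeasure_N g]; assumption)+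

end

section \<open>Normal approximation on the first Poisson chaos\<close>

context poisson_rm
begin

lemma measure_N_integrable:
  assumes A: "A \<in> sets I" "emeasure I A < \<infinity>"
  shows "integrable M (\<lambda>\<omega>. enn2real (emeasure (N \<omega>) A))"
    and "(\<integral>\<omega>. enn2real (emeasure (N \<omega>) A) \<partial>M) = measure I A"
    and "AE \<omega> in M. ennreal (enn2real (emeasure (N \<omega>) A)) = emeasure (N \<omega>) A"
proof -
  note [measurable] = measurable_emeasure_N[OF A(1)]
  show ae: "AE \<omega> in M. ennreal (enn2real (emeasure (N \<omega>) A)) = emeasure (N \<omega>) A"
    using AE_N_nat[OF A] by eventually_elim (auto simp: ennreal_of_nat_eq_real_of_nat)
  have "(\<integral>\<^sup>+\<omega>. ennreal (enn2real (emeasure (N \<omega>) A)) \<partial>M) = ennreal (measure I A)"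
    using nn_integral_cong_AE[OF ae] nn_integral_emeasure_N[OF A(1)] A(2)
    by (simp add: emeasure_eq_ennreal_measure)
  then have "has_bochner_integral M (\<lambda>\<omega>. enn2real (emeasure (N \<omega>) A)) (measure I A)"
    by (intro has_bochner_integral_nn_integral) auto
  then show "integrable M (\<lambda>\<omega>. enn2real (emeasure (N \<omega>) A))"
    and "(\<integral>\<omega>. enn2real (emeasure (N \<omega>) A) \<partial>M) = measure I A"
    by (auto simp: has_bochner_integral_iff)
qed

text \<open>Size-biasing a Poisson count adds one point. A further point in \<open>A j\<close>
  leaves the other cells untouched and raises \<open>F\<close> by \<open>c j\<close>; this is
  Mecke's formula for an integrand that sees only finitely many disjoint cells.\<close>

lemma poisson_size_bias_nn:
  fixes A :: "'j \<Rightarrow> 'a set" and c :: "'j \<Rightarrow> real" and f :: "real \<Rightarrow> ennreal"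
  assumes J: "finite J" "j \<in> J" and A: "\<And>i. i \<in> J \<Longrightarrow> A i \<in> sets I"
    "\<And>i. i \<in> J \<Longrightarrow> emeasure I (A i) < \<infinity>" "disjoint_family_on A J"
    and f: "f \<in> borel_measurable borel"
  defines "F \<equiv> \<lambda>\<omega>. \<Sum>i\<in>J. c i * (enn2real (emeasure (N \<omega>) (A i)) - measure I (A i))"
  shows "(\<integral>\<^sup>+\<omega>. emeasure (N \<omega>) (A j) * f (F \<omega>) \<partial>M) = measure I (A j) * (\<integral>\<^sup>+\<omega>. f (F \<omega> + c j) \<partial>M)"
proof -
  define n where "n = card (J - {j})"
  obtain e where e: "bij_betw e {..<n} (J - {j})"
    using ex_bij_betw_nat_finite[of "J - {j}"] J by (auto simp: n_def atLeast0LessThan)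
  have eJ: "e i \<in> J" "e i \<noteq> j" if "i < n" for i
    using bij_betwE[OF e] that by auto
  have einj: "e i \<noteq> e k" if "i < n" "k < n" "i \<noteq> k" for i k
    using bij_betw_imp_inj_on[OF e] that by (auto simp: inj_on_def)
  \<comment> \<open>The biased cell takes index 0 and the other cells the indices 1 to
    \<open>n\<close>; empty sets fill up the infinite sequence that \<open>indep_N_pair\<close>
    expects.\<close>
  define B where "B i = (case i of 0 \<Rightarrow> A j | Suc k \<Rightarrow> if k < n then A (e k) else {})" for i
  have B0: "B 0 = A j" and BS: "k < n \<Longrightarrow> B (Suc k) = A (e k)" for k
    by (simp_all add: B_def)
  have B: "range B \<subseteq> sets I"
    using A(1) J(2) eJ by (auto simp: B_def split: nat.splits)
  have disj: "disjoint_family B"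
  proof -
    have d: "A a \<inter> A b = {}" if "a \<in> J" "b \<in> J" "a \<noteq> b" for a b
      using A(3) that by (auto simp: disjoint_family_on_def)
    have d0: "B 0 \<inter> B (Suc k) = {}" for k
      using d[of j "e k"] eJ[of k] J(2) by (auto simp: B_def)
    have dS: "B (Suc k) \<inter> B (Suc l) = {}" if "k \<noteq> l" for k l
      using d[of "e k" "e l"] eJ[of k] eJ[of l] einj[of k l] that by (auto simp: B_def)
    show ?thesis
      unfolding disjoint_family_on_def
    proof (intro ballI impI)
      fix a b :: nat assume "a \<noteq> b"
      then show "B a \<inter> B b = {}"
        using d0 dS by (cases a; cases b) (simp_all add: Int_commute)
    qed
  qed
  define R where "R x = (\<Sum>i<n. c (e i) * (enn2real (x (Suc i)) - measure I (A (e i))))" for x :: "nat \<Rightarrow> ennreal"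
  have Rm: "R \<in> borel_measurable (Pi\<^sub>M {1..} (\<lambda>_. borel))"
    unfolding R_def[abs_def]
    by (intro borel_measurable_sum borel_measurable_times borel_measurable_diff borel_measurable_const
        measurable_compose[OF measurable_component_singleton borel_measurable_enn2real]) auto
  define G where "G k \<omega> = f (c j * (real k - measure I (A j)) + R (restrict (\<lambda>i. emeasure (N \<omega>) (B i)) {1..}))" for k \<omega>
  have Gind: "indep_var borel (\<lambda>\<omega>. emeasure (N \<omega>) (A j)) borel (G k)" for k
  proof -
    have "(\<lambda>x. f (c j * (real k - measure I (A j)) + R x)) \<in> borel_measurable (Pi\<^sub>M {1..} (\<lambda>_. borel))"
      by (rule measurable_compose[OF borel_measurable_add[OF borel_measurable_const Rm] f])
    from indep_N_pair[OF B disj this] show ?thesis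
      unfolding B0 G_def[abs_def] .
  qed
  have FG: "F \<omega> = c j * (real k - measure I (A j)) + R (restrict (\<lambda>i. emeasure (N \<omega>) (B i)) {1..})"
    if "emeasure (N \<omega>) (A j) = of_nat k" for k \<omega>
  proof -
    have "F \<omega> = c j * (real k - measure I (A j))
        + (\<Sum>i\<in>J - {j}. c i * (enn2real (emeasure (N \<omega>) (A i)) - measure I (A i)))"
      unfolding F_def using J that by (subst sum.remove[of J j]) (auto simp: ennreal_of_nat_eq_real_of_nat)
    also have "(\<Sum>i\<in>J - {j}. c i * (enn2real (emeasure (N \<omega>) (A i)) - measure I (A i)))
        = R (restrict (\<lambda>i. emeasure (N \<omega>) (B i)) {1..})"
      unfolding R_def by (subst sum.reindex_bij_betw[OF e, symmetric]) (auto simp: BS)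
    finally show ?thesis .
  qed
  have j: "A j \<in> sets I" "emeasure I (A j) < \<infinity>" using A J by auto
  have Gm: "G k \<in> borel_measurable M" for k
    by (rule indep_var_rv2[OF Gind])
  let ?p = "\<lambda>k. ennreal (measure I (A j) ^ k / fact k * exp (- measure I (A j)))"
  have "(\<integral>\<^sup>+\<omega>. emeasure (N \<omega>) (A j) * f (F \<omega>) \<partial>M) = (\<Sum>k. ?p k * (\<integral>\<^sup>+\<omega>. of_nat k * G k \<omega> \<partial>M))"
  proof (rule nn_integral_N_indep[OF j])
    show "indep_var borel (\<lambda>\<omega>. emeasure (N \<omega>) (A j)) borel (\<lambda>\<omega>. of_nat k * G k \<omega>)" for k
    proof -
      have "(\<lambda>x. of_nat k * x :: ennreal) \<in> borel_measurable borel" by measurable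
      from indep_var_compose[OF Gind[of k] measurable_ident this] show ?thesis
        by (simp only: comp_def id_apply)
    qed
    show "emeasure (N \<omega>) (A j) * f (F \<omega>) = of_nat k * G k \<omega>" if "emeasure (N \<omega>) (A j) = of_nat k" for \<omega> k
      unfolding G_def FG[OF that, symmetric] that by (rule refl)
  qed
  also have "\<dots> = (\<Sum>k. ?p k * (of_nat k * (\<integral>\<^sup>+\<omega>. G k \<omega> \<partial>M)))"
    by (intro suminf_cong arg_cong[where f="\<lambda>x. _ * x"] nn_integral_cmult Gm)
  also have "\<dots> = ennreal (measure I (A j)) * (\<Sum>k. ?p k * (\<integral>\<^sup>+\<omega>. G (Suc k) \<omega> \<partial>M))"
    by (rule poisson_shift_nn[OF measure_nonneg])
  also have "(\<Sum>k. ?p k * (\<integral>\<^sup>+\<omega>. G (Suc k) \<omega> \<partial>M)) = (\<integral>\<^sup>+\<omega>. f (F \<omega> + c j) \<partial>M)"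
  proof (rule nn_integral_N_indep[OF j Gind, symmetric])
    show "f (F \<omega> + c j) = G (Suc k) \<omega>" if "emeasure (N \<omega>) (A j) = of_nat k" for \<omega> k
      unfolding G_def FG[OF that] by (rule arg_cong[where f=f]) (simp add: algebra_simps)
  qed
  finally show ?thesis .
qed

text \<open>The version in [0,\<infinity>] is applied to \<open>f + b\<close>, which is nonnegative;
  the constant \<open>b\<close> contributes \<open>b\<close> times the mean count on both sides and
  cancels.\<close>

lemma poisson_size_bias:
  fixes A :: "'j \<Rightarrow> 'a set" and c :: "'j \<Rightarrow> real" and f :: "real \<Rightarrow> real"
  assumes J: "finite J" "j \<in> J" and A: "\<And>i. i \<in> J \<Longrightarrow> A i \<in> sets I"
    "\<And>i. i \<in> J \<Longrightarrow> emeasure I (A i) < \<infinity>" "disjoint_family_on A J"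
    and f: "f \<in> borel_measurable borel" and b: "\<And>x. \<bar>f x\<bar> \<le> b"
  defines "F \<equiv> \<lambda>\<omega>. \<Sum>i\<in>J. c i * (enn2real (emeasure (N \<omega>) (A i)) - measure I (A i))"
  shows "F \<in> borel_measurable M"
    and "integrable M (\<lambda>\<omega>. enn2real (emeasure (N \<omega>) (A j)) * f (F \<omega>))"
    and "(\<integral>\<omega>. enn2real (emeasure (N \<omega>) (A j)) * f (F \<omega>) \<partial>M) = measure I (A j) * (\<integral>\<omega>. f (F \<omega> + c j) \<partial>M)"
proof -
  let ?X = "\<lambda>\<omega>. enn2real (emeasure (N \<omega>) (A j))"
  have j: "A j \<in> sets I" "emeasure I (A j) < \<infinity>" using A J by auto
  note X = measure_N_integrable[OF j]
  show Fm: "F \<in> borel_measurable M"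
    unfolding F_def
    by (intro borel_measurable_sum borel_measurable_times borel_measurable_diff borel_measurable_const
        measurable_compose[OF measurable_emeasure_N borel_measurable_enn2real] A) auto
  have fm: "(\<lambda>\<omega>. f (F \<omega> + d)) \<in> borel_measurable M" for d
    by (rule measurable_compose[OF borel_measurable_add[OF Fm borel_measurable_const] f])
  have fm0: "(\<lambda>\<omega>. f (F \<omega>)) \<in> borel_measurable M"
    by (rule measurable_compose[OF Fm f])
  have Xm: "?X \<in> borel_measurable M" using X(1) by (rule borel_measurable_integrable)
  show int: "integrable M (\<lambda>\<omega>. ?X \<omega> * f (F \<omega>))"
  proof (rule Bochner_Integration.integrable_bound)
    show "integrable M (\<lambda>\<omega>. ?X \<omega> * b)" by (rule integrable_mult_left[OF X(1)])
    show "(\<lambda>\<omega>. ?X \<omega> * f (F \<omega>)) \<in> borel_measurable M"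
      by (rule borel_measurable_times[OF Xm fm0])
    show "AE \<omega> in M. norm (?X \<omega> * f (F \<omega>)) \<le> norm (?X \<omega> * b)"
      using b by (intro AE_I2) (auto simp: abs_mult intro!: mult_left_mono order_trans[OF b])
  qed
  have nn: "0 \<le> f x + b" for x using b[of x] by linarith
  have intf: "integrable M (\<lambda>\<omega>. f (F \<omega> + c j))"
    by (rule integrable_const_bound[where B=b, OF AE_I2 fm]) (use b in auto)
  have "(\<integral>\<^sup>+\<omega>. ennreal (?X \<omega> * (f (F \<omega>) + b)) \<partial>M) = (\<integral>\<^sup>+\<omega>. emeasure (N \<omega>) (A j) * ennreal (f (F \<omega>) + b) \<partial>M)"
  proof (rule nn_integral_cong_AE)
    show "AE \<omega> in M. ennreal (?X \<omega> * (f (F \<omega>) + b)) = emeasure (N \<omega>) (A j) * ennreal (f (F \<omega>) + b)"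
      using X(3)
    proof eventually_elim
      case (elim \<omega>)
      show ?case
        by (subst (2) elim[symmetric], rule ennreal_mult) (auto simp: nn)
    qed
  qed
  also have "\<dots> = measure I (A j) * (\<integral>\<^sup>+\<omega>. ennreal (f (F \<omega> + c j) + b) \<partial>M)"
    unfolding F_def by (rule poisson_size_bias_nn[OF J A]) (use f in measurable)
  also have "(\<integral>\<^sup>+\<omega>. ennreal (f (F \<omega> + c j) + b) \<partial>M) = ennreal (\<integral>\<omega>. f (F \<omega> + c j) + b \<partial>M)"
    using intf nn by (intro nn_integral_eq_integral) auto
  finally have "(\<integral>\<^sup>+\<omega>. ennreal (?X \<omega> * (f (F \<omega>) + b)) \<partial>M)
      = ennreal (measure I (A j)) * ennreal (\<integral>\<omega>. f (F \<omega> + c j) + b \<partial>M)" .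
  moreover have "(\<integral>\<^sup>+\<omega>. ennreal (?X \<omega> * (f (F \<omega>) + b)) \<partial>M) = ennreal (\<integral>\<omega>. ?X \<omega> * (f (F \<omega>) + b) \<partial>M)"
  proof (rule nn_integral_eq_integral)
    show "integrable M (\<lambda>\<omega>. ?X \<omega> * (f (F \<omega>) + b))"
      unfolding distrib_left by (intro Bochner_Integration.integrable_add int integrable_mult_left X(1))
  qed (auto simp: nn)
  ultimately have "ennreal (\<integral>\<omega>. ?X \<omega> * (f (F \<omega>) + b) \<partial>M)
      = ennreal (measure I (A j) * (\<integral>\<omega>. f (F \<omega> + c j) + b \<partial>M))"
    using nn by (simp add: ennreal_mult integral_nonneg_AE)
  then have "(\<integral>\<omega>. ?X \<omega> * (f (F \<omega>) + b) \<partial>M) = measure I (A j) * (\<integral>\<omega>. f (F \<omega> + c j) + b \<partial>M)"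
    using nn by (subst (asm) ennreal_inj) (auto intro!: integral_nonneg_AE mult_nonneg_nonneg)
  moreover have "(\<integral>\<omega>. ?X \<omega> * (f (F \<omega>) + b) \<partial>M) = (\<integral>\<omega>. ?X \<omega> * f (F \<omega>) \<partial>M) + measure I (A j) * b"
    unfolding distrib_left using int X(1,2) by (subst Bochner_Integration.integral_add) auto
  moreover have "(\<integral>\<omega>. f (F \<omega> + c j) + b \<partial>M) = (\<integral>\<omega>. f (F \<omega> + c j) \<partial>M) + b"
    using intf by (subst Bochner_Integration.integral_add) (auto simp: prob_space)
  ultimately show "(\<integral>\<omega>. ?X \<omega> * f (F \<omega>) \<partial>M) = measure I (A j) * (\<integral>\<omega>. f (F \<omega> + c j) \<partial>M)"
    by (simp add: distrib_left)
qed

end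

lemma abs_integral_le_integral:
  fixes f g :: "'a \<Rightarrow> real"
  assumes "integrable M f" "integrable M g" "\<And>x. \<bar>f x\<bar> \<le> g x"
  shows "\<bar>\<integral>x. f x \<partial>M\<bar> \<le> (\<integral>x. g x \<partial>M)"
  using assms by (intro order_trans[OF integral_abs_bound integral_mono]) auto

text \<open>The mean value theorem gives \<open>f'\<close> at an intermediate point, which differs
  from \<open>f' w\<close> by at most \<open>K * c\<close>. Integrating instead would halve the
  constant.\<close>

lemma taylor_lipschitz_deriv:
  fixes f f' :: "real \<Rightarrow> real"
  assumes "\<And>x. (f has_real_derivative f' x) (at x)" and "K-lipschitz_on UNIV f'" and c: "0 \<le> c"
  shows "\<bar>f (w + c) - f w - c * f' w\<bar> \<le> K * c\<^sup>2"
proof (cases "c = 0")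
  case False
  then have "w < w + c" using c by simp
  then obtain z where z: "w < z" "z < w + c" "f (w + c) - f w = (w + c - w) * f' z"
    using MVT2[of w "w + c" f f'] assms(1) by blast
  have "f (w + c) - f w - c * f' w = c * (f' z - f' w)"
    using z(3) by (simp add: algebra_simps)
  then have "\<bar>f (w + c) - f w - c * f' w\<bar> = c * \<bar>f' z - f' w\<bar>"
    using c by (simp add: abs_mult)
  also have "\<bar>f' z - f' w\<bar> \<le> K * \<bar>z - w\<bar>"
    using lipschitz_onD[OF assms(2), of z w] by (simp add: dist_real_def)
  also have "K * \<bar>z - w\<bar> \<le> K * c"
    using z lipschitz_on_nonneg[OF assms(2)] by (intro mult_left_mono) auto
  finally show ?thesis using c by (simp add: power2_eq_square mult_left_mono mult.left_commute)
qed simp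

context poisson_rm
begin

text \<open>If the integral in [0,\<infinity>] is infinite, the Bochner integral and
  \<open>enn2real\<close> both return 0, so the identity holds without an exceptional set.\<close>

lemma compensated_integral_eq:
  assumes "h \<in> borel_measurable I" "\<And>x. 0 \<le> h x" "\<omega> \<in> space M"
  shows "compensated_integral I N h \<omega> = enn2real (\<integral>\<^sup>+x. ennreal (h x) \<partial>N \<omega>) - (\<integral>x. h x \<partial>I)"
proof -
  have "h \<in> borel_measurable (N \<omega>)"
    using assms(1) unfolding measurable_cong_sets[OF sets_N[OF assms(3)] refl] .
  then have "(\<integral>x. h x \<partial>N \<omega>) = enn2real (\<integral>\<^sup>+x. ennreal (h x) \<partial>N \<omega>)"
    using assms(2) by (intro integral_eq_nn_integral) auto
  then show ?thesis by (simp add: compensated_integral_def)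
qed

lemma nn_integral_N_finite:
  assumes h: "integrable I h" "\<And>x. 0 \<le> h x"
  shows "AE \<omega> in M. (\<integral>\<^sup>+x. ennreal (h x) \<partial>N \<omega>) < \<infinity>"
    and "(\<lambda>\<omega>. enn2real (\<integral>\<^sup>+x. ennreal (h x) \<partial>N \<omega>)) \<in> borel_measurable M"
    and "integrable M (\<lambda>\<omega>. enn2real (\<integral>\<^sup>+x. ennreal (h x) \<partial>N \<omega>))"
    and "(\<integral>\<omega>. enn2real (\<integral>\<^sup>+x. ennreal (h x) \<partial>N \<omega>) \<partial>M) = (\<integral>x. h x \<partial>I)"
proof -
  have hm: "(\<lambda>x. ennreal (h x)) \<in> borel_measurable I"
    using borel_measurable_integrable[OF h(1)] by simp
  note m = nn_integral_N[OF hm]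
  have eq: "(\<integral>\<^sup>+\<omega>. (\<integral>\<^sup>+x. ennreal (h x) \<partial>N \<omega>) \<partial>M) = ennreal (\<integral>x. h x \<partial>I)"
    unfolding m(2) using h by (intro nn_integral_eq_integral) auto
  then have "(\<integral>\<^sup>+\<omega>. (\<integral>\<^sup>+x. ennreal (h x) \<partial>N \<omega>) \<partial>M) \<noteq> \<infinity>" by simp
  from nn_integral_noteq_infinite[OF m(1) this]
  show ae: "AE \<omega> in M. (\<integral>\<^sup>+x. ennreal (h x) \<partial>N \<omega>) < \<infinity>"
    by eventually_elim (simp add: less_top)
  show m': "(\<lambda>\<omega>. enn2real (\<integral>\<^sup>+x. ennreal (h x) \<partial>N \<omega>)) \<in> borel_measurable M"
    by (rule borel_measurable_enn2real[OF m(1)])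
  have ae': "AE \<omega> in M. ennreal (enn2real (\<integral>\<^sup>+x. ennreal (h x) \<partial>N \<omega>)) = (\<integral>\<^sup>+x. ennreal (h x) \<partial>N \<omega>)"
    using ae by eventually_elim (simp only: ennreal_enn2real infinity_ennreal_def)
  have "(\<integral>\<^sup>+\<omega>. ennreal (enn2real (\<integral>\<^sup>+x. ennreal (h x) \<partial>N \<omega>)) \<partial>M) = ennreal (\<integral>x. h x \<partial>I)"
    using nn_integral_cong_AE[OF ae'] eq by (rule trans)
  then have "has_bochner_integral M (\<lambda>\<omega>. enn2real (\<integral>\<^sup>+x. ennreal (h x) \<partial>N \<omega>)) (\<integral>x. h x \<partial>I)"
    by (intro has_bochner_integral_nn_integral m' AE_I2 enn2real_nonneg integral_nonneg_AE) (use h in auto)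
  then show "integrable M (\<lambda>\<omega>. enn2real (\<integral>\<^sup>+x. ennreal (h x) \<partial>N \<omega>))"
    and "(\<integral>\<omega>. enn2real (\<integral>\<^sup>+x. ennreal (h x) \<partial>N \<omega>) \<partial>M) = (\<integral>x. h x \<partial>I)"
    by (simp_all only: has_bochner_integral_iff)
qed

text \<open>The triangle inequality leaves the mean of the integral against \<open>N\<close> plus
  the integral against \<open>I\<close>, and these agree by Campbell's formula; hence the factor
  2.\<close>

lemma compensated_integral_integrable:
  assumes h: "integrable I h" "\<And>x. 0 \<le> h x"
  shows "integrable M (compensated_integral I N h)"
    and "(\<integral>\<omega>. \<bar>compensated_integral I N h \<omega>\<bar> \<partial>M) \<le> 2 * (\<integral>x. h x \<partial>I)"
proof -
  let ?H = "\<lambda>\<omega>. enn2real (\<integral>\<^sup>+x. ennreal (h x) \<partial>N \<omega>)"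
  have eq: "compensated_integral I N h \<omega> = ?H \<omega> - (\<integral>x. h x \<partial>I)" if "\<omega> \<in> space M" for \<omega>
    by (rule compensated_integral_eq[OF borel_measurable_integrable[OF h(1)] h(2) that])
  note H = nn_integral_N_finite[OF h]
  have I0: "0 \<le> (\<integral>x. h x \<partial>I)" by (intro integral_nonneg_AE AE_I2 h)
  have "integrable M (\<lambda>\<omega>. ?H \<omega> - (\<integral>x. h x \<partial>I))"
    by (intro Bochner_Integration.integrable_diff H(3)) simp
  then show int: "integrable M (compensated_integral I N h)"
    by (rule Bochner_Integration.integrable_cong[THEN iffD2, OF refl eq, rotated])
  have "(\<integral>\<omega>. \<bar>compensated_integral I N h \<omega>\<bar> \<partial>M) \<le> (\<integral>\<omega>. ?H \<omega> + (\<integral>x. h x \<partial>I) \<partial>M)"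
  proof (rule integral_mono)
    show "integrable M (\<lambda>\<omega>. \<bar>compensated_integral I N h \<omega>\<bar>)" by (rule integrable_abs[OF int])
    show "integrable M (\<lambda>\<omega>. ?H \<omega> + (\<integral>x. h x \<partial>I))"
      by (intro Bochner_Integration.integrable_add H(3)) simp
    show "\<bar>compensated_integral I N h \<omega>\<bar> \<le> ?H \<omega> + (\<integral>x. h x \<partial>I)" if "\<omega> \<in> space M" for \<omega>
      unfolding eq[OF that] using I0 enn2real_nonneg[of "\<integral>\<^sup>+x. ennreal (h x) \<partial>N \<omega>"] by linarith
  qed
  also have "\<dots> = 2 * (\<integral>x. h x \<partial>I)"
    using H(3,4) by (subst Bochner_Integration.integral_add) (simp_all add: prob_space)
  finally show "(\<integral>\<omega>. \<bar>compensated_integral I N h \<omega>\<bar> \<partial>M) \<le> 2 * (\<integral>x. h x \<partial>I)" .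
qed

text \<open>Additivity under \<open>N \<omega>\<close> rests on both integrands being integrable for
  that realisation, which holds almost surely.\<close>

lemma compensated_integral_add:
  assumes h: "integrable I h" "\<And>x. 0 \<le> h x" and g: "integrable I g" "\<And>x. 0 \<le> g x"
  shows "AE \<omega> in M. compensated_integral I N (\<lambda>x. g x + h x) \<omega>
    = compensated_integral I N g \<omega> + compensated_integral I N h \<omega>"
  using nn_integral_N_finite(1)[OF h] nn_integral_N_finite(1)[OF g] AE_space
proof eventually_elim
  case (elim \<omega>)
  have m: "h \<in> borel_measurable I" "g \<in> borel_measurable I"
    using h g by (auto intro: borel_measurable_integrable)
  then have mN: "h \<in> borel_measurable (N \<omega>)" "g \<in> borel_measurable (N \<omega>)"
    unfolding measurable_cong_sets[OF sets_N[OF elim(3)] refl] .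
  have "integrable (N \<omega>) h" "integrable (N \<omega>) g"
    using elim h(2) g(2) mN by (auto intro!: integrableI_nonneg)
  then have "(\<integral>x. g x + h x \<partial>N \<omega>) = (\<integral>x. g x \<partial>N \<omega>) + (\<integral>x. h x \<partial>N \<omega>)"
    by (intro Bochner_Integration.integral_add)
  moreover have "(\<integral>x. g x + h x \<partial>I) = (\<integral>x. g x \<partial>I) + (\<integral>x. h x \<partial>I)"
    using h g by (intro Bochner_Integration.integral_add)
  ultimately show ?case by (simp add: compensated_integral_def)
qed

text \<open>The level sets of the nonzero values are the disjoint cells for
  \<open>poisson_size_bias\<close>, each value labelling its own cell. A positive value on an
  integrable function bounds the measure of its cell, as in Markov's inequality.\<close>

lemma compensated_integral_simple:
  fixes h :: "'a \<Rightarrow> real"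
  assumes h: "simple_function I h" "\<And>x. 0 \<le> h x" "integrable I h"
  defines "J \<equiv> h ` space I - {0}" and "A \<equiv> \<lambda>y. h -` {y} \<inter> space I"
  shows "finite J" "\<And>y. y \<in> J \<Longrightarrow> 0 < y" "\<And>y. y \<in> J \<Longrightarrow> A y \<in> sets I"
    "\<And>y. y \<in> J \<Longrightarrow> emeasure I (A y) < \<infinity>" "disjoint_family_on A J"
    and "\<And>p. (\<integral>x. h x ^ Suc p \<partial>I) = (\<Sum>y\<in>J. y ^ Suc p * measure I (A y))"
    and "AE \<omega> in M. compensated_integral I N h \<omega> = (\<Sum>y\<in>J. y * (enn2real (emeasure (N \<omega>) (A y)) - measure I (A y)))"
proof -
  show J: "finite J" unfolding J_def using h(1) by (auto simp: simple_function_def)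
  show pos: "0 < y" if "y \<in> J" for y using that h(2) by (auto simp: J_def order.order_iff_strict)
  have hm: "h \<in> borel_measurable I" using h(3) by (rule borel_measurable_integrable)
  show A: "A y \<in> sets I" for y
    unfolding A_def using hm by (rule measurable_sets) simp
  show "disjoint_family_on A J" by (auto simp: disjoint_family_on_def A_def)
  show fin: "emeasure I (A y) < \<infinity>" if y: "y \<in> J" for y
  proof -
    have "ennreal y * emeasure I (A y) = (\<integral>\<^sup>+x. ennreal y * indicator (A y) x \<partial>I)"
      using A by (simp add: nn_integral_cmult_indicator)
    also have "\<dots> \<le> (\<integral>\<^sup>+x. ennreal (h x) \<partial>I)"
      by (intro nn_integral_mono) (auto simp: indicator_def A_def)
    also have "\<dots> < \<infinity>"
      using h(3) by (simp add: integrable_iff_bounded h(2))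
    finally show ?thesis using pos[OF y] by (auto simp: ennreal_mult_less_top)
  qed
  \<comment> \<open>The exponent is a successor so that the value 0, which \<open>J\<close> omits,
    contributes 0; with exponent 0 it would contribute 1.\<close>
  have hsum: "h x ^ Suc p = (\<Sum>y\<in>J. y ^ Suc p * indicator (A y) x)" if x: "x \<in> space I" for x p
  proof (cases "h x = 0")
    case True
    then show ?thesis using J by (auto simp: A_def J_def indicator_def intro!: sum.neutral)
  next
    case False
    then have "h x \<in> J" using x by (auto simp: J_def)
    then have "(\<Sum>y\<in>J. y ^ Suc p * indicator (A y) x) = (\<Sum>y\<in>J. if y = h x then h x ^ Suc p else 0)"
      using x by (intro sum.cong) (auto simp: A_def indicator_def)
    also have "\<dots> = h x ^ Suc p" using J \<open>h x \<in> J\<close> by simp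
    finally show ?thesis by (rule sym)
  qed
  show "(\<integral>x. h x ^ Suc p \<partial>I) = (\<Sum>y\<in>J. y ^ Suc p * measure I (A y))" for p
  proof -
    have "(\<integral>x. h x ^ Suc p \<partial>I) = (\<integral>x. (\<Sum>y\<in>J. y ^ Suc p * indicator (A y) x) \<partial>I)"
      by (intro Bochner_Integration.integral_cong hsum refl)
    also have "\<dots> = (\<Sum>y\<in>J. \<integral>x. y ^ Suc p * indicator (A y) x \<partial>I)"
      using A fin by (intro Bochner_Integration.integral_sum integrable_mult_right integrable_real_indicator) auto
    also have "\<dots> = (\<Sum>y\<in>J. y ^ Suc p * measure I (A y))"
      using A by (intro sum.cong) (auto simp: Int_absorb1[OF sets.sets_into_space])
    finally show ?thesis .
  qed
  from this[of 0] have Ih: "(\<integral>x. h x \<partial>I) = (\<Sum>y\<in>J. y * measure I (A y))" by simp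
  have "AE \<omega> in M. \<forall>y\<in>J. ennreal (enn2real (emeasure (N \<omega>) (A y))) = emeasure (N \<omega>) (A y)"
    using J A fin measure_N_integrable(3) by (intro AE_finite_allI) auto
  then show "AE \<omega> in M. compensated_integral I N h \<omega> = (\<Sum>y\<in>J. y * (enn2real (emeasure (N \<omega>) (A y)) - measure I (A y)))"
    using AE_space
  proof eventually_elim
    case (elim \<omega>)
    have "(\<integral>\<^sup>+x. ennreal (h x) \<partial>N \<omega>) = (\<integral>\<^sup>+x. (\<Sum>y\<in>J. ennreal y * indicator (A y) x) \<partial>N \<omega>)"
    proof (rule nn_integral_cong)
      fix x assume "x \<in> space (N \<omega>)"
      then have x: "x \<in> space I" by (simp add: space_N[OF elim(2)])
      have "h x = (\<Sum>y\<in>J. y * indicator (A y) x)" using hsum[OF x, of 0] by simp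
      then have "ennreal (h x) = ennreal (\<Sum>y\<in>J. y * indicator (A y) x)" by simp
      also have "\<dots> = (\<Sum>y\<in>J. ennreal (y * indicator (A y) x))"
        using pos by (intro sum_ennreal[symmetric] mult_nonneg_nonneg) (auto intro: less_imp_le)
      also have "\<dots> = (\<Sum>y\<in>J. ennreal y * indicator (A y) x)"
        by (intro sum.cong refl) (auto simp: indicator_def)
      finally show "ennreal (h x) = (\<Sum>y\<in>J. ennreal y * indicator (A y) x)" .
    qed
    also have "\<dots> = (\<Sum>y\<in>J. ennreal y * emeasure (N \<omega>) (A y))"
      using A by (subst nn_integral_sum) (auto simp: nn_integral_cmult_indicator sets_N[OF elim(2)] intro!: borel_measurable_times_ennreal borel_measurable_indicator)
    also have "\<dots> = (\<Sum>y\<in>J. ennreal (y * enn2real (emeasure (N \<omega>) (A y))))"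
      using elim(1) pos by (intro sum.cong refl) (auto simp: ennreal_mult less_imp_le)
    also have "\<dots> = ennreal (\<Sum>y\<in>J. y * enn2real (emeasure (N \<omega>) (A y)))"
      using pos by (intro sum_ennreal mult_nonneg_nonneg) (auto intro: less_imp_le)
    finally have "enn2real (\<integral>\<^sup>+x. ennreal (h x) \<partial>N \<omega>) = (\<Sum>y\<in>J. y * enn2real (emeasure (N \<omega>) (A y)))"
      using pos by (simp add: sum_nonneg less_imp_le mult_nonneg_nonneg)
    then show ?case
      using compensated_integral_eq[OF hm h(2) elim(2)]
      by (simp add: Ih right_diff_distrib sum_subtractf)
  qed
qed

text \<open>By the Stein equation the difference is E f'(F) - E[F f(F)], and the size-bias identity
  expands the second mean into increments \<open>f (F \<omega> + y) - f (F \<omega>)\<close>.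
  Replacing them by \<open>y * f' (F \<omega>)\<close> leaves the variance defect times E f'(F) and
  remainders of cubic order. The defect is kept because a simple approximation of a normalised
  integrand need not have variance 1.\<close>

lemma stein_bound_simple:
  assumes h: "simple_function I h" "\<And>x. 0 \<le> h x" "integrable I h"
    and u: "1-lipschitz_on UNIV u"
  shows "\<bar>(\<integral>\<omega>. u (compensated_integral I N h \<omega>) \<partial>M) - gauss_mean u\<bar>
    \<le> (22 * (\<integral>x. h x \<partial>I) + 1) * \<bar>1 - (\<integral>x. (h x)\<^sup>2 \<partial>I)\<bar> + 22 * (\<integral>x. h x ^ 3 \<partial>I)"
proof -
  obtain f f' where f: "\<And>x. (f has_real_derivative f' x) (at x)"
    "\<And>x. f' x = x * f x + (u x - gauss_mean u)" "\<And>x. \<bar>f x\<bar> \<le> 10"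
    "22-lipschitz_on UNIV f'"
    using stein_solution[OF u] by blast
  define J where "J = h ` space I - {0}"
  define A where "A y = h -` {y} \<inter> space I" for y
  define X where "X y \<omega> = enn2real (emeasure (N \<omega>) (A y))" for y \<omega>
  define F where "F \<omega> = (\<Sum>y\<in>J. y * (X y \<omega> - measure I (A y)))" for \<omega>
  note S = compensated_integral_simple[OF h, folded J_def A_def X_def, folded F_def]
  have fm: "f \<in> borel_measurable borel"
    using f(1) by (intro borel_measurable_continuous_onI DERIV_continuous_on) auto
  note um = lipschitz_measurable[OF u]
  have bias: "F \<in> borel_measurable M" "integrable M (\<lambda>\<omega>. X y \<omega> * f (F \<omega>))"
     "(\<integral>\<omega>. X y \<omega> * f (F \<omega>) \<partial>M) = measure I (A y) * (\<integral>\<omega>. f (F \<omega> + y) \<partial>M)" if "y \<in> J" for y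
    using poisson_size_bias[OF S(1) that S(3,4,5) fm f(3), where c="\<lambda>y. y"]
    unfolding X_def[abs_def] F_def[abs_def] by auto
  have intF: "integrable M F"
    unfolding F_def[abs_def] X_def
    using S(3,4) by (intro Bochner_Integration.integrable_sum integrable_mult_right Bochner_Integration.integrable_diff measure_N_integrable(1)) auto
  have Fm: "F \<in> borel_measurable M" by (rule borel_measurable_integrable[OF intF])
  have fF: "integrable M (\<lambda>\<omega>. f (F \<omega> + d))" for d
    by (rule integrable_const_bound[where B=10])
      (use f(3) measurable_compose[OF borel_measurable_add[OF Fm borel_measurable_const] fm] in auto)
  have fF0: "integrable M (\<lambda>\<omega>. f (F \<omega>))" using fF[of 0] by simp
  have uF: "integrable M (\<lambda>\<omega>. u (F \<omega>))"
    by (rule integrable_lipschitz[OF u finite_measure_axioms intF])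
  have FfF: "integrable M (\<lambda>\<omega>. F \<omega> * f (F \<omega>))"
  proof (rule Bochner_Integration.integrable_bound)
    show "integrable M (\<lambda>\<omega>. 10 * \<bar>F \<omega>\<bar>)" using intF by simp
    show "AE \<omega> in M. norm (F \<omega> * f (F \<omega>)) \<le> norm (10 * \<bar>F \<omega>\<bar>)"
      using f(3) by (intro AE_I2) (auto simp: abs_mult mult.commute[of "10::real"] intro!: mult_left_mono)
  qed (rule borel_measurable_times[OF Fm measurable_compose[OF Fm fm]])
  have f'F: "integrable M (\<lambda>\<omega>. f' (F \<omega>))"
    unfolding f(2) using FfF uF by simp
  have EFf: "(\<integral>\<omega>. F \<omega> * f (F \<omega>) \<partial>M) = (\<Sum>y\<in>J. y * measure I (A y) * (\<integral>\<omega>. f (F \<omega> + y) - f (F \<omega>) \<partial>M))"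
  proof -
    have "(\<integral>\<omega>. F \<omega> * f (F \<omega>) \<partial>M) = (\<integral>\<omega>. (\<Sum>y\<in>J. y * (X y \<omega> * f (F \<omega>) - measure I (A y) * f (F \<omega>))) \<partial>M)"
    proof (intro Bochner_Integration.integral_cong refl)
      fix \<omega>
      have "F \<omega> * z = (\<Sum>y\<in>J. y * (X y \<omega> * z - measure I (A y) * z))" for z
        unfolding F_def sum_distrib_right by (intro sum.cong refl) (simp add: algebra_simps)
      then show "F \<omega> * f (F \<omega>) = (\<Sum>y\<in>J. y * (X y \<omega> * f (F \<omega>) - measure I (A y) * f (F \<omega>)))" .
    qed
    also have "\<dots> = (\<Sum>y\<in>J. \<integral>\<omega>. y * (X y \<omega> * f (F \<omega>) - measure I (A y) * f (F \<omega>)) \<partial>M)"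
      by (intro Bochner_Integration.integral_sum integrable_mult_right Bochner_Integration.integrable_diff bias(2) fF0)
    also have "\<dots> = (\<Sum>y\<in>J. y * measure I (A y) * (\<integral>\<omega>. f (F \<omega> + y) - f (F \<omega>) \<partial>M))"
      using fF fF0 bias by (intro sum.cong refl) (simp add: algebra_simps)
    finally show ?thesis .
  qed
  have ae: "AE \<omega> in M. compensated_integral I N h \<omega> = F \<omega>" by (rule S(7))
  have E_abs: "(\<integral>\<omega>. \<bar>F \<omega>\<bar> \<partial>M) \<le> 2 * (\<integral>x. h x \<partial>I)"
  proof -
    have "(\<integral>\<omega>. \<bar>F \<omega>\<bar> \<partial>M) = (\<integral>\<omega>. \<bar>compensated_integral I N h \<omega>\<bar> \<partial>M)"
    proof (rule integral_cong_AE)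
      show "AE \<omega> in M. \<bar>F \<omega>\<bar> = \<bar>compensated_integral I N h \<omega>\<bar>"
        using ae by eventually_elim simp
    qed (use Fm borel_measurable_integrable[OF compensated_integral_integrable(1)[OF h(3,2)]] in auto)
    then show ?thesis using compensated_integral_integrable(2)[OF h(3,2)] by simp
  qed
  have uc: "(\<integral>\<omega>. u (compensated_integral I N h \<omega>) \<partial>M) = (\<integral>\<omega>. u (F \<omega>) \<partial>M)"
  proof (rule integral_cong_AE)
    show "AE \<omega> in M. u (compensated_integral I N h \<omega>) = u (F \<omega>)"
      using ae by eventually_elim simp
  qed (auto intro!: measurable_compose[OF _ um] Fm borel_measurable_integrable[OF compensated_integral_integrable(1)[OF h(3,2)]])
  define v where "v = (\<integral>x. (h x)\<^sup>2 \<partial>I)"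
  have v: "v = (\<Sum>y\<in>J. y\<^sup>2 * measure I (A y))"
    unfolding v_def using S(6)[of 1] by (simp add: numeral_2_eq_2)
  have w: "(\<integral>x. h x ^ 3 \<partial>I) = (\<Sum>y\<in>J. y ^ 3 * measure I (A y))"
    using S(6)[of 2] by (simp add: numeral_3_eq_3 numeral_2_eq_2)
  have "(\<integral>\<omega>. u (F \<omega>) \<partial>M) - gauss_mean u = (\<integral>\<omega>. f' (F \<omega>) \<partial>M) - (\<integral>\<omega>. F \<omega> * f (F \<omega>) \<partial>M)"
    unfolding f(2) using FfF uF by (simp add: prob_space)
  also have "\<dots> = (1 - v) * (\<integral>\<omega>. f' (F \<omega>) \<partial>M)
      - (\<Sum>y\<in>J. y * measure I (A y) * (\<integral>\<omega>. f (F \<omega> + y) - f (F \<omega>) - y * f' (F \<omega>) \<partial>M))"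
  proof -
    define m where "m = (\<integral>\<omega>. f' (F \<omega>) \<partial>M)"
    define D where "D y = (\<integral>\<omega>. f (F \<omega> + y) - f (F \<omega>) \<partial>M)" for y
    have D: "(\<integral>\<omega>. f (F \<omega> + y) - f (F \<omega>) - y * f' (F \<omega>) \<partial>M) = D y - y * m" for y
      using fF fF0 f'F unfolding D_def m_def by simp
    have "(\<Sum>y\<in>J. y * measure I (A y) * (D y - y * m)) = (\<Sum>y\<in>J. y * measure I (A y) * D y) - v * m"
      unfolding v sum_distrib_right sum_subtractf[symmetric]
      by (intro sum.cong refl) (simp add: algebra_simps power2_eq_square)
    then show ?thesis
      unfolding EFf D D_def[symmetric] m_def[symmetric] by (simp add: algebra_simps)
  qed
  finally have "\<bar>(\<integral>\<omega>. u (F \<omega>) \<partial>M) - gauss_mean u\<bar> = \<bar>(1 - v) * (\<integral>\<omega>. f' (F \<omega>) \<partial>M)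
      - (\<Sum>y\<in>J. y * measure I (A y) * (\<integral>\<omega>. f (F \<omega> + y) - f (F \<omega>) - y * f' (F \<omega>) \<partial>M))\<bar>"
    by (rule arg_cong)
  also have "\<dots> \<le> \<bar>1 - v\<bar> * \<bar>\<integral>\<omega>. f' (F \<omega>) \<partial>M\<bar>
      + (\<Sum>y\<in>J. \<bar>y * measure I (A y) * (\<integral>\<omega>. f (F \<omega> + y) - f (F \<omega>) - y * f' (F \<omega>) \<partial>M)\<bar>)"
    unfolding abs_mult[symmetric, of "1 - v"]
    by (rule order_trans[OF abs_triangle_ineq4]) (intro add_left_mono sum_abs)
  \<comment> \<open>The two constants 22 have different origins. The first is 11 * 2, from
    \<open>\<bar>f' x\<bar> \<le> 11 * \<bar>x\<bar> + 1\<close> and the L1 bound on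
    \<open>F\<close>; the second is the Lipschitz constant of \<open>f'\<close>.\<close>
  also have "\<dots> \<le> \<bar>1 - v\<bar> * (22 * (\<integral>x. h x \<partial>I) + 1) + (\<Sum>y\<in>J. 22 * (y ^ 3 * measure I (A y)))"
  proof (intro add_mono mult_left_mono sum_mono)
    have "\<bar>\<integral>\<omega>. f' (F \<omega>) \<partial>M\<bar> \<le> (\<integral>\<omega>. 11 * \<bar>F \<omega>\<bar> + 1 \<partial>M)"
    proof (rule abs_integral_le_integral[OF f'F])
      show "integrable M (\<lambda>\<omega>. 11 * \<bar>F \<omega>\<bar> + 1)"
        by (intro Bochner_Integration.integrable_add integrable_mult_right integrable_abs intF) simp
      show "\<bar>f' (F \<omega>)\<bar> \<le> 11 * \<bar>F \<omega>\<bar> + 1" for \<omega>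
      proof -
        have "\<bar>F \<omega> * f (F \<omega>)\<bar> \<le> \<bar>F \<omega>\<bar> * 10"
          unfolding abs_mult by (intro mult_left_mono f(3)) simp
        then show ?thesis using lipschitz_gauss_mean(1)[OF u, of "F \<omega>"] unfolding f(2) by linarith
      qed
    qed
    also have "\<dots> = 11 * (\<integral>\<omega>. \<bar>F \<omega>\<bar> \<partial>M) + 1" using intF by (simp add: prob_space)
    finally show "\<bar>\<integral>\<omega>. f' (F \<omega>) \<partial>M\<bar> \<le> 22 * (\<integral>x. h x \<partial>I) + 1" using E_abs by linarith
  next
    fix y assume y: "y \<in> J"
    have "\<bar>\<integral>\<omega>. f (F \<omega> + y) - f (F \<omega>) - y * f' (F \<omega>) \<partial>M\<bar> \<le> (\<integral>\<omega>. 22 * y\<^sup>2 \<partial>M)"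
      using taylor_lipschitz_deriv[OF f(1,4)] S(2)[OF y] fF fF0 f'F
      by (intro abs_integral_le_integral) auto
    then have "\<bar>\<integral>\<omega>. f (F \<omega> + y) - f (F \<omega>) - y * f' (F \<omega>) \<partial>M\<bar> \<le> 22 * y\<^sup>2" by (simp add: prob_space)
    then have "\<bar>y * measure I (A y) * (\<integral>\<omega>. f (F \<omega> + y) - f (F \<omega>) - y * f' (F \<omega>) \<partial>M)\<bar>
      \<le> (y * measure I (A y)) * (22 * y\<^sup>2)"
      unfolding abs_mult using S(2)[OF y] by (intro mult_mono) auto
    then show "\<bar>y * measure I (A y) * (\<integral>\<omega>. f (F \<omega> + y) - f (F \<omega>) - y * f' (F \<omega>) \<partial>M)\<bar>
      \<le> 22 * (y ^ 3 * measure I (A y))"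
      by (simp add: power2_eq_square power3_eq_cube mult_ac)
  qed simp
  finally show ?thesis unfolding uc v_def w by (simp add: sum_distrib_left mult.commute)
qed

text \<open>Simple functions increase to \<open>h\<close>. The error is the compensated integral of
  a nonnegative function, whose L1 norm is at most twice its integral, so the approximation
  converges in L1 and a Lipschitz \<open>u\<close> preserves this. Dominated convergence with the
  powers of \<open>h\<close> takes the bound to its limit.\<close>

lemma poisson_stein_bound:
  assumes h: "\<And>x. 0 \<le> h x" "integrable I h" "integrable I (\<lambda>x. (h x)\<^sup>2)" "integrable I (\<lambda>x. h x ^ 3)"
    and u: "1-lipschitz_on UNIV u"
  shows "\<bar>(\<integral>\<omega>. u (compensated_integral I N h \<omega>) \<partial>M) - gauss_mean u\<bar>
    \<le> (22 * (\<integral>x. h x \<partial>I) + 1) * \<bar>1 - (\<integral>x. (h x)\<^sup>2 \<partial>I)\<bar> + 22 * (\<integral>x. h x ^ 3 \<partial>I)"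
proof -
  have hm: "h \<in> borel_measurable I" using h(2) by (rule borel_measurable_integrable)
  obtain U where U: "\<And>i. simple_function I (U i)" "incseq U" "\<And>i x. U i x < top"
    "\<And>x. (SUP i. U i x) = ennreal (h x)"
    using borel_measurable_implies_simple_function_sequence'[OF measurable_compose[OF hm measurable_ennreal]] by auto
  define g where "g i x = enn2real (U i x)" for i x
  have gU: "ennreal (g i x) = U i x" for i x
    using U(3)[of i x] by (simp add: g_def)
  have g_simple: "simple_function I (g i)" for i
    unfolding g_def by (rule simple_function_compose1[OF U(1)])
  have g0: "0 \<le> g i x" for i x by (simp add: g_def)
  have gh: "g i x \<le> h x" for i x
  proof -
    have "U i x \<le> (SUP i. U i x)" by (rule SUP_upper) simp
    then have "ennreal (g i x) \<le> ennreal (h x)" by (simp only: U(4) gU)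
    then show ?thesis using h(1)[of x] by (simp add: ennreal_le_iff)
  qed
  have glim: "(\<lambda>i. g i x) \<longlonglongrightarrow> h x" for x
  proof -
    have "incseq (\<lambda>i. U i x)" using U(2) by (auto simp: incseq_def le_fun_def)
    from LIMSEQ_SUP[OF this] have "(\<lambda>i. ennreal (g i x)) \<longlonglongrightarrow> ennreal (h x)"
      by (simp only: U(4) gU)
    then show ?thesis using g0 h(1) by (subst (asm) tendsto_ennreal_iff) auto
  qed
  have gm: "g i \<in> borel_measurable I" for i
    by (rule borel_measurable_simple_function[OF g_simple])
  have gint: "integrable I (g i)" for i
    using h(1) g0 gh by (intro Bochner_Integration.integrable_bound[OF h(2) gm]) auto
  have lim: "(\<lambda>i. \<integral>x. g i x ^ p \<partial>I) \<longlonglongrightarrow> (\<integral>x. h x ^ p \<partial>I)" if p: "integrable I (\<lambda>x. h x ^ p)" for p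
  proof (rule integral_dominated_convergence[OF _ _ p])
    show "AE x in I. (\<lambda>i. g i x ^ p) \<longlonglongrightarrow> h x ^ p"
      by (intro AE_I2 tendsto_power glim)
    show "AE x in I. norm (g i x ^ p) \<le> h x ^ p" for i
      using g0 gh by (intro AE_I2) (auto simp: power_abs intro!: power_mono)
  qed (intro borel_measurable_power hm gm)+
  let ?F = "\<lambda>h. compensated_integral I N h"
  have uint: "integrable M (\<lambda>\<omega>. u (?F k \<omega>))" if "integrable I k" "\<And>x. 0 \<le> k x" for k
    by (rule integrable_lipschitz[OF u finite_measure_axioms compensated_integral_integrable(1)[OF that]])
  have diff: "\<bar>(\<integral>\<omega>. u (?F h \<omega>) \<partial>M) - (\<integral>\<omega>. u (?F (g i) \<omega>) \<partial>M)\<bar> \<le> 2 * ((\<integral>x. h x \<partial>I) - (\<integral>x. g i x \<partial>I))" for i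
  proof -
    let ?d = "\<lambda>x. h x - g i x"
    have d: "integrable I ?d" "\<And>x. 0 \<le> ?d x" using h(2) gint[of i] gh by simp_all
    note Fd = compensated_integral_integrable[OF d]
    have ae: "AE \<omega> in M. ?F h \<omega> = ?F (g i) \<omega> + ?F ?d \<omega>"
      using compensated_integral_add[OF d gint g0, of i] by simp
    have "\<bar>(\<integral>\<omega>. u (?F h \<omega>) \<partial>M) - (\<integral>\<omega>. u (?F (g i) \<omega>) \<partial>M)\<bar>
        = \<bar>\<integral>\<omega>. u (?F h \<omega>) - u (?F (g i) \<omega>) \<partial>M\<bar>"
      using uint[OF h(2,1)] uint[OF gint g0] by simp
    also have "\<dots> \<le> (\<integral>\<omega>. \<bar>u (?F h \<omega>) - u (?F (g i) \<omega>)\<bar> \<partial>M)"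
      by (rule integral_abs_bound)
    also have "\<dots> \<le> (\<integral>\<omega>. \<bar>?F ?d \<omega>\<bar> \<partial>M)"
    proof (rule integral_mono_AE)
      show "integrable M (\<lambda>\<omega>. \<bar>u (?F h \<omega>) - u (?F (g i) \<omega>)\<bar>)"
        using uint[OF h(2,1)] uint[OF gint g0] by simp
      show "integrable M (\<lambda>\<omega>. \<bar>?F ?d \<omega>\<bar>)" using Fd(1) by simp
      show "AE \<omega> in M. \<bar>u (?F h \<omega>) - u (?F (g i) \<omega>)\<bar> \<le> \<bar>?F ?d \<omega>\<bar>"
        using ae
      proof eventually_elim
        case (elim \<omega>)
        show ?case
          using lipschitz_onD[OF u, of "?F h \<omega>" "?F (g i) \<omega>"] elim by (simp add: dist_real_def)
      qed
    qed
    also have "\<dots> \<le> 2 * (\<integral>x. ?d x \<partial>I)" by (rule Fd(2))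
    also have "(\<integral>x. ?d x \<partial>I) = (\<integral>x. h x \<partial>I) - (\<integral>x. g i x \<partial>I)"
      using h(2) gint by (intro Bochner_Integration.integral_diff)
    finally show ?thesis .
  qed
  have bound: "\<bar>(\<integral>\<omega>. u (?F h \<omega>) \<partial>M) - gauss_mean u\<bar>
    \<le> 2 * ((\<integral>x. h x \<partial>I) - (\<integral>x. g i x \<partial>I))
      + ((22 * (\<integral>x. g i x \<partial>I) + 1) * \<bar>1 - (\<integral>x. (g i x)\<^sup>2 \<partial>I)\<bar> + 22 * (\<integral>x. g i x ^ 3 \<partial>I))" for i
    using diff[of i] stein_bound_simple[OF g_simple g0 gint u, of i] by linarith
  have "(\<lambda>i. 2 * ((\<integral>x. h x \<partial>I) - (\<integral>x. g i x \<partial>I))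
      + ((22 * (\<integral>x. g i x \<partial>I) + 1) * \<bar>1 - (\<integral>x. (g i x)\<^sup>2 \<partial>I)\<bar> + 22 * (\<integral>x. g i x ^ 3 \<partial>I)))
    \<longlonglongrightarrow> 2 * ((\<integral>x. h x \<partial>I) - (\<integral>x. h x \<partial>I))
      + ((22 * (\<integral>x. h x \<partial>I) + 1) * \<bar>1 - (\<integral>x. (h x)\<^sup>2 \<partial>I)\<bar> + 22 * (\<integral>x. h x ^ 3 \<partial>I))"
    using lim[of 1] lim[of 2] lim[of 3] h by (intro tendsto_intros) auto
  from LIMSEQ_le_const[OF this] bound show ?thesis by simp
qed

end

section \<open>Pathwise estimates\<close>

lemma indicator_UN_SUP:
  "indicator (\<Union>n. A n) x = (SUP n. indicator (A n) x :: ennreal)"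
proof (cases "x \<in> (\<Union>n. A n)")
  case True
  then obtain n where "x \<in> A n" by blast
  then have "1 \<le> (SUP n. indicator (A n) x :: ennreal)" by (intro SUP_upper2[of n]) auto
  moreover have "(SUP n. indicator (A n) x :: ennreal) \<le> 1"
    by (intro SUP_least) (auto simp: indicator_def)
  moreover have "indicator (\<Union>n. A n) x = (1 :: ennreal)" using True by (rule indicator_simps(1))
  ultimately show ?thesis by (metis antisym)
next
  case False
  then have "indicator (A n) x = (0 :: ennreal)" for n by auto
  moreover have "indicator (\<Union>n. A n) x = (0 :: ennreal)" using False by (rule indicator_simps(2))
  ultimately show ?thesis by simp
qed

lemma nn_integral_fubini_restrict:
  fixes n :: "'a measure" and \<sigma> :: "'a \<Rightarrow> real" and \<phi> :: "real \<Rightarrow> real"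
  assumes "sigma_finite_measure n" and [measurable]: "A \<in> sets n" "\<sigma> \<in> borel_measurable n"
    "\<phi> \<in> borel_measurable borel" "S \<in> sets borel"
  shows "(\<integral>\<^sup>+t\<in>S. (\<integral>\<^sup>+p\<in>A. ennreal (\<phi> (t - \<sigma> p)) \<partial>n) \<partial>lborel)
       = (\<integral>\<^sup>+p\<in>A. (\<integral>\<^sup>+t\<in>S. ennreal (\<phi> (t - \<sigma> p)) \<partial>lborel) \<partial>n)"
proof -
  interpret n: sigma_finite_measure n by fact
  interpret P: pair_sigma_finite n lborel ..
  have "(\<integral>\<^sup>+t\<in>S. (\<integral>\<^sup>+p\<in>A. ennreal (\<phi> (t - \<sigma> p)) \<partial>n) \<partial>lborel)
      = (\<integral>\<^sup>+t. (\<integral>\<^sup>+p. ennreal (\<phi> (t - \<sigma> p)) * indicator A p * indicator S t \<partial>n) \<partial>lborel)"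
    by (intro nn_integral_cong nn_integral_multc[symmetric]) simp
  also have "\<dots> = (\<integral>\<^sup>+p. (\<integral>\<^sup>+t. ennreal (\<phi> (t - \<sigma> p)) * indicator A p * indicator S t \<partial>lborel) \<partial>n)"
    by (rule P.Fubini') measurable
  also have "\<dots> = (\<integral>\<^sup>+p\<in>A. (\<integral>\<^sup>+t\<in>S. ennreal (\<phi> (t - \<sigma> p)) \<partial>lborel) \<partial>n)"
    by (intro nn_integral_cong, subst nn_integral_multc[symmetric]) (auto intro!: nn_integral_cong simp: ac_simps)
  finally show ?thesis .
qed

text \<open>The substitution moves the lower limit to \<open>- s\<close>; the part below 0
  contributes nothing because the kernel vanishes there.\<close>

lemma nn_integral_shift_kernel:
  fixes \<phi> :: "real \<Rightarrow> real"
  assumes [measurable]: "\<phi> \<in> borel_measurable borel" and "\<And>t. t \<le> 0 \<Longrightarrow> \<phi> t = 0" and "0 \<le> s"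
  shows "(\<integral>\<^sup>+t\<in>{0..x}. ennreal (\<phi> (t - s)) \<partial>lborel) = (\<integral>\<^sup>+t\<in>{0..x - s}. ennreal (\<phi> t) \<partial>lborel)"
proof -
  have "(\<integral>\<^sup>+t\<in>{0..x}. ennreal (\<phi> (t - s)) \<partial>lborel)
      = (\<integral>\<^sup>+t. ennreal (\<phi> t) * indicator {0..x} (s + t) \<partial>lborel)"
    by (subst nn_integral_real_affine[where c=1 and t=s]) auto
  also have "\<dots> = (\<integral>\<^sup>+t\<in>{0..x - s}. ennreal (\<phi> t) \<partial>lborel)"
  proof (rule nn_integral_cong)
    fix t show "ennreal (\<phi> t) * indicator {0..x} (s + t) = ennreal (\<phi> t) * indicator {0..x - s} t"
      using assms(2)[of t] assms(3) by (cases "t \<le> 0") (auto simp: indicator_def)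
  qed
  finally show ?thesis .
qed

text \<open>Finiteness at every time does not bound the sum in time, and the kernel may vanish near
  0, so a point can act much later than it occurs. The gap between \<open>x\<close> and
  \<open>T\<close> is the remedy: every point that puts mass before \<open>x\<close> puts at least a
  fixed amount of mass before \<open>T\<close>. Comparing with a set of times on which the sum is
  bounded limits the measure of such points, and each of them adds at most
  \<open>\<Phi> T\<close>.\<close>

lemma nn_integral_convolution_finite:
  fixes n :: "'a measure" and \<sigma> :: "'a \<Rightarrow> real" and \<phi> :: "real \<Rightarrow> real"
  assumes sf: "sigma_finite_measure n" and [measurable]: "A \<in> sets n" "\<sigma> \<in> borel_measurable n"
    "\<phi> \<in> borel_measurable borel"
    and \<phi>0: "\<And>t. t \<le> 0 \<Longrightarrow> \<phi> t = 0" and \<phi>B: "\<And>t. t \<le> T \<Longrightarrow> \<phi> t \<le> B"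
    and \<sigma>: "\<And>p. p \<in> A \<Longrightarrow> 0 \<le> \<sigma> p"
    and fin: "\<And>t. 0 \<le> t \<Longrightarrow> t \<le> T \<Longrightarrow> (\<integral>\<^sup>+p\<in>A. ennreal (\<phi> (t - \<sigma> p)) \<partial>n) < \<infinity>"
    and x: "0 \<le> x" "x < T"
  shows "(\<integral>\<^sup>+t\<in>{0..x}. (\<integral>\<^sup>+p\<in>A. ennreal (\<phi> (t - \<sigma> p)) \<partial>n) \<partial>lborel) < \<infinity>"
proof -
  interpret n: sigma_finite_measure n by fact
  interpret P: pair_sigma_finite n lborel ..
  define g where "g t = (\<integral>\<^sup>+p\<in>A. ennreal (\<phi> (t - \<sigma> p)) \<partial>n)" for t
  define \<Phi> where "\<Phi> u = (\<integral>\<^sup>+t\<in>{0..u}. ennreal (\<phi> t) \<partial>lborel)" for u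
  have [measurable]: "g \<in> borel_measurable borel"
    unfolding g_def[abs_def] by (rule n.borel_measurable_nn_integral) measurable
  have \<Phi>_mono: "\<Phi> u \<le> \<Phi> v" if "u \<le> v" for u v
    unfolding \<Phi>_def using that by (intro nn_integral_mono) (auto simp: indicator_def)
  have B0: "0 \<le> B" using \<phi>B[of 0] \<phi>0[of 0] x by simp
  have \<Phi>_fin: "\<Phi> T < \<infinity>"
  proof -
    have "\<Phi> T \<le> (\<integral>\<^sup>+t. ennreal B * indicator {0..T} t \<partial>lborel)"
      unfolding \<Phi>_def using \<phi>B by (intro nn_integral_mono) (auto simp: indicator_def intro!: ennreal_leI)
    also have "\<dots> < \<infinity>" using x by (simp add: nn_integral_cmult ennreal_mult_less_top)
    finally show ?thesis .
  qed
  have g_int: "(\<integral>\<^sup>+t\<in>{0..y}. g t \<partial>lborel) = (\<integral>\<^sup>+p\<in>A. \<Phi> (y - \<sigma> p) \<partial>n)" for y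
  proof -
    have "(\<integral>\<^sup>+t\<in>{0..y}. g t \<partial>lborel) = (\<integral>\<^sup>+p\<in>A. (\<integral>\<^sup>+t\<in>{0..y}. ennreal (\<phi> (t - \<sigma> p)) \<partial>lborel) \<partial>n)"
      unfolding g_def by (rule nn_integral_fubini_restrict[OF sf]) measurable
    also have "\<dots> = (\<integral>\<^sup>+p\<in>A. \<Phi> (y - \<sigma> p) \<partial>n)"
      unfolding \<Phi>_def using \<sigma> nn_integral_shift_kernel[of \<phi>] \<phi>0
      by (intro nn_integral_cong) (auto simp: indicator_def)
    finally show ?thesis .
  qed
  \<comment> \<open>Let I be the infimum of the u with \<open>0 < \<Phi> u\<close>. The kernel has
    positive mass up to I + (T - x), and this serves every such u by monotonicity. The minimum with
    1 keeps the value finite; for a kernel without mass any positive number will do.\<close>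
  obtain c where c: "c > 0" "\<And>u. 0 < \<Phi> u \<Longrightarrow> ennreal c \<le> \<Phi> (u + (T - x))"
  proof (cases "\<exists>u. 0 < \<Phi> u")
    case False
    then show thesis using that[of 1] by auto
  next
    case True
    define U where "U = {u. 0 < \<Phi> u}"
    have neg: "\<Phi> u = 0" if "u < 0" for u
      unfolding \<Phi>_def using that by simp
    have bdd: "bdd_below U"
      unfolding U_def using neg by (intro bdd_belowI[of _ 0]) (auto simp: not_le[symmetric])
    have ne: "U \<noteq> {}" using True unfolding U_def by blast
    obtain w where w: "w \<in> U" "w < Inf U + (T - x)"
      using cInf_less_iff[OF ne bdd, of "Inf U + (T - x)"] x by auto
    then have pos: "0 < \<Phi> (Inf U + (T - x))"
      using \<Phi>_mono[of w "Inf U + (T - x)"] by (auto simp: U_def)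
    define c where "c = enn2real (min 1 (\<Phi> (Inf U + (T - x))))"
    have "min 1 (\<Phi> (Inf U + (T - x))) < top"
      by (simp add: min_less_iff_disj)
    then have c: "0 < c" "ennreal c \<le> \<Phi> (Inf U + (T - x))"
      using pos by (simp_all add: c_def enn2real_positive_iff)
    show thesis
    proof (rule that[OF c(1)])
      fix u assume "0 < \<Phi> u"
      then have "Inf U \<le> u" using bdd by (intro cInf_lower) (auto simp: U_def)
      then have "\<Phi> (Inf U + (T - x)) \<le> \<Phi> (u + (T - x))" by (intro \<Phi>_mono) auto
      then show "ennreal c \<le> \<Phi> (u + (T - x))" using c(2) by auto
    qed
  qed
  \<comment> \<open>\<open>g\<close> is at most \<open>k\<close> off a set of measure so small that it cannot absorb the mass \<open>c\<close> of \<open>\<phi>\<close>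
    beyond a point that matters before \<open>x\<close>; hence there are finitely many such points.\<close>
  define E where "E k = {t\<in>{0..T}. of_nat k < g t}" for k :: nat
  have [measurable]: "E k \<in> sets borel" for k
    unfolding E_def by measurable
  have Elim: "(\<lambda>k. emeasure lborel (E k)) \<longlonglongrightarrow> emeasure lborel (\<Inter>k. E k)"
  proof (rule Lim_emeasure_decseq)
    show "decseq E"
      unfolding E_def decseq_def by (auto simp: le_less_trans[OF of_nat_mono])
    show "emeasure lborel (E i) \<noteq> \<infinity>" for i
    proof -
      have "emeasure lborel (E i) \<le> emeasure lborel {0..T}"
        by (intro emeasure_mono) (auto simp: E_def)
      also have "\<dots> < \<infinity>" using x by simp
      finally show ?thesis by simp
    qed
  qed auto
  have "(\<Inter>k. E k) = {}"
  proof -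
    have "\<exists>k. g t \<le> of_nat k" if "t \<in> {0..T}" for t
    proof -
      have "g t < \<infinity>" using fin[of t] that by (simp add: g_def)
      then obtain k where "g t < of_nat k"
        using ennreal_Ex_less_of_nat by (auto simp: less_top)
      then show ?thesis by (auto intro: less_imp_le)
    qed
    then show ?thesis by (fastforce simp: E_def not_less[symmetric])
  qed
  with Elim have "(\<lambda>k. emeasure lborel (E k)) \<longlonglongrightarrow> 0" by simp
  \<comment> \<open>With this threshold the kernel, bounded by \<open>B\<close>, puts at most
    \<open>c / 2\<close> on \<open>E k\<close>, so half of the mass \<open>c\<close> survives
    elsewhere; \<open>B + 1\<close> guards against \<open>B = 0\<close>.\<close>
  moreover have "0 < ennreal (c / (2 * (B + 1)))" using c B0 by simp
  ultimately obtain k where k: "emeasure lborel (E k) < ennreal (c / (2 * (B + 1)))"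
    by (metis (no_types, lifting) eventually_sequentially order_refl order_tendstoD(2))
  have key: "ennreal (c / 2) * indicator {p\<in>space n. 0 < \<Phi> (x - \<sigma> p)} p
      \<le> (\<integral>\<^sup>+t\<in>({0..T} - E k). ennreal (\<phi> (t - \<sigma> p)) \<partial>lborel)" if p: "p \<in> A" for p
  proof (cases "0 < \<Phi> (x - \<sigma> p)")
    case True
    then have "ennreal c \<le> \<Phi> (T - \<sigma> p)" using c(2)[of "x - \<sigma> p"] by (simp add: algebra_simps)
    also have "\<dots> = (\<integral>\<^sup>+t\<in>{0..T}. ennreal (\<phi> (t - \<sigma> p)) \<partial>lborel)"
      unfolding \<Phi>_def using \<sigma>[OF p] nn_integral_shift_kernel[of \<phi>] \<phi>0 by simp
    also have "\<dots> \<le> (\<integral>\<^sup>+t. ennreal (\<phi> (t - \<sigma> p)) * indicator ({0..T} - E k) t + ennreal B * indicator (E k) t \<partial>lborel)"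
      using \<phi>B \<sigma>[OF p] by (intro nn_integral_mono) (auto simp: indicator_def E_def intro!: ennreal_leI)
    also have "\<dots> = (\<integral>\<^sup>+t\<in>({0..T} - E k). ennreal (\<phi> (t - \<sigma> p)) \<partial>lborel) + ennreal B * emeasure lborel (E k)"
      by (subst nn_integral_add) (auto simp: nn_integral_cmult)
    also have "ennreal B * emeasure lborel (E k) \<le> ennreal B * ennreal (c / (2 * (B + 1)))"
      using k by (intro mult_left_mono) auto
    also have "\<dots> = ennreal (B * (c / (2 * (B + 1))))"
      using B0 c(1) by (intro ennreal_mult[symmetric]) auto
    also have "\<dots> \<le> ennreal (c / 2)"
      using B0 c by (intro ennreal_leI) (simp add: field_simps)
    finally have "ennreal c \<le> (\<integral>\<^sup>+t\<in>({0..T} - E k). ennreal (\<phi> (t - \<sigma> p)) \<partial>lborel) + ennreal (c / 2)"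
      by (simp add: add_left_mono)
    moreover have "ennreal c = ennreal (c / 2) + ennreal (c / 2)"
      using c by (simp add: ennreal_plus[symmetric])
    ultimately show ?thesis using True
      by (auto simp: indicator_def)
  qed simp
  define Z where "Z = {p\<in>A. 0 < \<Phi> (x - \<sigma> p)}"
  have [measurable]: "\<Phi> \<in> borel_measurable borel"
  proof -
    have "(\<lambda>u. \<integral>\<^sup>+t. (if 0 \<le> t \<and> t \<le> u then ennreal (\<phi> t) else 0) \<partial>lborel) \<in> borel_measurable borel"
      by (rule lborel.borel_measurable_nn_integral) measurable
    moreover have "\<Phi> u = (\<integral>\<^sup>+t. (if 0 \<le> t \<and> t \<le> u then ennreal (\<phi> t) else 0) \<partial>lborel)" for u
      unfolding \<Phi>_def by (intro nn_integral_cong) (auto simp: indicator_def)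
    ultimately show ?thesis by (simp cong: measurable_cong)
  qed
  have [measurable]: "Z \<in> sets n"
  proof -
    have "Z = A \<inter> {p\<in>space n. 0 < \<Phi> (x - \<sigma> p)}"
      using sets.sets_into_space[OF \<open>A \<in> sets n\<close>] by (auto simp: Z_def)
    then show ?thesis by simp
  qed
  \<comment> \<open>The surviving masses, summed over the points in \<open>Z\<close>, cannot exceed
    the integral of \<open>g\<close> off \<open>E k\<close>, where \<open>g\<close> is at most
    \<open>k\<close>.\<close>
  have "ennreal (c / 2) * emeasure n Z = (\<integral>\<^sup>+p\<in>A. ennreal (c / 2) * indicator {p\<in>space n. 0 < \<Phi> (x - \<sigma> p)} p \<partial>n)"
    using sets.sets_into_space[OF \<open>A \<in> sets n\<close>]
    by (subst nn_integral_cmult_indicator[symmetric]) (auto simp: Z_def indicator_def intro!: nn_integral_cong)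
  also have "\<dots> \<le> (\<integral>\<^sup>+p\<in>A. (\<integral>\<^sup>+t\<in>({0..T} - E k). ennreal (\<phi> (t - \<sigma> p)) \<partial>lborel) \<partial>n)"
  proof (rule nn_integral_mono)
    fix p show "ennreal (c / 2) * indicator {p\<in>space n. 0 < \<Phi> (x - \<sigma> p)} p * indicator A p
      \<le> (\<integral>\<^sup>+t\<in>({0..T} - E k). ennreal (\<phi> (t - \<sigma> p)) \<partial>lborel) * indicator A p"
      using key[of p] by (cases "p \<in> A") simp_all
  qed
  also have "\<dots> = (\<integral>\<^sup>+t\<in>({0..T} - E k). g t \<partial>lborel)"
    unfolding g_def by (rule nn_integral_fubini_restrict[OF sf, symmetric]) measurable
  also have "\<dots> \<le> (\<integral>\<^sup>+t. of_nat k * indicator {0..T} t \<partial>lborel)"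
    by (intro nn_integral_mono) (auto simp: indicator_def E_def not_less)
  also have "\<dots> < \<infinity>" using x by (simp add: nn_integral_cmult ennreal_mult_less_top of_nat_less_top)
  finally have Zfin: "emeasure n Z < \<infinity>"
    using c by (auto simp: ennreal_mult_less_top)
  have "(\<integral>\<^sup>+t\<in>{0..x}. g t \<partial>lborel) \<le> (\<integral>\<^sup>+p. \<Phi> T * indicator Z p \<partial>n)"
    unfolding g_int
  proof (rule nn_integral_mono)
    fix p show "\<Phi> (x - \<sigma> p) * indicator A p \<le> \<Phi> T * indicator Z p"
      using \<sigma>[of p] x \<Phi>_mono[of "x - \<sigma> p" T] by (auto simp: Z_def indicator_def)
  qed
  also have "\<dots> < \<infinity>" using Zfin \<Phi>_fin by (simp add: nn_integral_cmult ennreal_mult_less_top)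
  finally show ?thesis unfolding g_def .
qed

text \<open>The domain is an initial segment of \<open>{0..T}\<close>. If it contains its supremum,
  the running integral there is the bound; otherwise the segment is exhausted by closed intervals
  whose endpoints lie in it. Applied to a path of the intensity, this makes every stopped mean
  finite.\<close>

lemma nn_integral_stopped_le:
  fixes f :: "real \<Rightarrow> ennreal"
  assumes [measurable]: "f \<in> borel_measurable borel"
  shows "(\<integral>\<^sup>+t\<in>{t\<in>{0..T}. (\<integral>\<^sup>+r\<in>{0..t}. f r \<partial>lborel) \<le> K}. f t \<partial>lborel) \<le> K"
proof -
  define Y where "Y t = (\<integral>\<^sup>+r\<in>{0..t}. f r \<partial>lborel)" for t
  define S where "S = {t\<in>{0..T}. Y t \<le> K}"
  have mono: "Y s \<le> Y t" if "s \<le> t" for s t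
    unfolding Y_def using that by (intro nn_integral_mono) (auto simp: indicator_def)
  have "(\<integral>\<^sup>+t\<in>S. f t \<partial>lborel) \<le> K"
  proof (cases "S = {}")
    case False
    define \<tau> where "\<tau> = Sup S"
    have bdd: "bdd_above S" by (auto simp: S_def)
    show ?thesis
    proof (cases "\<tau> \<in> S")
      case True
      have "(\<integral>\<^sup>+t\<in>S. f t \<partial>lborel) \<le> Y \<tau>"
        unfolding Y_def using cSup_upper[OF _ bdd]
        by (intro nn_integral_mono) (auto simp: indicator_def \<tau>_def, auto simp: S_def)
      then show ?thesis using True by (auto simp: S_def)
    next
      case nS: False
      have S_int: "t \<in> S" if t: "0 \<le> t" "t < \<tau>" for t
      proof -
        obtain s where "s \<in> S" "t < s"
          using t less_cSup_iff[OF False bdd, of t] unfolding \<tau>_def by blast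
        then show ?thesis using t mono[of t s] by (auto simp: S_def)
      qed
      have "S = (\<Union>n::nat. {0..\<tau> - 1 / Suc n})"
      proof (intro set_eqI iffI)
        fix t assume "t \<in> S"
        then have "t < \<tau>" using cSup_upper[OF _ bdd, of t] nS
          unfolding \<tau>_def[symmetric] by (metis order_le_less)
        then obtain n where "1 / Suc n < \<tau> - t"
          using reals_Archimedean[of "\<tau> - t"] by (auto simp: inverse_eq_divide)
        moreover have "0 \<le> t" using \<open>t \<in> S\<close> by (auto simp: S_def)
        ultimately have "t \<in> {0..\<tau> - 1 / Suc n}" by simp
        then show "t \<in> (\<Union>n::nat. {0..\<tau> - 1 / Suc n})" by blast
      next
        fix t assume "t \<in> (\<Union>n::nat. {0..\<tau> - 1 / Suc n})"
        then obtain n :: nat where "0 \<le> t" "t \<le> \<tau> - 1 / Suc n" by auto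
        moreover have "0 < 1 / real (Suc n)" by simp
        ultimately show "t \<in> S" by (intro S_int) linarith+
      qed
      then have S_eq: "indicator S t = (SUP n::nat. indicator {0..\<tau> - 1 / Suc n} t :: ennreal)" for t
        by (simp only: indicator_UN_SUP)
      have shrink: "t \<le> \<tau> - 1 / real (Suc (Suc n))" if "t \<le> \<tau> - 1 / real (Suc n)" for t n
        using that frac_le[of 1 1 "real (Suc n)" "real (Suc (Suc n))"] by linarith
      have "(\<integral>\<^sup>+t\<in>S. f t \<partial>lborel) = (\<integral>\<^sup>+t. (SUP n::nat. f t * indicator {0..\<tau> - 1 / Suc n} t) \<partial>lborel)"
        unfolding S_eq by (simp add: SUP_mult_left_ennreal)
      also have "\<dots> = (SUP n. Y (\<tau> - 1 / Suc n))"
        unfolding Y_def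
        by (intro nn_integral_monotone_convergence_SUP incseq_SucI le_funI mult_left_mono)
          (auto simp: indicator_def simp del: of_nat_Suc dest: shrink)
      also have "\<dots> \<le> K"
      proof (rule SUP_least)
        fix n :: nat
        show "Y (\<tau> - 1 / Suc n) \<le> K"
        proof (cases "0 \<le> \<tau> - 1 / Suc n")
          case True
          then have "\<tau> - 1 / Suc n \<in> S" by (intro S_int) auto
          then show ?thesis by (simp add: S_def)
        qed (simp add: Y_def)
      qed
      finally show ?thesis .
    qed
  qed simp
  then show ?thesis unfolding S_def Y_def by simp
qed

section \<open>Predictable integrands\<close>

context poisson_rm
begin

text \<open>Cylinder events over counts inside \<open>H\<close> form a pi-system; for them the
  factorisation follows from independence over disjoint cells, and Dynkin's argument extends it.
  With \<open>H\<close> the past of a time and \<open>D\<close> after it, this is the independence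
  behind compensation.\<close>

lemma indep_N_past:
  assumes D: "D \<in> sets I" "H \<in> sets I" "D \<inter> H = {}"
    and E: "E \<in> sigma_sets (space M)
      {(\<lambda>\<omega>. emeasure (N \<omega>) C) -` B \<inter> space M | C B. C \<in> sets I \<and> C \<subseteq> H \<and> B \<in> sets borel}"
  shows "E \<in> sets M"
    and "(\<integral>\<^sup>+\<omega>. emeasure (N \<omega>) D * indicator E \<omega> \<partial>M) = emeasure I D * emeasure M E"
proof -
  let ?G = "{(\<lambda>\<omega>. emeasure (N \<omega>) C) -` B \<inter> space M | C B. C \<in> sets I \<and> C \<subseteq> H \<and> B \<in> sets borel}"
  \<comment> \<open>Events about one count are not closed under intersection, so finite conjunctions
    of such conditions serve as the pi-system.\<close>
  define P where "P = {{\<omega>\<in>space M. \<forall>i<k. emeasure (N \<omega>) (C i) \<in> B i} | (k::nat) C B.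
     \<forall>i. C i \<in> sets I \<and> C i \<subseteq> H \<and> B i \<in> sets borel}"
  have P_int: "Int_stable P"
  proof (rule Int_stableI)
    fix a b assume "a \<in> P" "b \<in> P"
    from \<open>a \<in> P\<close>[unfolded P_def mem_Collect_eq] obtain k :: nat and C B where a: "a = {\<omega>\<in>space M. \<forall>i<k. emeasure (N \<omega>) (C i) \<in> B i}"
      and C1: "\<forall>i. C i \<in> sets I \<and> C i \<subseteq> H \<and> B i \<in> sets borel"
      by blast
    from \<open>b \<in> P\<close>[unfolded P_def mem_Collect_eq] obtain k' :: nat and C' B' where b: "b = {\<omega>\<in>space M. \<forall>i<k'. emeasure (N \<omega>) (C' i) \<in> B' i}"
      and C2: "\<forall>i. C' i \<in> sets I \<and> C' i \<subseteq> H \<and> B' i \<in> sets borel"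
      by blast
    note C = C1[rule_format] C2[rule_format]
    define C2 where "C2 i = (if i < k then C i else C' (i - k))" for i
    define B2 where "B2 i = (if i < k then B i else B' (i - k))" for i
    have "a \<inter> b = {\<omega>\<in>space M. \<forall>i<k + k'. emeasure (N \<omega>) (C2 i) \<in> B2 i}"
    proof (intro set_eqI iffI)
      fix \<omega> assume "\<omega> \<in> a \<inter> b"
      then show "\<omega> \<in> {\<omega>\<in>space M. \<forall>i<k + k'. emeasure (N \<omega>) (C2 i) \<in> B2 i}"
        by (auto simp: a b C2_def B2_def)
    next
      fix \<omega> assume w: "\<omega> \<in> {\<omega>\<in>space M. \<forall>i<k + k'. emeasure (N \<omega>) (C2 i) \<in> B2 i}"
      then have w': "emeasure (N \<omega>) (C2 i) \<in> B2 i" if "i < k + k'" for i using that by blast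
      have "emeasure (N \<omega>) (C i) \<in> B i" if "i < k" for i
        using w'[of i] that by (simp add: C2_def B2_def)
      moreover have "emeasure (N \<omega>) (C' i) \<in> B' i" if "i < k'" for i
        using w'[of "k + i"] that by (simp add: C2_def B2_def)
      ultimately show "\<omega> \<in> a \<inter> b" using w by (simp add: a b)
    qed
    moreover have "\<forall>i. C2 i \<in> sets I \<and> C2 i \<subseteq> H \<and> B2 i \<in> sets borel"
      using C by (simp add: C2_def B2_def)
    ultimately show "a \<inter> b \<in> P" unfolding P_def by blast
  qed
  have P_sub: "P \<subseteq> Pow (space M)" by (auto simp: P_def)
  have GP: "?G \<subseteq> P"
  proof
    fix a assume "a \<in> ?G"
    then obtain C B where "a = {\<omega>\<in>space M. \<forall>i<Suc 0. emeasure (N \<omega>) C \<in> B}" "C \<in> sets I \<and> C \<subseteq> H \<and> B \<in> sets borel"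
      by auto
    then show "a \<in> P"
      unfolding P_def by (intro CollectI exI[of _ "Suc 0"] exI[of _ "\<lambda>_. C"] exI[of _ "\<lambda>_. B"]) simp
  qed
  have DN: "(\<lambda>\<omega>. emeasure (N \<omega>) D) \<in> borel_measurable M" by (rule measurable_emeasure_N[OF D(1)])
  show *: "E \<in> sets M"
  proof -
    have "?G \<subseteq> sets M"
      using measurable_emeasure_N by (auto intro: measurable_sets)
    from sets.sigma_sets_subset[OF this] E show ?thesis by (rule subsetD)
  qed
  have cylinder: "A \<in> sets M \<and> (\<integral>\<^sup>+\<omega>. emeasure (N \<omega>) D * indicator A \<omega> \<partial>M) = emeasure I D * emeasure M A" if "A \<in> P" for A
  proof -
    from that obtain k :: nat and C B where A: "A = {\<omega>\<in>space M. \<forall>i<k. emeasure (N \<omega>) (C i) \<in> B i}"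
      and C: "\<And>i. C i \<in> sets I" "\<And>i. C i \<subseteq> H" "\<And>i. B i \<in> sets borel"
      unfolding P_def by auto
    \<comment> \<open>Independence is only available for disjoint sets, so the \<open>C i\<close> are split into the atoms of the
      algebra they generate.\<close>
    define atom where "atom S = {p\<in>H. \<forall>i<k. p \<in> C i \<longleftrightarrow> i \<in> S}" for S :: "nat set"
    obtain e :: "nat \<Rightarrow> nat set" where e: "bij_betw e {..<card (Pow {..<k})} (Pow {..<k})"
      using ex_bij_betw_nat_finite[of "Pow {..<k}"] by (auto simp: atLeast0LessThan)
    define m where "m = card (Pow {..<k})"
    have e_sub: "e n \<subseteq> {..<k}" if "n < m" for n
      using bij_betwE[OF e] that by (auto simp: m_def)
    have e_inj: "e n \<noteq> e n'" if "n < m" "n' < m" "n \<noteq> n'" for n n'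
      using bij_betw_imp_inj_on[OF e] that by (auto simp: inj_on_def m_def)
    have e_surj: "\<exists>n<m. e n = S" if "S \<subseteq> {..<k}" for S
    proof -
      have "S \<in> e ` {..<m}"
        unfolding m_def bij_betw_imp_surj_on[OF e] using that by (rule PowI)
      then show ?thesis by blast
    qed
    have atom_sets: "atom S \<in> sets I" for S
    proof -
      have "atom S = H \<inter> (\<Inter>i\<in>{..<k}. if i \<in> S then C i \<inter> H else H - C i)"
        by (auto simp: atom_def split: if_splits)
      also have "\<dots> \<in> sets I"
      proof (cases "k = 0")
        case False
        then show ?thesis using C(1) D(2)
          by (intro sets.Int sets.finite_INT) auto
      qed (use D(2) in simp)
      finally show ?thesis .
    qed
    have atom_disj: "atom S \<inter> atom S' = {}" if "S \<subseteq> {..<k}" "S' \<subseteq> {..<k}" "S \<noteq> S'" for S S'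
      using that by (auto simp: atom_def)
    define Q where "Q i = (case i of 0 \<Rightarrow> D | Suc n \<Rightarrow> if n < m then atom (e n) else {})" for i
    have Q0: "Q 0 = D" by (simp add: Q_def)
    have Q_sets: "range Q \<subseteq> sets I"
      using D(1) atom_sets by (auto simp: Q_def split: nat.splits)
    have Q_disj: "disjoint_family Q"
    proof -
      have d0: "Q 0 \<inter> Q (Suc n) = {}" for n
        using D(3) by (auto simp: Q_def atom_def)
      have dS: "Q (Suc n) \<inter> Q (Suc n') = {}" if "n \<noteq> n'" for n n'
        using atom_disj[of "e n" "e n'"] e_sub[of n] e_sub[of n'] e_inj[of n n'] that by (auto simp: Q_def)
      show ?thesis
        unfolding disjoint_family_on_def
      proof (intro ballI impI)
        fix a b :: nat assume "a \<noteq> b"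
        then show "Q a \<inter> Q b = {}"
          using d0 dS by (cases a; cases b) (simp_all add: Int_commute)
      qed
    qed
    have N_C: "emeasure (N \<omega>) (C i) = (\<Sum>n\<in>{n. n < m \<and> i \<in> e n}. emeasure (N \<omega>) (Q (Suc n)))"
      if "\<omega> \<in> space M" "i < k" for \<omega> i
    proof -
      have "C i = (\<Union>n\<in>{n. n < m \<and> i \<in> e n}. Q (Suc n))"
      proof (intro set_eqI iffI)
        fix p assume p: "p \<in> C i"
        obtain n where n: "n < m" "e n = {j. j < k \<and> p \<in> C j}"
          using e_surj[of "{j. j < k \<and> p \<in> C j}"] by auto
        then have "p \<in> atom (e n)" using p C(2) by (auto simp: atom_def)
        then show "p \<in> (\<Union>n\<in>{n. n < m \<and> i \<in> e n}. Q (Suc n))"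
          using n p that(2) by (auto simp: Q_def)
      next
        fix p assume "p \<in> (\<Union>n\<in>{n. n < m \<and> i \<in> e n}. Q (Suc n))"
        then show "p \<in> C i" using that(2) by (auto simp: Q_def atom_def)
      qed
      then have "emeasure (N \<omega>) (C i) = emeasure (N \<omega>) (\<Union>n\<in>{n. n < m \<and> i \<in> e n}. Q (Suc n))" by simp
      also have "\<dots> = (\<Sum>n\<in>{n. n < m \<and> i \<in> e n}. emeasure (N \<omega>) (Q (Suc n)))"
      proof (rule sum_emeasure[symmetric])
        show "(\<lambda>n. Q (Suc n)) ` {n. n < m \<and> i \<in> e n} \<subseteq> sets (N \<omega>)"
          using Q_sets by (auto simp: sets_N[OF that(1)])
        show "disjoint_family_on (\<lambda>n. Q (Suc n)) {n. n < m \<and> i \<in> e n}"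
          using Q_disj by (auto simp: disjoint_family_on_def)
      qed simp
      finally show ?thesis .
    qed
    \<comment> \<open>Every count on a \<open>C i\<close> is a sum of atom counts, so the indicator
      of the cylinder becomes a function of the coordinates from 1 on, while \<open>D\<close> sits
      at index 0.\<close>
    define F :: "(nat \<Rightarrow> ennreal) \<Rightarrow> ennreal" where
      "F x = (\<Prod>i<k. indicator (B i) (\<Sum>n\<in>{n. n < m \<and> i \<in> e n}. x (Suc n)))" for x
    have Fm: "F \<in> borel_measurable (Pi\<^sub>M {1..} (\<lambda>_. borel))"
      unfolding F_def[abs_def]
    proof (rule borel_measurable_prod_ennreal)
      fix i
      have "(\<lambda>x. \<Sum>n\<in>{n. n < m \<and> i \<in> e n}. x (Suc n) :: ennreal) \<in> borel_measurable (Pi\<^sub>M {1..} (\<lambda>_. borel))"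
        by (intro borel_measurable_sum measurable_component_singleton) auto
      from measurable_compose[OF this borel_measurable_indicator[OF C(3)[of i]]]
      show "(\<lambda>x. indicator (B i) (\<Sum>n\<in>{n. n < m \<and> i \<in> e n}. x (Suc n)) :: ennreal) \<in> borel_measurable (Pi\<^sub>M {1..} (\<lambda>_. borel))" .
    qed
    have FA: "F (restrict (\<lambda>i. emeasure (N \<omega>) (Q i)) {1..}) = indicator A \<omega>" if w: "\<omega> \<in> space M" for \<omega>
    proof -
      have "F (restrict (\<lambda>i. emeasure (N \<omega>) (Q i)) {1..}) = (\<Prod>i<k. indicator (B i) (emeasure (N \<omega>) (C i)))"
        unfolding F_def using N_C[OF that] by (intro prod.cong) simp_all
      also have "\<dots> = indicator A \<omega>"
      proof (cases "\<omega> \<in> A")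
        case True
        then show ?thesis by (simp add: A)
      next
        case False
        then obtain i where "i < k" "emeasure (N \<omega>) (C i) \<notin> B i" using w by (auto simp: A)
        then show ?thesis using False by (simp, intro bexI[of _ i]) auto
      qed
      finally show ?thesis .
    qed
    note ind = indep_N_pair[OF Q_sets Q_disj Fm]
    have A_sets: "A \<in> sets M"
    proof -
      have "{\<omega>\<in>space M. emeasure (N \<omega>) (C i) \<in> B i} \<in> sets M" for i
        using measurable_sets[OF measurable_emeasure_N[OF C(1)] C(3)]
        by (simp add: vimage_def Int_def conj_commute)
      then have "{\<omega>\<in>space M. \<forall>i\<in>{..<k}. emeasure (N \<omega>) (C i) \<in> B i} \<in> sets M"
        by (rule sets.sets_Collect_finite_All) (rule finite_lessThan)
      then show ?thesis unfolding A Ball_def lessThan_iff .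
    qed
    have "(\<integral>\<^sup>+\<omega>. emeasure (N \<omega>) D * indicator A \<omega> \<partial>M)
        = (\<integral>\<^sup>+\<omega>. emeasure (N \<omega>) (Q 0) * F (restrict (\<lambda>i. emeasure (N \<omega>) (Q i)) {1..}) \<partial>M)"
      by (intro nn_integral_cong) (simp only: FA Q0)
    also have "\<dots> = (\<integral>\<^sup>+\<omega>. emeasure (N \<omega>) (Q 0) \<partial>M) * (\<integral>\<^sup>+\<omega>. F (restrict (\<lambda>i. emeasure (N \<omega>) (Q i)) {1..}) \<partial>M)"
      by (rule indep_var_nn_integral_mult[OF ind])
    also have "(\<integral>\<^sup>+\<omega>. emeasure (N \<omega>) (Q 0) \<partial>M) = emeasure I D"
      unfolding Q0 by (rule nn_integral_emeasure_N[OF D(1)])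
    also have "(\<integral>\<^sup>+\<omega>. F (restrict (\<lambda>i. emeasure (N \<omega>) (Q i)) {1..}) \<partial>M) = (\<integral>\<^sup>+\<omega>. indicator A \<omega> \<partial>M)"
      by (intro nn_integral_cong FA)
    also have "\<dots> = emeasure M A" by (rule nn_integral_indicator[OF A_sets])
    finally show ?thesis using A_sets by simp
  qed
  have E': "E \<in> sigma_sets (space M) P"
    using sigma_sets_subseteq[OF GP] E by (rule subsetD)
  show "(\<integral>\<^sup>+\<omega>. emeasure (N \<omega>) D * indicator E \<omega> \<partial>M) = emeasure I D * emeasure M E"
  \<comment> \<open>Complements are treated by subtraction, which needs a finite mean. For infinite
    intensity the count on \<open>D\<close> is almost surely infinite and both sides can be read
    off.\<close>
  proof (cases "emeasure I D < \<infinity>")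
    case True
    have "E \<in> sets M \<and> (\<integral>\<^sup>+\<omega>. emeasure (N \<omega>) D * indicator E \<omega> \<partial>M) = emeasure I D * emeasure M E"
      using P_int P_sub E'
    proof (induction rule: sigma_sets_induct_disjoint)
      case (basic A)
      then show ?case by (rule cylinder)
    next
      case empty
      show ?case by simp
    next
      case (compl A)
      have fin: "(\<integral>\<^sup>+\<omega>. emeasure (N \<omega>) D * indicator A \<omega> \<partial>M) \<noteq> \<infinity>"
        using compl True by (simp add: ennreal_mult_eq_top_iff less_top)
      have Dfin: "AE \<omega> in M. emeasure (N \<omega>) D < \<infinity>"
        using AE_N_nat[OF D(1) True] by eventually_elim (auto simp: of_nat_less_top)
      have m: "(\<lambda>\<omega>. emeasure (N \<omega>) D * indicator A \<omega>) \<in> borel_measurable M"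
        using compl by (intro borel_measurable_times_ennreal DN borel_measurable_indicator) blast
      have "(\<integral>\<^sup>+\<omega>. emeasure (N \<omega>) D * indicator (space M - A) \<omega> \<partial>M)
          = (\<integral>\<^sup>+\<omega>. emeasure (N \<omega>) D - emeasure (N \<omega>) D * indicator A \<omega> \<partial>M)"
      proof (rule nn_integral_cong_AE)
        show "AE \<omega> in M. emeasure (N \<omega>) D * indicator (space M - A) \<omega>
          = emeasure (N \<omega>) D - emeasure (N \<omega>) D * indicator A \<omega>"
          using Dfin AE_space
          by eventually_elim (auto simp: indicator_def ennreal_minus_cancel_iff)
      qed
      also have "\<dots> = (\<integral>\<^sup>+\<omega>. emeasure (N \<omega>) D \<partial>M) - (\<integral>\<^sup>+\<omega>. emeasure (N \<omega>) D * indicator A \<omega> \<partial>M)"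
        by (rule nn_integral_diff[OF DN m fin]) (auto simp: indicator_def)
      also have "\<dots> = emeasure I D * emeasure M (space M) - emeasure I D * emeasure M A"
        using compl by (simp add: nn_integral_emeasure_N[OF D(1)] emeasure_space_1)
      also have "\<dots> = emeasure I D * (emeasure M (space M) - emeasure M A)"
        by (rule ennreal_right_diff_distrib[symmetric]) (use True in auto)
      also have "emeasure M (space M) - emeasure M A = emeasure M (space M - A)"
        using compl by (intro emeasure_compl[symmetric]) auto
      finally show ?case using compl by blast
    next
      case (union A)
      have sets: "range A \<subseteq> sets M" using union by blast
      have "(\<integral>\<^sup>+\<omega>. emeasure (N \<omega>) D * indicator (\<Union>i. A i) \<omega> \<partial>M)
          = (\<integral>\<^sup>+\<omega>. (\<Sum>i. emeasure (N \<omega>) D * indicator (A i) \<omega>) \<partial>M)"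
        by (intro nn_integral_cong) (simp add: suminf_indicator[OF union(1), symmetric])
      also have "\<dots> = (\<Sum>i. \<integral>\<^sup>+\<omega>. emeasure (N \<omega>) D * indicator (A i) \<omega> \<partial>M)"
        by (rule nn_integral_suminf, rule borel_measurable_times_ennreal[OF DN borel_measurable_indicator])
          (use sets in auto)
      also have "\<dots> = emeasure I D * (\<Sum>i. emeasure M (A i))"
        using union by simp
      also have "(\<Sum>i. emeasure M (A i)) = emeasure M (\<Union>i. A i)"
        by (rule suminf_emeasure[OF sets union(1)])
      finally show ?case using sets by blast
    qed
    then show ?thesis by blast
  next
    case False
    then have inf: "emeasure I D = \<infinity>"
      unfolding infinity_ennreal_def top.not_eq_extremum[symmetric] by simp
    have "(\<integral>\<^sup>+\<omega>. emeasure (N \<omega>) D * indicator E \<omega> \<partial>M) = (\<integral>\<^sup>+\<omega>. \<infinity> * indicator E \<omega> \<partial>M)"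
    proof (rule nn_integral_cong_AE)
      show "AE \<omega> in M. emeasure (N \<omega>) D * indicator E \<omega> = \<infinity> * indicator E \<omega>"
        using N_eq_infinity[OF D(1) inf] by eventually_elim simp
    qed
    then show ?thesis using * by (simp add: inf nn_integral_cmult_indicator)
  qed
qed

end

section \<open>The intensity on the time-mark half-plane and the predictable sigma-algebra\<close>

lemma space_dt_d\<theta>: "space dt_d\<theta> = UNIV \<times> {0..}"
  by (simp add: dt_d\<theta>_def space_restrict_space)

lemma sets_dt_d\<theta>_iff: "A \<in> sets dt_d\<theta> \<longleftrightarrow> A \<in> sets borel \<and> A \<subseteq> UNIV \<times> {0..}"
  unfolding dt_d\<theta>_def by (subst sets_restrict_space_iff) (auto simp: borel_prod[symmetric])

lemma sets_dt_d\<theta>_rect: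
  assumes "S \<in> sets borel" "B \<in> sets borel"
  shows "S \<times> (B \<inter> {0..}) \<in> sets dt_d\<theta>"
  unfolding sets_dt_d\<theta>_iff using assms by (auto simp: borel_prod[symmetric])

lemma emeasure_dt_d\<theta>_rect:
  assumes "S \<in> sets borel" "B \<in> sets borel" "B \<subseteq> {0..}"
  shows "emeasure dt_d\<theta> (S \<times> B) = emeasure lborel S * emeasure lborel B"
proof -
  have "emeasure dt_d\<theta> (S \<times> B) = emeasure lborel (S \<times> B)"
    unfolding dt_d\<theta>_def using assms by (intro emeasure_restrict_space) (auto simp: borel_prod[symmetric])
  also have "\<dots> = emeasure lborel S * emeasure lborel B"
    unfolding lborel_prod[symmetric] using assms by (intro lborel.emeasure_pair_measure_Times) auto
  finally show ?thesis .
qed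

lemma measurable_fst_dt_d\<theta>: "fst \<in> borel_measurable dt_d\<theta>"
  and measurable_snd_dt_d\<theta>: "snd \<in> borel_measurable dt_d\<theta>"
  unfolding dt_d\<theta>_def by (rule measurable_restrict_space1, simp add: borel_prod[symmetric])+

lemma nn_integral_dt_d\<theta>:
  assumes [measurable]: "f \<in> borel_measurable (borel \<Otimes>\<^sub>M borel)"
  shows "(\<integral>\<^sup>+p. f p \<partial>dt_d\<theta>) = (\<integral>\<^sup>+t. (\<integral>\<^sup>+x\<in>{0..}. f (t, x) \<partial>lborel) \<partial>lborel)"
proof -
  have "(\<integral>\<^sup>+p. f p \<partial>dt_d\<theta>) = (\<integral>\<^sup>+p. f p * indicator (UNIV \<times> {0..}) p \<partial>(lborel \<Otimes>\<^sub>M lborel))"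
    unfolding dt_d\<theta>_def lborel_prod
    by (rule nn_integral_restrict_space) (auto simp: borel_prod[symmetric])
  also have "\<dots> = (\<integral>\<^sup>+t. (\<integral>\<^sup>+x. f (t, x) * indicator (UNIV \<times> {0..}) (t, x) \<partial>lborel) \<partial>lborel)"
    by (rule lborel.nn_integral_fst[symmetric]) measurable
  also have "\<dots> = (\<integral>\<^sup>+t. (\<integral>\<^sup>+x\<in>{0..}. f (t, x) \<partial>lborel) \<partial>lborel)"
    by (intro nn_integral_cong) (auto simp: indicator_def)
  finally show ?thesis .
qed

text \<open>The generating family from \<open>predictable_sigma\<close>, given a name so that it can
  be handled as a pi-system.\<close>

definition pred_gen :: "'w set \<Rightarrow> (real \<Rightarrow> 'w measure) \<Rightarrow> real \<Rightarrow> (real \<times> 'w) set set" where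
  "pred_gen \<Omega> F T = {{0} \<times> A | A. A \<in> sets (F 0)} \<union>
      {{s<..t} \<times> A | s t A. 0 \<le> s \<and> s < t \<and> t \<le> T \<and> A \<in> sets (F s)}"

lemma predictable_sigma_eq: "predictable_sigma \<Omega> F T = sigma ({0..T} \<times> \<Omega>) (pred_gen \<Omega> F T)"
  by (simp add: predictable_sigma_def pred_gen_def)

locale planar_poisson = poisson_rm M "dt_d\<theta>" N
  for M :: "'w measure" and N :: "'w \<Rightarrow> (real \<times> real) measure" +
  fixes T :: real
  assumes T: "0 < T"
begin

abbreviation "F \<equiv> natural_filtration M N"
abbreviation "PS \<equiv> predictable_sigma (space M) F T"
abbreviation "GPS \<equiv> pred_gen (space M) F T"

lemma space_F: "space (F t) = space M"
  by (simp add: natural_filtration_def space_measure_of_conv)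

lemma sets_F: "sets (F t) = sigma_sets (space M) {(\<lambda>\<omega>. emeasure (N \<omega>) A) -` B \<inter> space M | A B.
        A \<in> sets dt_d\<theta> \<and> A \<subseteq> {..t} \<times> UNIV \<and> B \<in> sets borel}"
  unfolding natural_filtration_def by (rule sets_measure_of) auto

lemma sets_F_mono: "s \<le> t \<Longrightarrow> sets (F s) \<subseteq> sets (F t)"
  unfolding sets_F by (rule sigma_sets_subseteq) fastforce

text \<open>Marks are nonnegative, so the past may be cut to \<open>{..t} \<times> {0..}\<close>.
  Unlike \<open>{..t} \<times> UNIV\<close>, this is a measurable set of \<open>dt_d\<theta>\<close>
  and can play the role of \<open>H\<close> in \<open>indep_N_past\<close>.\<close>

lemma sets_F_past: "sets (F t) \<subseteq> sigma_sets (space M) {(\<lambda>\<omega>. emeasure (N \<omega>) A) -` B \<inter> space M | A B.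
        A \<in> sets dt_d\<theta> \<and> A \<subseteq> {..t} \<times> {0..} \<and> B \<in> sets borel}"
  unfolding sets_F
proof (rule sigma_sets_subseteq, intro subsetI)
  fix E assume "E \<in> {(\<lambda>\<omega>. emeasure (N \<omega>) A) -` B \<inter> space M | A B.
        A \<in> sets dt_d\<theta> \<and> A \<subseteq> {..t} \<times> UNIV \<and> B \<in> sets borel}"
  then obtain A B where E: "E = (\<lambda>\<omega>. emeasure (N \<omega>) A) -` B \<inter> space M" "A \<in> sets dt_d\<theta>"
    "A \<subseteq> {..t} \<times> UNIV" "B \<in> sets borel" by auto
  have "A \<subseteq> {..t} \<times> {0..}"
    using E(3) sets.sets_into_space[OF E(2)] unfolding space_dt_d\<theta> by auto
  then show "E \<in> {(\<lambda>\<omega>. emeasure (N \<omega>) A) -` B \<inter> space M | A B.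
        A \<in> sets dt_d\<theta> \<and> A \<subseteq> {..t} \<times> {0..} \<and> B \<in> sets borel}"
    by (intro CollectI exI[of _ A] exI[of _ B] conjI E)
qed

lemma past_sets: "{..t} \<times> {0..} \<in> sets dt_d\<theta>"
  using sets_dt_d\<theta>_rect[of "{..t}" UNIV] by simp

lemma sets_F_M: "A \<in> sets (F t) \<Longrightarrow> A \<in> sets M"
  using indep_N_past(1)[of "{}" "{..t} \<times> {0..}" A] sets_F_past past_sets by blast

lemma indep_F:
  assumes "A \<in> sets (F t)" "D \<in> sets dt_d\<theta>" "D \<inter> {..t} \<times> UNIV = {}"
  shows "(\<integral>\<^sup>+\<omega>. emeasure (N \<omega>) D * indicator A \<omega> \<partial>M) = emeasure dt_d\<theta> D * emeasure M A"
  using indep_N_past(2)[OF assms(2) past_sets[of t], of A] assms sets_F_past by blast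

lemma GPS_sub: "GPS \<subseteq> Pow ({0..T} \<times> space M)"
  using T sets.sets_into_space[of _ "F _"] unfolding pred_gen_def space_F by fastforce

lemma space_PS: "space PS = {0..T} \<times> space M"
  unfolding predictable_sigma_eq by (rule space_measure_of[OF GPS_sub])

lemma sets_PS: "sets PS = sigma_sets ({0..T} \<times> space M) GPS"
  unfolding predictable_sigma_eq by (rule sets_measure_of[OF GPS_sub])

lemma GPS_cases:
  assumes "S \<in> GPS"
  obtains A where "S = {0} \<times> A" "A \<in> sets (F 0)"
  | s t A where "S = {s<..t} \<times> A" "0 \<le> s" "s < t" "t \<le> T" "A \<in> sets (F s)"
  using assms unfolding pred_gen_def by blast

text \<open>Two rectangles over left-open intervals meet over an interval that begins at the later
  left endpoint, and by then both events are known because the filtration increases.\<close>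

lemma GPS_Int_stable: "Int_stable GPS"
proof (rule Int_stableI)
  fix a b assume a: "a \<in> GPS" and b: "b \<in> GPS"
  have 0: "{0} \<times> A \<in> GPS" if "A \<in> sets (F 0)" for A
    using that unfolding pred_gen_def by blast
  have 1: "{s<..t} \<times> A \<in> GPS" if "0 \<le> s" "s < t" "t \<le> T" "A \<in> sets (F s)" for s t A
    using that unfolding pred_gen_def by blast
  have empty: "{} \<in> GPS" using 0[of "{}"] by simp
  show "a \<inter> b \<in> GPS"
    using a
  proof (cases rule: GPS_cases)
    case (1 A)
    show ?thesis using b
    proof (cases rule: GPS_cases)
      case (1 B)
      then have "a \<inter> b = {0} \<times> (A \<inter> B)" using \<open>a = {0} \<times> A\<close> by auto
      then show ?thesis using 0[of "A \<inter> B"] 1 \<open>A \<in> sets (F 0)\<close> by simp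
    next
      case (2 s t B)
      then have "a \<inter> b = {}" using 1 by auto
      then show ?thesis using empty by simp
    qed
  next
    case (2 s t A)
    show ?thesis using b
    proof (cases rule: GPS_cases)
      case (1 B)
      then have "a \<inter> b = {}" using 2 by auto
      then show ?thesis using empty by simp
    next
      case (2 s' t' B)
      have eq: "a \<inter> b = {max s s'<..min t t'} \<times> (A \<inter> B)"
        using 2 \<open>a = {s<..t} \<times> A\<close> by auto
      have "A \<inter> B \<in> sets (F (max s s'))"
        using 2 \<open>A \<in> sets (F s)\<close> sets_F_mono[of s "max s s'"] sets_F_mono[of s' "max s s'"] by auto
      then show ?thesis
        using 1[of "max s s'" "min t t'" "A \<inter> B"] 2 \<open>0 \<le> s\<close> \<open>s < t\<close> \<open>t \<le> T\<close> empty
        unfolding eq by (cases "max s s' < min t t'") (auto simp: not_less)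
    qed
  qed
qed

text \<open>The predictable sigma-algebra is coarser than the product one, so predictable functions
  are jointly measurable and open to Fubini.\<close>

lemma measurable_id_PS: "(\<lambda>x. x) \<in> measurable (restrict_space borel {0..T} \<Otimes>\<^sub>M M) PS"
  unfolding predictable_sigma_eq
proof (rule measurable_measure_of[OF GPS_sub])
  show "(\<lambda>x. x) \<in> space (restrict_space borel {0..T} \<Otimes>\<^sub>M M) \<rightarrow> {0..T} \<times> space M"
    by (auto simp: space_pair_measure)
  fix S assume S: "S \<in> GPS"
  have rect: "R \<times> A \<in> sets (restrict_space borel {0..T} \<Otimes>\<^sub>M M)"
    if "R \<in> sets borel" "R \<subseteq> {0..T}" "A \<in> sets M" for R A
    using that by (intro pair_measureI) (auto simp: sets_restrict_space_iff)
  have "S \<in> sets (restrict_space borel {0..T} \<Otimes>\<^sub>M M)"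
    using S
  proof (cases rule: GPS_cases)
    case (1 A)
    then show ?thesis using rect[of "{0}" A] T sets_F_M by auto
  next
    case (2 s t A)
    moreover have "{s<..t} \<subseteq> {0..T}" using 2 by auto
    ultimately show ?thesis using rect[of "{s<..t}" A] sets_F_M by auto
  qed
  then show "(\<lambda>x. x) -` S \<inter> space (restrict_space borel {0..T} \<Otimes>\<^sub>M M) \<in> sets (restrict_space borel {0..T} \<Otimes>\<^sub>M M)"
    by (simp add: sets.Int)
qed

lemma measurable_PS_pair:
  assumes "t \<in> borel_measurable L" "w \<in> measurable L M" "\<And>x. x \<in> space L \<Longrightarrow> t x \<in> {0..T}"
  shows "(\<lambda>x. (t x, w x)) \<in> measurable L PS"
proof -
  have "t \<in> measurable L (restrict_space borel {0..T})"
    using assms by (intro measurable_restrict_space2) auto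
  from measurable_compose[OF measurable_Pair[OF this assms(2)] measurable_id_PS] show ?thesis .
qed

lemma sets_PS_borel: "sets (PS \<Otimes>\<^sub>M (borel :: real measure)) =
    sigma_sets (({0..T} \<times> space M) \<times> UNIV) {a \<times> b | a b. a \<in> GPS \<and> b \<in> sets borel}"
proof -
  have "sets (PS \<Otimes>\<^sub>M (borel :: real measure)) = sets (sigma ({0..T} \<times> space M) GPS \<Otimes>\<^sub>M sigma UNIV (sets borel))"
    unfolding predictable_sigma_eq
    using sets.sets_measure_of_eq[of "borel :: real measure" "\<lambda>_. 0"]
    by (intro sets_pair_measure_cong refl) simp
  also have "\<dots> = sets (sigma (({0..T} \<times> space M) \<times> UNIV) {a \<times> b | a b. a \<in> GPS \<and> b \<in> sets borel})"
  proof (rule arg_cong[where f=sets], rule sigma_prod)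
    \<comment> \<open>\<open>{0..T} \<times> space M\<close> is not a generator; it is covered by
      the slice at time 0 and the rectangle over \<open>{0<..T}\<close>.\<close>
    have top: "space M \<in> sets (F s)" for s using sets.top[of "F s"] by (simp add: space_F)
    have "{0} \<times> space M \<in> GPS" "{0<..T} \<times> space M \<in> GPS"
      using T top unfolding pred_gen_def by blast+
    moreover have "{0..T} \<times> space M = \<Union> {{0} \<times> space M, {0<..T} \<times> space M}"
      using T by auto
    ultimately show "\<exists>E\<subseteq>GPS. countable E \<and> {0..T} \<times> space M = \<Union>E"
      by (intro exI[of _ "{{0} \<times> space M, {0<..T} \<times> space M}"]) auto
    show "\<exists>E\<subseteq>sets borel. countable E \<and> (UNIV :: real set) = \<Union>E"
      by (intro exI[of _ "{UNIV}"]) auto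
  qed (use GPS_sub in auto)
  also have "\<dots> = sigma_sets (({0..T} \<times> space M) \<times> UNIV) {a \<times> b | a b. a \<in> GPS \<and> b \<in> sets borel}"
    using GPS_sub by (intro sets_measure_of) blast
  finally show ?thesis .
qed

text \<open>Bounded marks give the finite intensity that \<open>emeasure_kernel_generator\<close>
  requires; letting \<open>n\<close> grow recovers all marks.\<close>

definition slab :: "nat \<Rightarrow> (real \<times> real) set" where
  "slab n = {0..T} \<times> {0..real n}"

lemma slab_sets: "slab n \<in> sets dt_d\<theta>"
  unfolding slab_def using sets_dt_d\<theta>_rect[of "{0..T}" "{0..real n}"] by (simp add: Int_absorb2)

lemma emeasure_slab: "emeasure dt_d\<theta> (slab n) < \<infinity>"
  unfolding slab_def using T by (subst emeasure_dt_d\<theta>_rect) (auto simp: ennreal_mult_less_top)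

lemma rect_sets: "S \<in> sets borel \<Longrightarrow> B \<in> sets borel \<Longrightarrow> slab n \<inter> S \<times> B \<in> sets dt_d\<theta>"
proof -
  assume "S \<in> sets borel" "B \<in> sets borel"
  then have "(S \<inter> {0..T}) \<times> ((B \<inter> {0..real n}) \<inter> {0..}) \<in> sets dt_d\<theta>"
    by (intro sets_dt_d\<theta>_rect) auto
  also have "(S \<inter> {0..T}) \<times> ((B \<inter> {0..real n}) \<inter> {0..}) = slab n \<inter> S \<times> B"
    by (auto simp: slab_def)
  finally show ?thesis .
qed

lemma emeasure_rect_0:
  assumes "B \<in> sets borel"
  shows "emeasure dt_d\<theta> (slab n \<inter> {0} \<times> B) = 0"
proof -
  have "slab n \<inter> {0} \<times> B = {0} \<times> (B \<inter> {0..real n})"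
    using T by (auto simp: slab_def)
  then show ?thesis using assms by (simp, subst emeasure_dt_d\<theta>_rect) auto
qed

text \<open>Over \<open>{s<..t}\<close> the counts are independent of an event known at s; the slice
  at time 0 is null; on the whole space only the mean count is involved.\<close>

lemma predictable_kernel_gen:
  assumes "S \<in> GPS \<or> S = {0..T} \<times> space M" "B \<in> sets borel"
  obtains R A where "S = R \<times> A" "R \<in> sets borel" "A \<in> sets M"
    "(\<integral>\<^sup>+\<omega>. emeasure (N \<omega>) (slab n \<inter> R \<times> B) * indicator A \<omega> \<partial>M) = emeasure dt_d\<theta> (slab n \<inter> R \<times> B) * emeasure M A"
proof -
  consider "S \<in> GPS" | "S = {0..T} \<times> space M" using assms(1) by blast
  then show thesis
  proof cases
    case 1
    then show ?thesis
    proof (cases rule: GPS_cases)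
      case (1 A)
      let ?D = "slab n \<inter> {0} \<times> B"
      have D: "?D \<in> sets dt_d\<theta>" using assms(2) by (intro rect_sets) auto
      have "(\<integral>\<^sup>+\<omega>. emeasure (N \<omega>) ?D * indicator A \<omega> \<partial>M) \<le> (\<integral>\<^sup>+\<omega>. emeasure (N \<omega>) ?D \<partial>M)"
        by (intro nn_integral_mono) (auto simp: indicator_def)
      also have "\<dots> = 0" using nn_integral_emeasure_N[OF D] emeasure_rect_0[OF assms(2)] by simp
      finally have "(\<integral>\<^sup>+\<omega>. emeasure (N \<omega>) ?D * indicator A \<omega> \<partial>M) = emeasure dt_d\<theta> ?D * emeasure M A"
        by (simp add: emeasure_rect_0[OF assms(2)])
      then show ?thesis using that[of "{0}" A] 1 sets_F_M by auto
    next
      case (2 s t A)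
      let ?D = "slab n \<inter> {s<..t} \<times> B"
      have D: "?D \<in> sets dt_d\<theta>" using assms(2) by (intro rect_sets) auto
      have "(\<integral>\<^sup>+\<omega>. emeasure (N \<omega>) ?D * indicator A \<omega> \<partial>M) = emeasure dt_d\<theta> ?D * emeasure M A"
        by (rule indep_F[OF 2(5) D]) auto
      then show ?thesis using that[of "{s<..t}" A] 2 sets_F_M by auto
    qed
  next
    case 2
    let ?D = "slab n \<inter> {0..T} \<times> B"
    have D: "?D \<in> sets dt_d\<theta>" using assms(2) by (intro rect_sets) auto
    have "(\<integral>\<^sup>+\<omega>. emeasure (N \<omega>) ?D * indicator (space M) \<omega> \<partial>M) = (\<integral>\<^sup>+\<omega>. emeasure (N \<omega>) ?D \<partial>M)"
      by (intro nn_integral_cong) simp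
    also have "\<dots> = emeasure dt_d\<theta> ?D * emeasure M (space M)"
      using nn_integral_emeasure_N[OF D] by (simp add: emeasure_space_1)
    finally show ?thesis using that[of "{0..T}" "space M"] 2 by auto
  qed
qed

lemma slab_Int_space: "slab n \<inter> space dt_d\<theta> = slab n"
  using sets.sets_into_space[OF slab_sets] by auto

lemma space_slab: "space (restrict_space dt_d\<theta> (slab n)) = slab n"
  by (simp add: space_restrict_space slab_Int_space)

lemma measurable_slab_map:
  "(\<lambda>x. ((fst (fst x), snd x), snd (fst x))) \<in> measurable (restrict_space dt_d\<theta> (slab n) \<Otimes>\<^sub>M M) (PS \<Otimes>\<^sub>M borel)"
  (is "_ \<in> measurable (?R \<Otimes>\<^sub>M M) _")
proof (rule measurable_Pair)
  show "(\<lambda>x. (fst (fst x), snd x)) \<in> measurable (?R \<Otimes>\<^sub>M M) PS"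
  proof (rule measurable_PS_pair)
    show "(\<lambda>x. fst (fst x)) \<in> borel_measurable (?R \<Otimes>\<^sub>M M)"
      by (rule measurable_compose[OF measurable_fst measurable_restrict_space1[OF measurable_fst_dt_d\<theta>]])
    show "fst (fst x) \<in> {0..T}" if "x \<in> space (?R \<Otimes>\<^sub>M M)" for x
    proof -
      have "fst x \<in> slab n" using that by (auto simp: space_pair_measure space_slab)
      then show ?thesis by (auto simp: slab_def)
    qed
  qed (rule measurable_snd)
  show "(\<lambda>x. snd (fst x)) \<in> borel_measurable (?R \<Otimes>\<^sub>M M)"
    by (rule measurable_compose[OF measurable_fst measurable_restrict_space1[OF measurable_snd_dt_d\<theta>]])
qed

lemma measurable_slab_section:
  assumes "\<omega> \<in> space M"
  shows "(\<lambda>p. ((fst p, \<omega>), snd p)) \<in> measurable (restrict_space dt_d\<theta> (slab n)) (PS \<Otimes>\<^sub>M borel)"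
  using measurable_compose[OF measurable_Pair2'[OF assms] measurable_slab_map] by simp

lemma measurable_slab:
  assumes "f \<in> borel_measurable (PS \<Otimes>\<^sub>M borel)" "\<omega> \<in> space M"
  shows "(\<lambda>p. f ((fst p, \<omega>), snd p) * indicator (slab n) p :: ennreal) \<in> borel_measurable dt_d\<theta>"
  using measurable_compose[OF measurable_slab_section[OF assms(2)] assms(1)]
  by (subst (asm) borel_measurable_restrict_space_iff_ennreal) (simp_all add: slab_Int_space slab_sets)

lemma finite_measure_slab: "finite_measure (restrict_space dt_d\<theta> (slab n))"
  by (rule finite_measureI)
    (use emeasure_slab slab_Int_space in \<open>simp add: space_slab emeasure_restrict_space slab_sets less_top\<close>)

lemma measurable_nn_integral_slab:
  assumes f: "f \<in> borel_measurable (PS \<Otimes>\<^sub>M borel)"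
  shows "(\<lambda>\<omega>. \<integral>\<^sup>+p. f ((fst p, \<omega>), snd p) * indicator (slab n) p \<partial>dt_d\<theta>) \<in> borel_measurable M"
proof -
  interpret R: finite_measure "restrict_space dt_d\<theta> (slab n)" by (rule finite_measure_slab)
  have "(\<lambda>\<omega>. \<integral>\<^sup>+p. f ((fst p, \<omega>), snd p) \<partial>restrict_space dt_d\<theta> (slab n)) \<in> borel_measurable M"
    using R.borel_measurable_nn_integral[OF measurable_pair_swap[OF measurable_compose[OF measurable_slab_map f]]]
    by (simp add: split_beta')
  then show ?thesis
    by (subst (asm) nn_integral_restrict_space) (simp_all add: slab_Int_space slab_sets)
qed

text \<open>Each point of \<open>N \<omega>\<close> is lifted by attaching \<open>\<omega>\<close>
  to its time, and the mean of the lifted random measure is compared with the lifted product measure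
  on predictable rectangles, which determine both. The conclusion is about a measurable version
  \<open>H\<close>, because the lifted kernel is altered on a null set.\<close>

lemma predictable_formula_slab:
  fixes f :: "(real \<times> 'w) \<times> real \<Rightarrow> ennreal"
  assumes f: "f \<in> borel_measurable (PS \<Otimes>\<^sub>M borel)"
  shows "\<exists>H\<in>borel_measurable M. (AE \<omega> in M. H \<omega> = (\<integral>\<^sup>+p\<in>slab n. f ((fst p, \<omega>), snd p) \<partial>N \<omega>)) \<and>
    (\<integral>\<^sup>+\<omega>. H \<omega> \<partial>M) = (\<integral>\<^sup>+\<omega>. (\<integral>\<^sup>+p\<in>slab n. f ((fst p, \<omega>), snd p) \<partial>dt_d\<theta>) \<partial>M)"
proof -
  let ?X = "PS \<Otimes>\<^sub>M (borel :: real measure)"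
  let ?R = "restrict_space dt_d\<theta> (slab n)"
  let ?j = "\<lambda>\<omega> p. ((fst p, \<omega>), snd p) :: (real \<times> 'w) \<times> real"
  note slab_sp = slab_Int_space[of n]
  note R_space = space_slab[of n]
  interpret R: finite_measure ?R by (rule finite_measure_slab)
  interpret RM: pair_sigma_finite ?R M ..
  note jm = measurable_slab_map[of n]
  have jN: "?j \<omega> \<in> measurable (restrict_space (N \<omega>) (slab n)) ?X" if "\<omega> \<in> space M" for \<omega>
  proof -
    have "?j \<omega> \<in> measurable ?R ?X"
      by (rule measurable_slab_section[OF that])
    then show ?thesis
      by (subst measurable_cong_sets[OF sets_restrict_space_cong[OF sets_N[OF that]] refl])
  qed
  define I where "I = distr (?R \<Otimes>\<^sub>M M) ?X (\<lambda>x. ?j (snd x) (fst x))"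
  \<comment> \<open>Realisations with infinitely many points in the slab get the zero measure, so
    that the kernel is finite for every \<open>\<omega>\<close>, as the extension from generators
    demands.\<close>
  define K where "K \<omega> = (if emeasure (N \<omega>) (slab n) < \<infinity> then distr (restrict_space (N \<omega>) (slab n)) ?X (?j \<omega>)
      else null_measure ?X)" for \<omega>
  have sI: "sets I = sets ?X" and spI: "space I = ({0..T} \<times> space M) \<times> UNIV"
    by (simp_all add: I_def space_pair_measure space_PS)
  have sK: "sets (K \<omega>) = sets I" for \<omega>
    by (simp add: K_def sI)
  have Nfin: "AE \<omega> in M. emeasure (N \<omega>) (slab n) < \<infinity>"
    using AE_N_nat[OF slab_sets emeasure_slab, of n] by eventually_elim (auto simp: of_nat_less_top)
  let ?good = "{\<omega>\<in>space M. emeasure (N \<omega>) (slab n) < \<infinity>}"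
  have good: "?good \<in> sets M"
    using measurable_emeasure_N[OF slab_sets[of n]] by measurable
  let ?G = "{a \<times> b | a b. a \<in> GPS \<and> b \<in> sets (borel :: real measure)}"
  have gen: "(\<lambda>\<omega>. emeasure (K \<omega>) Z) \<in> borel_measurable M \<and>
      (\<integral>\<^sup>+\<omega>. emeasure (K \<omega>) Z \<partial>M) = emeasure I Z" if "Z \<in> ?G \<or> Z = space I" for Z
  proof -
    obtain S B where SB: "Z = S \<times> B" "S \<in> GPS \<or> S = {0..T} \<times> space M" "B \<in> sets borel"
    proof (cases "Z = space I")
      case True
      then show ?thesis using that[of "{0..T} \<times> space M" UNIV] by (simp add: spI)
    next
      case False
      then show ?thesis using \<open>Z \<in> ?G \<or> Z = space I\<close> that by blast
    qed
    obtain Q A where Q: "S = Q \<times> A" "Q \<in> sets borel" "A \<in> sets M"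
      "(\<integral>\<^sup>+\<omega>. emeasure (N \<omega>) (slab n \<inter> Q \<times> B) * indicator A \<omega> \<partial>M) = emeasure dt_d\<theta> (slab n \<inter> Q \<times> B) * emeasure M A"
      by (rule predictable_kernel_gen[OF SB(2,3), of n])
    let ?D = "slab n \<inter> Q \<times> B"
    have D: "?D \<in> sets dt_d\<theta>" by (rule rect_sets[OF Q(2) SB(3)])
    have S_sets: "S \<in> sets PS"
      using SB(2) sets.top[of PS] unfolding sets_PS space_PS by auto
    have Z: "Z \<in> sets ?X" unfolding SB(1) using S_sets SB(3) by (rule pair_measureI)
    have KZ: "emeasure (K \<omega>) Z = emeasure (N \<omega>) ?D * indicator A \<omega> * indicator ?good \<omega>" if w: "\<omega> \<in> space M" for \<omega>
    proof (cases "emeasure (N \<omega>) (slab n) < \<infinity>")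
      case True
      have "emeasure (K \<omega>) Z = emeasure (restrict_space (N \<omega>) (slab n)) (?j \<omega> -` Z \<inter> space (restrict_space (N \<omega>) (slab n)))"
        unfolding K_def using True by (simp add: emeasure_distr[OF jN[OF w] Z])
      also have "?j \<omega> -` Z \<inter> space (restrict_space (N \<omega>) (slab n)) = (if \<omega> \<in> A then ?D else {})"
        using slab_sp by (auto simp: space_restrict_space space_N[OF w] SB(1) Q(1))
      also have "emeasure (restrict_space (N \<omega>) (slab n)) \<dots> = emeasure (N \<omega>) \<dots>"
        using slab_sp slab_sets by (intro emeasure_restrict_space) (auto simp: space_N[OF w] sets_N[OF w])
      finally show ?thesis using True w by simp
    qed (simp add: K_def)
    have m: "(\<lambda>\<omega>. emeasure (N \<omega>) ?D * indicator A \<omega> * indicator ?good \<omega>) \<in> borel_measurable M"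
      using D Q(3) good by (intro borel_measurable_times_ennreal measurable_emeasure_N borel_measurable_indicator)
    have "(\<integral>\<^sup>+\<omega>. emeasure (N \<omega>) ?D * indicator A \<omega> * indicator ?good \<omega> \<partial>M)
        = (\<integral>\<^sup>+\<omega>. emeasure (N \<omega>) ?D * indicator A \<omega> \<partial>M)"
    proof (rule nn_integral_cong_AE)
      show "AE \<omega> in M. emeasure (N \<omega>) ?D * indicator A \<omega> * indicator ?good \<omega> = emeasure (N \<omega>) ?D * indicator A \<omega>"
        using Nfin AE_space by eventually_elim simp
    qed
    also have "\<dots> = emeasure dt_d\<theta> ?D * emeasure M A" by (rule Q(4))
    also have "\<dots> = emeasure I Z"
    proof -
      have "emeasure I Z = emeasure (?R \<Otimes>\<^sub>M M) ((\<lambda>x. ?j (snd x) (fst x)) -` Z \<inter> space (?R \<Otimes>\<^sub>M M))"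
        unfolding I_def by (rule emeasure_distr[OF jm Z])
      also have "(\<lambda>x. ?j (snd x) (fst x)) -` Z \<inter> space (?R \<Otimes>\<^sub>M M) = ?D \<times> A"
        using sets.sets_into_space[OF Q(3)] by (auto simp: space_pair_measure R_space SB(1) Q(1))
      also have "emeasure (?R \<Otimes>\<^sub>M M) (?D \<times> A) = emeasure ?R ?D * emeasure M A"
        using D Q(3) slab_sp slab_sets by (intro emeasure_pair_measure_Times) (auto simp: sets_restrict_space_iff)
      also have "emeasure ?R ?D = emeasure dt_d\<theta> ?D"
        using slab_sp slab_sets by (intro emeasure_restrict_space) auto
      finally show ?thesis by (rule sym)
    qed
    finally show ?thesis by (intro measurable_nn_integral_cong[OF KZ] conjI m)
  qed
  have Kfin: "emeasure (K \<omega>) (space I) < \<infinity>" if w: "\<omega> \<in> space M" for \<omega>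
  proof (cases "emeasure (N \<omega>) (slab n) < \<infinity>")
    case True
    have "emeasure (K \<omega>) (space I) = emeasure (restrict_space (N \<omega>) (slab n)) (?j \<omega> -` space I \<inter> space (restrict_space (N \<omega>) (slab n)))"
      unfolding K_def using True by (simp add: emeasure_distr[OF jN[OF w]] I_def)
    also have "\<dots> \<le> emeasure (restrict_space (N \<omega>) (slab n)) (space (restrict_space (N \<omega>) (slab n)))"
      by (rule emeasure_mono) auto
    also have "\<dots> = emeasure (N \<omega>) (slab n)"
      using slab_sp slab_sets by (subst emeasure_restrict_space) (auto simp: space_restrict_space space_N[OF w] sets_N[OF w])
    finally show ?thesis using True by simp
  qed (simp add: K_def)
  have Ifin: "emeasure I (space I) < \<infinity>"
  proof -
    have "emeasure I (space I) = emeasure (?R \<Otimes>\<^sub>M M) (space (?R \<Otimes>\<^sub>M M))"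
      unfolding I_def by (subst emeasure_distr[OF jm]) (use measurable_space[OF jm] in \<open>auto intro!: arg_cong[where f="emeasure _"]\<close>)
    also have "\<dots> = emeasure ?R (space ?R) * emeasure M (space M)"
      unfolding space_pair_measure by (rule emeasure_pair_measure_Times) auto
    also have "\<dots> < \<infinity>"
      using R.emeasure_finite[of "space ?R"] unfolding infinity_ennreal_def top.not_eq_extremum[symmetric]
      by (simp add: emeasure_space_1)
    finally show ?thesis .
  qed
  have G_int: "Int_stable ?G"
  proof (rule Int_stableI)
    fix a b assume "a \<in> ?G" "b \<in> ?G"
    then obtain a1 a2 b1 b2 where ab: "a = a1 \<times> a2" "b = b1 \<times> b2" "a1 \<in> GPS" "b1 \<in> GPS" "a2 \<in> sets borel" "b2 \<in> sets borel"
      by blast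
    then have "a \<inter> b = (a1 \<inter> b1) \<times> (a2 \<inter> b2)" by auto
    moreover have "a1 \<inter> b1 \<in> GPS" using Int_stableD[OF GPS_Int_stable ab(3,4)] .
    ultimately show "a \<inter> b \<in> ?G" using ab by blast
  qed
  have G_sub: "?G \<subseteq> Pow (space I)"
    using GPS_sub unfolding spI by blast
  have G_sets: "sets I = sigma_sets (space I) ?G"
    unfolding sI spI by (rule sets_PS_borel)
  note ker = emeasure_kernel_generator[where K=K and I=I and M=M, OF sK Kfin Ifin G_int G_sub G_sets gen]
  have fI: "f \<in> borel_measurable I"
    using f by (simp add: measurable_cong_sets[OF sI refl])
  note fK = nn_integral_kernel[where K=K and I=I and M=M, OF sK conjunct1[OF ker] conjunct2[OF ker] fI]
  have "(\<integral>\<^sup>+x. f x \<partial>I) = (\<integral>\<^sup>+x. f (?j (snd x) (fst x)) \<partial>(?R \<Otimes>\<^sub>M M))"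
    unfolding I_def using f by (intro nn_integral_distr[OF jm]) simp
  also have "\<dots> = (\<integral>\<^sup>+\<omega>. (\<integral>\<^sup>+p. f (?j \<omega> p) \<partial>?R) \<partial>M)"
    using RM.nn_integral_snd[OF measurable_compose[OF jm f]] by (simp add: split_beta')
  also have "\<dots> = (\<integral>\<^sup>+\<omega>. (\<integral>\<^sup>+p\<in>slab n. f (?j \<omega> p) \<partial>dt_d\<theta>) \<partial>M)"
    using slab_sp slab_sets by (intro nn_integral_cong nn_integral_restrict_space) simp
  finally have fI': "(\<integral>\<^sup>+x. f x \<partial>I) = (\<integral>\<^sup>+\<omega>. (\<integral>\<^sup>+p\<in>slab n. f (?j \<omega> p) \<partial>dt_d\<theta>) \<partial>M)" .
  have "AE \<omega> in M. (\<integral>\<^sup>+x. f x \<partial>K \<omega>) = (\<integral>\<^sup>+p\<in>slab n. f (?j \<omega> p) \<partial>N \<omega>)"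
    using Nfin AE_space
  proof eventually_elim
    case (elim \<omega>)
    have "(\<integral>\<^sup>+x. f x \<partial>K \<omega>) = (\<integral>\<^sup>+p. f (?j \<omega> p) \<partial>restrict_space (N \<omega>) (slab n))"
      unfolding K_def using elim(1) f by (simp add: nn_integral_distr[OF jN[OF elim(2)]])
    also have "\<dots> = (\<integral>\<^sup>+p\<in>slab n. f (?j \<omega> p) \<partial>N \<omega>)"
      using slab_sp slab_sets by (intro nn_integral_restrict_space) (simp add: space_N[OF elim(2)] sets_N[OF elim(2)])
    finally show ?case .
  qed
  then show ?thesis
    by (intro bexI[of _ "\<lambda>\<omega>. \<integral>\<^sup>+x. f x \<partial>K \<omega>"] conjI trans[OF fK(2) fI'] fK(1))
qed

text \<open>This is the compensation formula: in the mean, \<open>N\<close> may be replaced by its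
  intensity under a predictable integrand with a mark. It is the monotone limit of the slab
  versions, at the cost of countably many null sets.\<close>

lemma predictable_formula:
  fixes f :: "(real \<times> 'w) \<times> real \<Rightarrow> ennreal"
  assumes f: "f \<in> borel_measurable (PS \<Otimes>\<^sub>M borel)"
  shows "\<exists>H\<in>borel_measurable M.
    (AE \<omega> in M. H \<omega> = (\<integral>\<^sup>+p\<in>{0..T} \<times> {0..}. f ((fst p, \<omega>), snd p) \<partial>N \<omega>)) \<and>
    (\<integral>\<^sup>+\<omega>. H \<omega> \<partial>M) = (\<integral>\<^sup>+\<omega>. (\<integral>\<^sup>+p\<in>{0..T} \<times> {0..}. f ((fst p, \<omega>), snd p) \<partial>dt_d\<theta>) \<partial>M)"
proof -
  let ?g = "\<lambda>n \<omega> p. f ((fst p, \<omega>), snd p) * indicator (slab n) p"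
  have "\<forall>n. \<exists>H. H \<in> borel_measurable M \<and> (AE \<omega> in M. H \<omega> = (\<integral>\<^sup>+p. ?g n \<omega> p \<partial>N \<omega>)) \<and>
      (\<integral>\<^sup>+\<omega>. H \<omega> \<partial>M) = (\<integral>\<^sup>+\<omega>. (\<integral>\<^sup>+p. ?g n \<omega> p \<partial>dt_d\<theta>) \<partial>M)"
    using predictable_formula_slab[OF f] unfolding Bex_def by (rule allI)
  from choice[OF this] obtain H where
    H': "\<forall>n. H n \<in> borel_measurable M \<and> (AE \<omega> in M. H n \<omega> = (\<integral>\<^sup>+p. ?g n \<omega> p \<partial>N \<omega>)) \<and>
      (\<integral>\<^sup>+\<omega>. H n \<omega> \<partial>M) = (\<integral>\<^sup>+\<omega>. (\<integral>\<^sup>+p. ?g n \<omega> p \<partial>dt_d\<theta>) \<partial>M)" ..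
  note Hm = conjunct1[OF H'[rule_format]]
    and H = conjunct1[OF conjunct2[OF H'[rule_format]]]
    and Hi = conjunct2[OF conjunct2[OF H'[rule_format]]]
  have mono: "?g n \<omega> p \<le> ?g (Suc n) \<omega> p" for n \<omega> p
    by (intro mult_left_mono) (auto simp: slab_def indicator_def)
  have slab_UN: "indicator ({0..T} \<times> {0..}) p = (SUP n. indicator (slab n) p :: ennreal)" for p
  proof -
    have "(\<Union>n. slab n) = {0..T} \<times> {0..}"
      using real_arch_simple by (auto simp: slab_def)
    then show ?thesis by (metis indicator_UN_SUP)
  qed
  have sup: "(\<integral>\<^sup>+p\<in>{0..T} \<times> {0..}. f ((fst p, \<omega>), snd p) \<partial>L) = (SUP n. \<integral>\<^sup>+p. ?g n \<omega> p \<partial>L)"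
    if L: "sets L = sets dt_d\<theta>" and w: "\<omega> \<in> space M" for L \<omega>
  proof -
    have "(\<integral>\<^sup>+p\<in>{0..T} \<times> {0..}. f ((fst p, \<omega>), snd p) \<partial>L) = (\<integral>\<^sup>+p. (SUP n. ?g n \<omega> p) \<partial>L)"
      unfolding slab_UN by (simp only: SUP_mult_left_ennreal)
    also have "\<dots> = (SUP n. \<integral>\<^sup>+p. ?g n \<omega> p \<partial>L)"
    proof (rule nn_integral_monotone_convergence_SUP)
      show "incseq (\<lambda>n. ?g n \<omega>)" by (intro incseq_SucI le_funI mono)
      show "?g n \<omega> \<in> borel_measurable L" for n
        using measurable_slab[OF f w, of n] unfolding measurable_cong_sets[OF L refl] .
    qed
    finally show ?thesis .
  qed
  have "AE \<omega> in M. \<forall>n. H n \<omega> = (\<integral>\<^sup>+p. ?g n \<omega> p \<partial>N \<omega>)"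
    unfolding AE_all_countable by (intro allI H)
  then have ae: "AE \<omega> in M. (SUP n. H n \<omega>) = (\<integral>\<^sup>+p\<in>{0..T} \<times> {0..}. f ((fst p, \<omega>), snd p) \<partial>N \<omega>)"
    using AE_space
  proof eventually_elim
    case (elim \<omega>)
    then show ?case unfolding sup[OF sets_N[OF elim(2)] elim(2)] by simp
  qed
  have "(\<integral>\<^sup>+\<omega>. (SUP n. H n \<omega>) \<partial>M) = (SUP n. \<integral>\<^sup>+\<omega>. H n \<omega> \<partial>M)"
  proof (rule nn_integral_monotone_convergence_SUP_AE[OF _ Hm])
    show "AE \<omega> in M. H n \<omega> \<le> H (Suc n) \<omega>" for n
      using H[of n] H[of "Suc n"]
    proof eventually_elim
      case (elim \<omega>)
      show ?case unfolding elim by (rule nn_integral_mono[OF mono])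
    qed
  qed
  also have "\<dots> = (SUP n. \<integral>\<^sup>+\<omega>. (\<integral>\<^sup>+p. ?g n \<omega> p \<partial>dt_d\<theta>) \<partial>M)"
    by (simp only: Hi)
  also have "\<dots> = (\<integral>\<^sup>+\<omega>. (SUP n. \<integral>\<^sup>+p. ?g n \<omega> p \<partial>dt_d\<theta>) \<partial>M)"
    by (rule nn_integral_monotone_convergence_SUP[symmetric])
      (intro incseq_SucI le_funI nn_integral_mono mono, rule measurable_nn_integral_slab[OF f])
  also have "\<dots> = (\<integral>\<^sup>+\<omega>. (\<integral>\<^sup>+p\<in>{0..T} \<times> {0..}. f ((fst p, \<omega>), snd p) \<partial>dt_d\<theta>) \<partial>M)"
    by (intro nn_integral_cong sup[OF refl, symmetric])
  finally show ?thesis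
    by (intro bexI[of _ "\<lambda>\<omega>. SUP n. H n \<omega>"] conjI ae borel_measurable_SUP Hm) simp_all
qed

lemma GPS_I: "0 \<le> s \<Longrightarrow> s < t \<Longrightarrow> t \<le> T \<Longrightarrow> A \<in> sets (F s) \<Longrightarrow> {s<..t} \<times> A \<in> GPS"
  unfolding pred_gen_def by blast

lemma GPS_in_PS: "S \<in> GPS \<Longrightarrow> S \<in> sets PS"
  unfolding sets_PS by (rule sigma_sets.Basic)

lemma space_in_F: "space M \<in> sets (F s)"
  using sets.top[of "F s"] by (simp add: space_F)

lemma fst_PS: "fst \<in> borel_measurable PS"
proof (rule borel_measurableI_greater)
  fix c :: real
  consider "c < 0" | "0 \<le> c" "c < T" | "T \<le> c" by linarith
  then show "{x \<in> space PS. c < fst x} \<in> sets PS"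
  proof cases
    case 1
    then have "{x \<in> space PS. c < fst x} = space PS" by (auto simp: space_PS)
    then show ?thesis by (simp only: sets.top)
  next
    case 2
    then have "{x \<in> space PS. c < fst x} = {c<..T} \<times> space M" by (auto simp: space_PS)
    also have "\<dots> \<in> sets PS" using 2 by (intro GPS_in_PS GPS_I space_in_F) auto
    finally show ?thesis .
  next
    case 3
    then have "{x \<in> space PS. c < fst x} = {}" by (auto simp: space_PS)
    then show ?thesis by (simp only: sets.empty_sets)
  qed
qed

lemma PS_section:
  assumes "\<omega> \<in> space M" "t \<le> T"
  shows "(\<lambda>r. (r, \<omega>)) \<in> measurable (restrict_space lborel {0..t}) PS"
proof (rule measurable_PS_pair)
  show "(\<lambda>r. r) \<in> borel_measurable (restrict_space lborel {0..t})"
    by (rule measurable_restrict_space1) simp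
  show "r \<in> {0..T}" if "r \<in> space (restrict_space lborel {0..t})" for r
    using that assms by (simp add: space_restrict_space)
qed (use assms in simp)

lemma PS_at_time:
  assumes "t \<in> {0..T}"
  shows "(\<lambda>\<omega>. (t, \<omega>)) \<in> measurable M PS"
  by (rule measurable_PS_pair) (use assms in auto)

lemma PS_joint:
  fixes f :: "real \<times> 'w \<Rightarrow> ennreal"
  assumes f: "f \<in> borel_measurable PS"
  shows "(\<lambda>x. f x * indicator ({0..T} \<times> space M) x) \<in> borel_measurable (borel \<Otimes>\<^sub>M M)"
proof -
  let ?L = "restrict_space (borel \<Otimes>\<^sub>M M) ({0..T} \<times> space M)"
  have "(\<lambda>x. (fst x, snd x)) \<in> measurable ?L PS"
    by (rule measurable_PS_pair) (auto simp: space_restrict_space space_pair_measure intro!: measurable_restrict_space1)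
  from measurable_compose[OF this f] have "f \<in> borel_measurable ?L" by simp
  then show ?thesis
    by (subst (asm) borel_measurable_restrict_space_iff_ennreal)
      (auto simp: space_pair_measure Int_absorb2)
qed

text \<open>On a generating rectangle the running integral is explicit and depends on the past
  alone. The result makes the stopping rule \<open>J\<close> predictable.\<close>

lemma time_integral_predictable:
  fixes f :: "real \<times> 'w \<Rightarrow> ennreal"
  assumes f: "f \<in> borel_measurable PS"
  shows "(\<lambda>x. \<integral>\<^sup>+r\<in>{0..fst x}. f (r, snd x) \<partial>lborel) \<in> borel_measurable PS"
proof -
  \<comment> \<open>The null measure turns the kernel lemmas into pure measurability statements.\<close>
  let ?Z = "null_measure PS"
  define K where "K x = distr (restrict_space lborel {0..fst x}) PS (\<lambda>r. (r, snd x))" for x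
  have sec: "(\<lambda>r. (r, snd x)) \<in> measurable (restrict_space lborel {0..fst x}) PS" if "x \<in> space ?Z" for x
    using that by (intro PS_section) (auto simp: space_PS)
  have KS: "emeasure (K x) (R \<times> A) = emeasure lborel ({0..fst x} \<inter> R) * indicator A (snd x)"
    if x: "x \<in> space ?Z" and "R \<times> A \<in> sets PS" "R \<in> sets borel" for x R A
  proof -
    have "emeasure (K x) (R \<times> A) = emeasure (restrict_space lborel {0..fst x})
        ((\<lambda>r. (r, snd x)) -` (R \<times> A) \<inter> space (restrict_space lborel {0..fst x}))"
      unfolding K_def by (rule emeasure_distr[OF sec[OF x] that(2)])
    also have "(\<lambda>r. (r, snd x)) -` (R \<times> A) \<inter> space (restrict_space lborel {0..fst x})
        = (if snd x \<in> A then {0..fst x} \<inter> R else {})"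
      by (auto simp: space_restrict_space)
    also have "emeasure (restrict_space lborel {0..fst x}) \<dots> = emeasure lborel \<dots>"
      by (intro emeasure_restrict_space) auto
    finally show ?thesis by simp
  qed
  have top: "({0..T} \<times> space M) \<in> sets PS" using sets.top[of PS] by (simp only: space_PS)
  have gen: "(\<lambda>x. emeasure (K x) S) \<in> borel_measurable ?Z \<and> (\<integral>\<^sup>+x. emeasure (K x) S \<partial>?Z) = emeasure ?Z S"
    if S: "S \<in> GPS \<or> S = space ?Z" for S
  proof -
    have "(\<lambda>x. emeasure (K x) S) \<in> borel_measurable PS"
    proof (cases "S = space ?Z")
      case True
      then have S_eq: "S = {0..T} \<times> space M" by (simp add: space_PS)
      have "emeasure (K x) S = ennreal (fst x)" if "x \<in> space PS" for x
      proof -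
        have "{0..fst x} \<inter> {0..T} = {0..fst x}" using that by (auto simp: space_PS)
        then show ?thesis
          using KS[of x "{0..T}" "space M"] top that S_eq by (auto simp: space_PS)
      qed
      then show ?thesis
        by (subst measurable_cong) (auto intro: measurable_compose[OF fst_PS measurable_ennreal])
    next
      case False
      then have "S \<in> GPS" using S by blast
      then have S_sets: "S \<in> sets PS" by (rule GPS_in_PS)
      from \<open>S \<in> GPS\<close> show ?thesis
      proof (cases rule: GPS_cases)
        case (1 A)
        have "emeasure (K x) S = 0" if "x \<in> space PS" for x
        proof -
          have "emeasure lborel ({0..fst x} \<inter> {0}) \<le> emeasure lborel {0::real}"
            by (intro emeasure_mono) auto
          then show ?thesis using KS[of x "{0}" A] S_sets that 1 by simp
        qed
        then show ?thesis by (subst measurable_cong) auto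
      next
        case (2 s t A)
        \<comment> \<open>\<open>A\<close> is known at time s and enters only afterwards, so the
          value is a function of time multiplied by the indicator of a predictable
          rectangle.\<close>
        have "emeasure (K x) S = ennreal (min (fst x) t - s) * indicator ({s<..T} \<times> A) x"
          if x: "x \<in> space PS" for x
        proof -
          have "{0..fst x} \<inter> {s<..t} = {s<..min (fst x) t}" using 2 by auto
          moreover have "emeasure lborel {s<..min (fst x) t} = ennreal (min (fst x) t - s) * indicator {s<..T} (fst x)"
            using 2 x by (auto simp: indicator_def space_PS min_def)
          ultimately show ?thesis
            using KS[of x "{s<..t}" A] S_sets x 2 by (cases x) (auto simp: indicator_def)
        qed
        moreover have "(\<lambda>x. ennreal (min (fst x) t - s) * indicator ({s<..T} \<times> A) x) \<in> borel_measurable PS"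
          using 2 fst_PS
          by (intro borel_measurable_times_ennreal borel_measurable_indicator GPS_in_PS GPS_I) auto
        ultimately show ?thesis by (subst measurable_cong) auto
      qed
    qed
    then show ?thesis by (simp add: measurable_def)
  qed
  have fin: "emeasure (K x) (space ?Z) < \<infinity>" if "x \<in> space ?Z" for x
  proof -
    have "emeasure (K x) (space ?Z) = emeasure lborel ({0..fst x} \<inter> {0..T}) * indicator (space M) (snd x)"
      using KS[OF that, of "{0..T}" "space M"] top by (simp add: space_PS)
    also have "\<dots> \<le> emeasure lborel {0..T}"
      by (auto simp: indicator_def intro!: emeasure_mono)
    also have "\<dots> < \<infinity>" using T by simp
    finally show ?thesis .
  qed
  have G: "GPS \<subseteq> Pow (space ?Z)" "sets ?Z = sigma_sets (space ?Z) GPS"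
    using GPS_sub by (simp_all add: space_PS sets_PS)
  have sK: "sets (K x) = sets ?Z" for x by (simp add: K_def)
  have fin0: "emeasure ?Z (space ?Z) < \<infinity>" by simp
  note ker = emeasure_kernel_generator[where K=K and I="?Z" and M="?Z", OF sK fin fin0 GPS_Int_stable G gen]
  have fZ: "f \<in> borel_measurable ?Z" using f by (simp add: measurable_def)
  have "(\<lambda>x. \<integral>\<^sup>+r. f r \<partial>K x) \<in> borel_measurable ?Z"
    by (rule nn_integral_kernel(1)[where K=K and I="?Z" and M="?Z", OF sK conjunct1[OF ker] conjunct2[OF ker] fZ])
  then have "(\<lambda>x. \<integral>\<^sup>+r. f r \<partial>K x) \<in> borel_measurable PS" by (simp add: measurable_def)
  moreover have "(\<integral>\<^sup>+r. f r \<partial>K x) = (\<integral>\<^sup>+r\<in>{0..fst x}. f (r, snd x) \<partial>lborel)" if "x \<in> space PS" for x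
  proof -
    have "(\<integral>\<^sup>+r. f r \<partial>K x) = (\<integral>\<^sup>+r. f (r, snd x) \<partial>restrict_space lborel {0..fst x})"
      unfolding K_def using sec that f by (intro nn_integral_distr) auto
    also have "\<dots> = (\<integral>\<^sup>+r\<in>{0..fst x}. f (r, snd x) \<partial>lborel)"
      by (rule nn_integral_restrict_space) simp
    finally show ?thesis .
  qed
  ultimately show ?thesis by (subst (asm) measurable_cong) auto
qed

text \<open>A Poisson random measure is defined through the laws of its counts; that almost every
  realisation is sigma-finite follows from finite counts on countably many boxes. Pathwise Fubini
  relies on it.\<close>

lemma AE_sigma_finite_N: "AE \<omega> in M. sigma_finite_measure (N \<omega>)"
proof -
  define C where "C k = {- real k..real k} \<times> {0..real k}" for k :: nat
  have C_sets: "C k \<in> sets dt_d\<theta>" for k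
    using sets_dt_d\<theta>_rect[of "{- real k..real k}" "{0..real k}"] by (simp add: C_def Int_absorb2)
  have C_fin: "emeasure dt_d\<theta> (C k) < \<infinity>" for k
    unfolding C_def by (subst emeasure_dt_d\<theta>_rect) (auto simp: ennreal_mult_less_top)
  have C_UN: "(\<Union>k. C k) = UNIV \<times> {0..}"
  proof (intro set_eqI iffI)
    fix p :: "real \<times> real" assume p: "p \<in> UNIV \<times> {0..}"
    obtain k where "max \<bar>fst p\<bar> \<bar>snd p\<bar> \<le> real k" using real_arch_simple by blast
    then have "p \<in> C k" using p by (cases p) (auto simp: C_def)
    then show "p \<in> (\<Union>k. C k)" by blast
  qed (auto simp: C_def)
  have "AE \<omega> in M. emeasure (N \<omega>) (C k) < \<infinity>" for k
    using AE_N_nat[OF C_sets C_fin, of k] by eventually_elim (auto simp: of_nat_less_top)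
  then have "AE \<omega> in M. \<forall>k. emeasure (N \<omega>) (C k) < \<infinity>"
    unfolding AE_all_countable by (rule allI)
  then show ?thesis
    using AE_space
  proof eventually_elim
    case (elim \<omega>)
    show ?case
    proof
      show "\<exists>A. countable A \<and> A \<subseteq> sets (N \<omega>) \<and> \<Union>A = space (N \<omega>) \<and> (\<forall>a\<in>A. emeasure (N \<omega>) a \<noteq> \<infinity>)"
      proof (intro exI[of _ "range C"] conjI ballI)
        show "range C \<subseteq> sets (N \<omega>)" using C_sets by (auto simp: sets_N[OF elim(2)])
        show "\<Union>(range C) = space (N \<omega>)" by (simp add: C_UN space_N[OF elim(2)] space_dt_d\<theta>)
        show "emeasure (N \<omega>) A \<noteq> \<infinity>" if "A \<in> range C" for A
          using that elim(1) by (auto simp: less_top[symmetric])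
      qed simp
    qed
  qed
qed

end

section \<open>The mean of the Hawkes intensity\<close>

text \<open>\<open>\<psi>\<close> stands for the scaled kernel extended by 0 to the nonpositive
  axis. The restriction to points before t is thereby carried by the kernel, and only the condition
  of positive time remains as an indicator.\<close>

locale hawkes_process = planar_poisson M N T
  for M :: "'w measure" and N :: "'w \<Rightarrow> (real \<times> real) measure" and T :: real +
  fixes \<mu> a B :: real and \<psi> :: "real \<Rightarrow> real" and \<Lambda> :: "real \<Rightarrow> 'w \<Rightarrow> real"
  assumes \<mu>: "0 < \<mu>" and a: "0 < a" "a < 1"
    and \<psi>m: "\<psi> \<in> borel_measurable borel" and \<psi>_nonpos: "\<And>t. t \<le> 0 \<Longrightarrow> \<psi> t = 0"
    and \<psi>B: "\<And>t. t \<le> T \<Longrightarrow> \<psi> t \<le> B" and \<psi>a: "(\<integral>\<^sup>+t. ennreal (\<psi> t) \<partial>lborel) \<le> ennreal a"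
    and \<Lambda>m: "(\<lambda>x. \<Lambda> (fst x) (snd x)) \<in> borel_measurable PS"
    and \<Lambda>: "AE \<omega> in M. \<forall>t\<in>{0..T}. ennreal (\<Lambda> t \<omega>) = ennreal \<mu> +
        (\<integral>\<^sup>+p. ennreal (\<psi> (t - fst p)) * indicator {0<..} (fst p) * indicator {..\<Lambda> (fst p) \<omega>} (snd p) \<partial>N \<omega>)"
begin

definition \<Lambda>' :: "real \<times> 'w \<Rightarrow> ennreal" where "\<Lambda>' x = ennreal (\<Lambda> (fst x) (snd x))"

definition Y :: "real \<times> 'w \<Rightarrow> ennreal" where
  "Y x = (\<integral>\<^sup>+r\<in>{0..fst x}. \<Lambda>' (r, snd x) \<partial>lborel)"

text \<open>Stopping at level \<open>k\<close>, encoded by an indicator that decreases in time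
  rather than by a stopping time; it is predictable because \<open>Y\<close> is.\<close>

definition J :: "nat \<Rightarrow> real \<times> 'w \<Rightarrow> ennreal" where
  "J k x = indicator {y. y \<le> of_nat k} (Y x)"

lemma \<Lambda>'_PS: "\<Lambda>' \<in> borel_measurable PS"
  unfolding \<Lambda>'_def[abs_def] by (rule measurable_compose[OF \<Lambda>m measurable_ennreal])

lemma J_PS: "J k \<in> borel_measurable PS"
proof -
  have "Y \<in> borel_measurable PS"
    unfolding Y_def[abs_def] by (rule time_integral_predictable[OF \<Lambda>'_PS])
  moreover have "(indicator {y. y \<le> of_nat k} :: ennreal \<Rightarrow> ennreal) \<in> borel_measurable borel"
    by (rule borel_measurable_indicator) measurable
  ultimately show ?thesis
    unfolding J_def[abs_def] by (rule measurable_compose)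
qed

lemma J_antimono: "s \<le> t \<Longrightarrow> J k (t, \<omega>) \<le> J k (s, \<omega>)"
proof -
  assume "s \<le> t"
  then have "Y (s, \<omega>) \<le> Y (t, \<omega>)"
    unfolding Y_def by (intro nn_integral_mono) (auto simp: indicator_def)
  then show ?thesis unfolding J_def by (auto simp: indicator_def)
qed

lemma \<Lambda>_section:
  assumes "\<omega> \<in> space M"
  shows "(\<lambda>t. \<Lambda>' (t, \<omega>) * indicator {0..T} t) \<in> borel_measurable borel"
proof -
  have "(\<lambda>t. \<Lambda>' (t, \<omega>)) \<in> borel_measurable (restrict_space lborel {0..T})"
    by (rule measurable_compose[OF PS_section[OF assms order_refl] \<Lambda>'_PS])
  then show ?thesis
    by (subst (asm) borel_measurable_restrict_space_iff_ennreal) auto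
qed

lemma accepted_sets:
  assumes w: "\<omega> \<in> space M"
  shows "{p\<in>space dt_d\<theta>. 0 < fst p \<and> fst p \<le> T \<and> ennreal (snd p) \<le> \<Lambda>' (fst p, \<omega>) * indicator {0..T} (fst p)} \<in> sets dt_d\<theta>"
proof -
  note [measurable] = \<Lambda>_section[OF w] measurable_fst_dt_d\<theta> measurable_snd_dt_d\<theta>
  have "(\<lambda>p. \<Lambda>' (fst p, \<omega>) * indicator {0..T} (fst p)) \<in> borel_measurable dt_d\<theta>"
    by (rule measurable_compose[OF measurable_fst_dt_d\<theta> \<Lambda>_section[OF w]])
  then show ?thesis by measurable
qed

text \<open>Up to the constant \<open>\<mu>\<close> the intensity is a sum of kernels over the
  accepted points, finite at every time because \<open>\<Lambda>\<close> is real-valued.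
  \<open>nn_integral_convolution_finite\<close> turns this into integrability up to any time before
  \<open>T\<close>.\<close>

lemma Y_finite: "AE \<omega> in M. \<forall>x\<in>{0..<T}. Y (x, \<omega>) < \<infinity>"
  using \<Lambda> AE_sigma_finite_N AE_space
proof eventually_elim
  case (elim \<omega>)
  note w = elim(3)
  define A where "A = {p\<in>space dt_d\<theta>. 0 < fst p \<and> fst p \<le> T \<and> ennreal (snd p) \<le> \<Lambda>' (fst p, \<omega>) * indicator {0..T} (fst p)}"
  have A: "A \<in> sets (N \<omega>)"
    unfolding A_def sets_N[OF w] by (rule accepted_sets[OF w])
  have fstm: "fst \<in> borel_measurable (N \<omega>)"
    using measurable_fst_dt_d\<theta> unfolding measurable_cong_sets[OF sets_N[OF w] refl] .
  define g where "g t = (\<integral>\<^sup>+p\<in>A. ennreal (\<psi> (t - fst p)) \<partial>N \<omega>)" for t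
  have eq: "\<Lambda>' (t, \<omega>) = ennreal \<mu> + g t" if t: "0 \<le> t" "t \<le> T" for t
  proof -
    have "\<Lambda>' (t, \<omega>) = ennreal \<mu> +
        (\<integral>\<^sup>+p. ennreal (\<psi> (t - fst p)) * indicator {0<..} (fst p) * indicator {..\<Lambda> (fst p) \<omega>} (snd p) \<partial>N \<omega>)"
      using elim(1) t by (simp add: \<Lambda>'_def)
    also have "(\<integral>\<^sup>+p. ennreal (\<psi> (t - fst p)) * indicator {0<..} (fst p) * indicator {..\<Lambda> (fst p) \<omega>} (snd p) \<partial>N \<omega>) = g t"
      unfolding g_def
    proof (rule nn_integral_cong)
      fix p assume "p \<in> space (N \<omega>)"
      then have p: "p \<in> space dt_d\<theta>" by (simp add: space_N[OF w])
      then have "0 \<le> snd p" by (auto simp: space_dt_d\<theta>)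
      show "ennreal (\<psi> (t - fst p)) * indicator {0<..} (fst p) * indicator {..\<Lambda> (fst p) \<omega>} (snd p)
        = ennreal (\<psi> (t - fst p)) * indicator A p"
      proof (cases "0 < fst p \<and> fst p < t")
        case True
        \<comment> \<open>In [0,\<infinity>] a negative real becomes 0, so a mark 0 could be
          accepted in \<open>A\<close> under a negative intensity. The equation rules this out, its
          right-hand side being at least \<open>\<mu>\<close>.\<close>
        then have "p \<in> A \<longleftrightarrow> snd p \<le> \<Lambda> (fst p) \<omega> \<or> snd p = 0"
          using p t \<open>0 \<le> snd p\<close> by (auto simp: A_def \<Lambda>'_def ennreal_le_iff2)
        moreover have "0 \<le> \<Lambda> (fst p) \<omega>"
        proof (rule ccontr)
          assume "\<not> 0 \<le> \<Lambda> (fst p) \<omega>"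
          then have "ennreal (\<Lambda> (fst p) \<omega>) = 0" by (simp add: ennreal_neg)
          moreover have "fst p \<in> {0..T}" using True t by auto
          ultimately show False using elim(1) \<mu> by force
        qed
        ultimately show ?thesis using True by (auto simp: indicator_def)
      next
        case False
        then show ?thesis
          using \<psi>_nonpos[of "t - fst p"] by (cases "0 < fst p") (auto simp: A_def)
      qed
    qed
    finally show ?thesis .
  qed
  have gfin: "g t < \<infinity>" if "0 \<le> t" "t \<le> T" for t
  proof -
    have "ennreal \<mu> + g t < \<infinity>"
      unfolding eq[OF that, symmetric] \<Lambda>'_def by simp
    then show ?thesis by simp
  qed
  have gm: "g \<in> borel_measurable borel"
  proof -
    interpret sigma_finite_measure "N \<omega>" by (rule elim(2))
    have "(\<lambda>x. ennreal (\<psi> (fst x - fst (snd x))) * indicator A (snd x)) \<in> borel_measurable (borel \<Otimes>\<^sub>M N \<omega>)"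
      by (intro borel_measurable_times_ennreal measurable_compose[OF measurable_snd borel_measurable_indicator[OF A]]
          measurable_compose[OF _ measurable_ennreal] measurable_compose[OF _ \<psi>m] borel_measurable_diff
          measurable_fst measurable_compose[OF measurable_snd fstm])
    then show ?thesis
      unfolding g_def[abs_def] by (intro borel_measurable_nn_integral) (simp add: split_beta')
  qed
  show ?case
  proof
    fix x assume x: "x \<in> {0..<T}"
    have "(\<integral>\<^sup>+t\<in>{0..x}. g t \<partial>lborel) < \<infinity>"
      unfolding g_def
      by (rule nn_integral_convolution_finite[OF elim(2) A fstm \<psi>m \<psi>_nonpos \<psi>B])
        (use x gfin in \<open>auto simp: A_def g_def\<close>)
    moreover have "Y (x, \<omega>) = (\<integral>\<^sup>+t. ennreal \<mu> * indicator {0..x} t + g t * indicator {0..x} t \<partial>lborel)"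
      unfolding Y_def using x by (intro nn_integral_cong) (auto simp: indicator_def eq)
    ultimately show "Y (x, \<omega>) < \<infinity>"
      using gm x by (simp add: nn_integral_add nn_integral_cmult ennreal_mult_less_top)
  qed
qed

text \<open>The stopped intensity, extended by 0 so that convolutions can run over the whole
  line.\<close>

definition q :: "nat \<Rightarrow> real \<times> 'w \<Rightarrow> ennreal" where
  "q k x = \<Lambda>' x * J k x * indicator ({0..T} \<times> space M) x"

definition w :: "nat \<Rightarrow> real \<Rightarrow> ennreal" where
  "w k t = (\<integral>\<^sup>+\<omega>. q k (t, \<omega>) \<partial>M)"

sublocale LM: pair_sigma_finite lborel M ..

lemma q_joint: "q k \<in> borel_measurable (lborel \<Otimes>\<^sub>M M)"
proof -
  have "q k \<in> borel_measurable (borel \<Otimes>\<^sub>M M)"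
    unfolding q_def[abs_def] by (rule PS_joint[OF borel_measurable_times_ennreal[OF \<Lambda>'_PS J_PS]])
  then show ?thesis by (simp cong: measurable_cong_sets)
qed

lemma q_sections:
  shows "\<omega> \<in> space M \<Longrightarrow> (\<lambda>s. q k (s, \<omega>)) \<in> borel_measurable borel"
    and "(\<lambda>\<omega>. q k (s, \<omega>)) \<in> borel_measurable M"
  using measurable_compose[OF measurable_Pair2' q_joint] measurable_compose[OF measurable_Pair1' q_joint]
  by simp_all

lemma w_measurable: "w k \<in> borel_measurable borel"
  unfolding w_def[abs_def] using borel_measurable_nn_integral[of "\<lambda>s \<omega>. q k (s, \<omega>)" lborel] q_joint by simp

lemma nn_integral_w: "(\<integral>\<^sup>+s. w k s \<partial>lborel) = (\<integral>\<^sup>+\<omega>. (\<integral>\<^sup>+s. q k (s, \<omega>) \<partial>lborel) \<partial>M)"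
  unfolding w_def using q_joint by (intro LM.Fubini'[symmetric]) simp

text \<open>The marks are integrated out: at each time the accepted marks form an interval whose
  length is the intensity. An inequality results, since the condition of positive time is
  dropped.\<close>

lemma accepted_integral:
  assumes w: "\<omega> \<in> space M"
  shows "(\<integral>\<^sup>+p\<in>{0..T} \<times> {0..}. ennreal (\<psi> (t - fst p)) * indicator {0<..} (fst p) *
        indicator {..\<Lambda> (fst p) \<omega>} (snd p) * J k (fst p, \<omega>) \<partial>dt_d\<theta>)
    \<le> (\<integral>\<^sup>+s. ennreal (\<psi> (t - s)) * q k (s, \<omega>) \<partial>lborel)"
proof -
  define lam where "lam s = enn2real (\<Lambda>' (s, \<omega>) * indicator {0..T} s)" for s
  define jj where "jj s = J k (s, \<omega>) * indicator {0..T} s" for s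
  have lamm: "lam \<in> borel_measurable borel"
    unfolding lam_def[abs_def] by (rule borel_measurable_enn2real[OF \<Lambda>_section[OF w]])
  have "(\<lambda>s. J k (s, \<omega>)) \<in> borel_measurable (restrict_space lborel {0..T})"
    by (rule measurable_compose[OF PS_section[OF w order_refl] J_PS])
  then have jjm: "jj \<in> borel_measurable borel"
    unfolding jj_def[abs_def] by (subst (asm) borel_measurable_restrict_space_iff_ennreal) auto
  note [measurable] = lamm jjm \<psi>m
  have lam_eq: "lam s = max 0 (\<Lambda> s \<omega>)" if "s \<in> {0..T}" for s
    using that by (cases "0 \<le> \<Lambda> s \<omega>") (simp_all add: lam_def \<Lambda>'_def ennreal_neg)
  let ?f = "\<lambda>p. ennreal (\<psi> (t - fst p)) * jj (fst p) * (if snd p \<le> lam (fst p) then 1 else 0)"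
  have "(\<integral>\<^sup>+p\<in>{0..T} \<times> {0..}. ennreal (\<psi> (t - fst p)) * indicator {0<..} (fst p) *
        indicator {..\<Lambda> (fst p) \<omega>} (snd p) * J k (fst p, \<omega>) \<partial>dt_d\<theta>) \<le> (\<integral>\<^sup>+p. ?f p \<partial>dt_d\<theta>)"
    by (intro nn_integral_mono) (auto simp: indicator_def jj_def lam_eq)
  also have "\<dots> = (\<integral>\<^sup>+s. (\<integral>\<^sup>+x\<in>{0..}. ?f (s, x) \<partial>lborel) \<partial>lborel)"
    by (rule nn_integral_dt_d\<theta>) measurable
  also have "\<dots> = (\<integral>\<^sup>+s. ennreal (\<psi> (t - s)) * q k (s, \<omega>) \<partial>lborel)"
  proof (rule nn_integral_cong)
    fix s
    have "(\<integral>\<^sup>+x\<in>{0..}. ?f (s, x) \<partial>lborel) = (\<integral>\<^sup>+x. ennreal (\<psi> (t - s)) * jj s * indicator {0..lam s} x \<partial>lborel)"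
      by (intro nn_integral_cong) (auto simp: indicator_def)
    also have "\<dots> = ennreal (\<psi> (t - s)) * jj s * ennreal (lam s)"
      by (subst nn_integral_cmult_indicator) (auto simp: lam_def)
    also have "\<dots> = ennreal (\<psi> (t - s)) * q k (s, \<omega>)"
    proof -
      have "\<Lambda>' (s, \<omega>) < top" by (simp add: \<Lambda>'_def)
      then show ?thesis
        using w by (auto simp: jj_def lam_def q_def indicator_def mult_ac)
    qed
    finally show "(\<integral>\<^sup>+x\<in>{0..}. ?f (s, x) \<partial>lborel) = ennreal (\<psi> (t - s)) * q k (s, \<omega>)" .
  qed
  finally show ?thesis .
qed

text \<open>\<open>J k\<close> decreases in time, so its value at t can be replaced by its value at
  each earlier accepted point and moved under the integral. The integrand is then predictable, and
  compensation replaces \<open>N\<close> by its intensity.\<close>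

lemma renewal_inequality:
  assumes t: "t \<in> {0..T}"
  shows "w k t \<le> ennreal \<mu> + (\<integral>\<^sup>+s. ennreal (\<psi> (t - s)) * w k s \<partial>lborel)"
proof -
  define f where "f x = ennreal (\<psi> (t - fst (fst x))) * indicator {0<..} (fst (fst x)) *
      indicator {..\<Lambda> (fst (fst x)) (snd (fst x))} (snd x) * J k (fst x)" for x :: "(real \<times> 'w) \<times> real"
  have fm: "f \<in> borel_measurable (PS \<Otimes>\<^sub>M borel)"
  proof -
    have 1: "(\<lambda>x. fst (fst x)) \<in> borel_measurable (PS \<Otimes>\<^sub>M (borel :: real measure))"
      by (rule measurable_compose[OF measurable_fst fst_PS])
    have 2: "(\<lambda>x. \<Lambda> (fst (fst x)) (snd (fst x))) \<in> borel_measurable (PS \<Otimes>\<^sub>M (borel :: real measure))"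
      by (rule measurable_compose[OF measurable_fst \<Lambda>m])
    have 3: "(\<lambda>x. J k (fst x)) \<in> borel_measurable (PS \<Otimes>\<^sub>M (borel :: real measure))"
      by (rule measurable_compose[OF measurable_fst J_PS])
    have 4: "(\<lambda>x. indicator {..\<Lambda> (fst (fst x)) (snd (fst x))} (snd x) :: ennreal) \<in> borel_measurable (PS \<Otimes>\<^sub>M borel)"
    proof -
      have "{x\<in>space (PS \<Otimes>\<^sub>M borel). snd x \<le> \<Lambda> (fst (fst x)) (snd (fst x))} \<in> sets (PS \<Otimes>\<^sub>M (borel :: real measure))"
        by (rule borel_measurable_le[OF measurable_snd 2])
      from borel_measurable_indicator[OF this] show ?thesis
        by (subst measurable_cong) (auto simp: indicator_def)
    qed
    show ?thesis
      unfolding f_def[abs_def]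
      by (intro borel_measurable_times_ennreal 3 4 measurable_compose[OF 1 borel_measurable_indicator]
          measurable_compose[OF _ measurable_ennreal] measurable_compose[OF _ \<psi>m] borel_measurable_diff 1) simp_all
  qed
  obtain H where H: "H \<in> borel_measurable M"
    "AE \<omega> in M. H \<omega> = (\<integral>\<^sup>+p\<in>{0..T} \<times> {0..}. f ((fst p, \<omega>), snd p) \<partial>N \<omega>)"
    "(\<integral>\<^sup>+\<omega>. H \<omega> \<partial>M) = (\<integral>\<^sup>+\<omega>. (\<integral>\<^sup>+p\<in>{0..T} \<times> {0..}. f ((fst p, \<omega>), snd p) \<partial>dt_d\<theta>) \<partial>M)"
    using predictable_formula[OF fm] by blast
  have "AE \<omega> in M. q k (t, \<omega>) \<le> ennreal \<mu> + H \<omega>"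
    using \<Lambda> H(2) AE_space
  proof eventually_elim
    case (elim \<omega>)
    have "q k (t, \<omega>) = J k (t, \<omega>) * \<Lambda>' (t, \<omega>)"
      using t elim(3) by (simp add: q_def mult.commute)
    also have "\<dots> = J k (t, \<omega>) * ennreal \<mu> + J k (t, \<omega>) *
        (\<integral>\<^sup>+p. ennreal (\<psi> (t - fst p)) * indicator {0<..} (fst p) * indicator {..\<Lambda> (fst p) \<omega>} (snd p) \<partial>N \<omega>)"
      using elim(1) t by (simp add: \<Lambda>'_def distrib_left)
    also have "\<dots> \<le> ennreal \<mu> + H \<omega>"
    proof (rule add_mono)
      show "J k (t, \<omega>) * ennreal \<mu> \<le> ennreal \<mu>" by (auto simp: J_def indicator_def)
      show "J k (t, \<omega>) * (\<integral>\<^sup>+p. ennreal (\<psi> (t - fst p)) * indicator {0<..} (fst p) * indicator {..\<Lambda> (fst p) \<omega>} (snd p) \<partial>N \<omega>) \<le> H \<omega>"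
      proof (cases "J k (t, \<omega>) = 0")
        case False
        then have J1: "J k (t, \<omega>) = 1" by (auto simp: J_def indicator_def split: if_splits)
        have "(\<integral>\<^sup>+p. ennreal (\<psi> (t - fst p)) * indicator {0<..} (fst p) * indicator {..\<Lambda> (fst p) \<omega>} (snd p) \<partial>N \<omega>) \<le> H \<omega>"
          unfolding elim(2)
        proof (rule nn_integral_mono)
          fix p assume "p \<in> space (N \<omega>)"
          then have p: "0 \<le> snd p" by (auto simp: space_N[OF elim(3)] space_dt_d\<theta>)
          show "ennreal (\<psi> (t - fst p)) * indicator {0<..} (fst p) * indicator {..\<Lambda> (fst p) \<omega>} (snd p)
            \<le> f ((fst p, \<omega>), snd p) * indicator ({0..T} \<times> {0..}) p"
          proof (cases "0 < fst p \<and> fst p < t")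
            case True
            have "1 \<le> J k (fst p, \<omega>)" using J_antimono[of "fst p" t k \<omega>] True J1 by simp
            then have "J k (fst p, \<omega>) = 1"
              by (cases "Y (fst p, \<omega>) \<le> of_nat k") (simp_all add: J_def)
            moreover have "p \<in> {0..T} \<times> {0..}" using True t p by (cases p) auto
            ultimately show ?thesis by (simp add: f_def)
          next
            case False
            then show ?thesis using \<psi>_nonpos[of "t - fst p"] by (cases "0 < fst p") auto
          qed
        qed
        then show ?thesis by (simp add: J1)
      qed simp
    qed
    finally show ?case .
  qed
  then have "w k t \<le> (\<integral>\<^sup>+\<omega>. ennreal \<mu> + H \<omega> \<partial>M)"
    unfolding w_def by (rule nn_integral_mono_AE)
  also have "\<dots> = ennreal \<mu> + (\<integral>\<^sup>+\<omega>. H \<omega> \<partial>M)"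
    using H(1) by (simp add: nn_integral_add emeasure_space_1)
  also have "(\<integral>\<^sup>+\<omega>. H \<omega> \<partial>M) \<le> (\<integral>\<^sup>+\<omega>. (\<integral>\<^sup>+s. ennreal (\<psi> (t - s)) * q k (s, \<omega>) \<partial>lborel) \<partial>M)"
    unfolding H(3) f_def fst_conv snd_conv by (rule nn_integral_mono[OF accepted_integral])
  also have "\<dots> = (\<integral>\<^sup>+s. (\<integral>\<^sup>+\<omega>. ennreal (\<psi> (t - s)) * q k (s, \<omega>) \<partial>M) \<partial>lborel)"
  proof (rule LM.Fubini')
    have "(\<lambda>x. ennreal (\<psi> (t - fst x)) * q k x) \<in> borel_measurable (lborel \<Otimes>\<^sub>M M)"
      by (intro borel_measurable_times_ennreal q_joint measurable_compose[OF _ measurable_ennreal]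
          measurable_compose[OF _ \<psi>m] borel_measurable_diff) simp_all
    then show "(\<lambda>(s, \<omega>). ennreal (\<psi> (t - s)) * q k (s, \<omega>)) \<in> borel_measurable (lborel \<Otimes>\<^sub>M M)"
      by (simp add: split_beta')
  qed
  also have "\<dots> = (\<integral>\<^sup>+s. ennreal (\<psi> (t - s)) * w k s \<partial>lborel)"
    unfolding w_def by (intro nn_integral_cong nn_integral_cmult q_sections)
  finally show ?thesis by (simp add: add_left_mono)
qed

lemma q_mono: "q k (t, \<omega>) \<le> q (Suc k) (t, \<omega>)"
proof -
  have "J k (t, \<omega>) \<le> J (Suc k) (t, \<omega>)"
    using order_trans[of "Y (t, \<omega>)" "of_nat k" "of_nat (Suc k)"]
    unfolding J_def by (auto simp: indicator_def simp del: of_nat_Suc)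
  then show ?thesis
    unfolding q_def by (intro mult_right_mono mult_left_mono) auto
qed

text \<open>Integrating the renewal inequality and exchanging the order of integration gives
  \<open>?W \<le> \<mu> * T + a * ?W\<close>, because the kernel has mass at most
  \<open>a\<close>.\<close>

lemma w_bound: "(\<integral>\<^sup>+s. w k s \<partial>lborel) \<le> ennreal (\<mu> * T / (1 - a))"
proof -
  let ?W = "\<integral>\<^sup>+s. w k s \<partial>lborel"
  note [measurable] = w_measurable[of k] \<psi>m
  have w0: "w k t = 0" if "t \<notin> {0..T}" for t
  proof -
    have "q k (t, \<omega>) = 0" for \<omega> using that by (auto simp: q_def indicator_def)
    then show ?thesis by (simp add: w_def)
  qed
  have "?W \<le> (\<integral>\<^sup>+t. ennreal \<mu> * indicator {0..T} t + (\<integral>\<^sup>+s. ennreal (\<psi> (t - s)) * w k s \<partial>lborel) \<partial>lborel)"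
    using renewal_inequality w0 by (intro nn_integral_mono) (auto simp: indicator_def)
  also have "\<dots> = ennreal \<mu> * emeasure lborel {0..T} + (\<integral>\<^sup>+t. (\<integral>\<^sup>+s. ennreal (\<psi> (t - s)) * w k s \<partial>lborel) \<partial>lborel)"
  proof (subst nn_integral_add)
    show "(\<lambda>t. \<integral>\<^sup>+s. ennreal (\<psi> (t - s)) * w k s \<partial>lborel) \<in> borel_measurable lborel"
      by measurable
  qed (auto simp: nn_integral_cmult_indicator)
  also have "ennreal \<mu> * emeasure lborel {0..T} = ennreal (\<mu> * T)"
    using \<mu> T by (simp add: ennreal_mult)
  also have "(\<integral>\<^sup>+t. (\<integral>\<^sup>+s. ennreal (\<psi> (t - s)) * w k s \<partial>lborel) \<partial>lborel)
      = (\<integral>\<^sup>+s. (\<integral>\<^sup>+t. ennreal (\<psi> (t - s)) * w k s \<partial>lborel) \<partial>lborel)"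
    by (rule lborel_pair.Fubini') measurable
  also have "\<dots> \<le> (\<integral>\<^sup>+s. ennreal a * w k s \<partial>lborel)"
  proof (rule nn_integral_mono)
    fix s
    have "(\<integral>\<^sup>+t. ennreal (\<psi> (t - s)) \<partial>lborel) = (\<integral>\<^sup>+t. ennreal (\<psi> t) \<partial>lborel)"
      using \<psi>m by (subst nn_integral_real_affine[where c=1 and t=s]) auto
    then show "(\<integral>\<^sup>+t. ennreal (\<psi> (t - s)) * w k s \<partial>lborel) \<le> ennreal a * w k s"
      using \<psi>m \<psi>a by (subst nn_integral_multc) (auto intro: mult_right_mono)
  qed
  also have "\<dots> = ennreal a * ?W"
    using w_measurable by (intro nn_integral_cmult) simp
  finally have le: "?W \<le> ennreal (\<mu> * T) + ennreal a * ?W" by (simp add: add_left_mono)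
  \<comment> \<open>A crude bound that depends on \<open>k\<close>. It serves to make
    \<open>?W\<close> finite, so that \<open>a * ?W\<close> may be brought to the other side; the
    resulting bound is free of \<open>k\<close>.\<close>
  have "?W \<le> (\<integral>\<^sup>+\<omega>. of_nat k \<partial>M)"
    unfolding nn_integral_w
  proof (rule nn_integral_mono)
    fix \<omega> assume \<omega>: "\<omega> \<in> space M"
    let ?l = "\<lambda>t. \<Lambda>' (t, \<omega>) * indicator {0..T} t"
    have Y: "Y (t, \<omega>) = (\<integral>\<^sup>+r\<in>{0..t}. ?l r \<partial>lborel)" if "t \<in> {0..T}" for t
      unfolding Y_def using that by (intro nn_integral_cong) (auto simp: indicator_def)
    have "(\<integral>\<^sup>+s. q k (s, \<omega>) \<partial>lborel) = (\<integral>\<^sup>+t\<in>{t\<in>{0..T}. (\<integral>\<^sup>+r\<in>{0..t}. ?l r \<partial>lborel) \<le> of_nat k}. ?l t \<partial>lborel)"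
      using \<omega> by (intro nn_integral_cong) (auto simp: q_def J_def indicator_def Y)
    also have "\<dots> \<le> of_nat k"
      by (rule nn_integral_stopped_le[OF \<Lambda>_section[OF \<omega>]])
    finally show "(\<integral>\<^sup>+s. q k (s, \<omega>) \<partial>lborel) \<le> of_nat k" .
  qed
  also have "\<dots> < \<infinity>" by (simp add: emeasure_space_1 of_nat_less_top)
  finally have "?W < \<infinity>" .
  then obtain r where r: "?W = ennreal r" "0 \<le> r" by (cases ?W) auto
  have "ennreal r \<le> ennreal (\<mu> * T + a * r)"
    using le r \<mu> T a by (simp add: ennreal_mult ennreal_plus)
  then have "r \<le> \<mu> * T + a * r"
    using r \<mu> T a by (subst (asm) ennreal_le_iff) auto
  then have "r \<le> \<mu> * T / (1 - a)" using a by (simp add: field_simps)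
  then show ?thesis unfolding r by (rule ennreal_leI)
qed

text \<open>Before \<open>T\<close> the integrated intensity is almost surely finite, so the
  stopping is inactive for large k and the stopped means increase to a bound for the full mean. The
  time \<open>T\<close> itself is a null set.\<close>

lemma mean_intensity_bound:
  "(\<integral>\<^sup>+t\<in>{0..T}. (\<integral>\<^sup>+\<omega>. \<Lambda>' (t, \<omega>) \<partial>M) \<partial>lborel) \<le> ennreal (\<mu> * T / (1 - a))"
proof -
  have "(\<integral>\<^sup>+t\<in>{0..T}. (\<integral>\<^sup>+\<omega>. \<Lambda>' (t, \<omega>) \<partial>M) \<partial>lborel) \<le> (\<integral>\<^sup>+t. (SUP k. w k t) \<partial>lborel)"
  proof (rule nn_integral_mono_AE)
    show "AE t in lborel. (\<integral>\<^sup>+\<omega>. \<Lambda>' (t, \<omega>) \<partial>M) * indicator {0..T} t \<le> (SUP k. w k t)"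
      using AE_lborel_singleton[of T]
    proof eventually_elim
      case (elim t)
      show ?case
      proof (cases "t \<in> {0..<T}")
        case True
        have "(\<integral>\<^sup>+\<omega>. \<Lambda>' (t, \<omega>) \<partial>M) \<le> (\<integral>\<^sup>+\<omega>. (SUP k. q k (t, \<omega>)) \<partial>M)"
        proof (rule nn_integral_mono_AE)
          show "AE \<omega> in M. \<Lambda>' (t, \<omega>) \<le> (SUP k. q k (t, \<omega>))"
            using Y_finite AE_space
          proof eventually_elim
            case (elim \<omega>)
            then have "Y (t, \<omega>) < \<infinity>" using True by blast
            then obtain k where "Y (t, \<omega>) < of_nat k"
              using ennreal_Ex_less_of_nat by (auto simp: less_top)
            then have "\<Lambda>' (t, \<omega>) = q k (t, \<omega>)"
              using True elim(2) by (simp add: q_def J_def less_imp_le)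
            also have "\<dots> \<le> (SUP k. q k (t, \<omega>))" by (rule SUP_upper) simp
            finally show ?case .
          qed
        qed
        also have "\<dots> = (SUP k. w k t)"
          unfolding w_def
        proof (rule nn_integral_monotone_convergence_SUP[OF _ q_sections(2)])
          show "incseq (\<lambda>k \<omega>. q k (t, \<omega>))" by (intro incseq_SucI le_funI q_mono)
        qed
        finally show ?thesis using True by simp
      next
        case False
        then have "t \<notin> {0..T}" using elim by auto
        then show ?thesis by simp
      qed
    qed
  qed
  also have "\<dots> = (SUP k. \<integral>\<^sup>+t. w k t \<partial>lborel)"
  proof (rule nn_integral_monotone_convergence_SUP)
    show "incseq w"
      unfolding w_def by (intro incseq_SucI le_funI nn_integral_mono q_mono)
  qed (use w_measurable in simp)
  also have "\<dots> \<le> ennreal (\<mu> * T / (1 - a))"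
    by (intro SUP_least w_bound)
  finally show ?thesis .
qed

section \<open>The normalised integrand and its first three moments\<close>

definition E' :: "real \<Rightarrow> ennreal" where
  "E' t = (\<integral>\<^sup>+\<omega>. \<Lambda>' (t, \<omega>) \<partial>M) * indicator {0..T} t"

text \<open>\<open>enn2real\<close> sends \<infinity> to 0, the same default as the Bochner
  expectation of a non-integrable nonnegative variable, so \<open>e\<close> agrees with the
  expectation at every time in \<open>{0..T}\<close> and is Borel measurable.\<close>

definition e :: "real \<Rightarrow> real" where
  "e t = enn2real (E' t)"

lemma E'_measurable: "E' \<in> borel_measurable borel"
proof -
  have "(\<lambda>t. \<integral>\<^sup>+\<omega>. \<Lambda>' (t, \<omega>) * indicator ({0..T} \<times> space M) (t, \<omega>) \<partial>M) \<in> borel_measurable borel"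
    using PS_joint[OF \<Lambda>'_PS] by (intro borel_measurable_nn_integral) (simp add: split_beta')
  moreover have "E' t = (\<integral>\<^sup>+\<omega>. \<Lambda>' (t, \<omega>) * indicator ({0..T} \<times> space M) (t, \<omega>) \<partial>M)" for t
    unfolding E'_def by (cases "t \<in> {0..T}") (auto simp: indicator_def intro!: nn_integral_cong)
  ultimately show ?thesis by presburger
qed

lemma intensity_ge: "AE \<omega> in M. \<forall>t\<in>{0..T}. \<mu> \<le> \<Lambda> t \<omega>"
  using \<Lambda>
proof eventually_elim
  case (elim \<omega>)
  show ?case
  proof
    fix t assume "t \<in> {0..T}"
    then have "ennreal \<mu> \<le> ennreal (\<Lambda> t \<omega>)" using elim by simp
    then show "\<mu> \<le> \<Lambda> t \<omega>" using \<mu> by (simp add: ennreal_le_iff2)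
  qed
qed

lemma expectation_intensity:
  assumes t: "t \<in> {0..T}"
  shows "expectation (\<Lambda> t) = e t" and "ennreal \<mu> \<le> E' t"
proof -
  have m: "\<Lambda> t \<in> borel_measurable M"
    using measurable_compose[OF PS_at_time[OF t] \<Lambda>m] by simp
  have ge: "AE \<omega> in M. \<mu> \<le> \<Lambda> t \<omega>"
    using intensity_ge by eventually_elim (use t in blast)
  have "expectation (\<Lambda> t) = enn2real (\<integral>\<^sup>+\<omega>. ennreal (\<Lambda> t \<omega>) \<partial>M)"
  proof (rule integral_eq_nn_integral[OF m])
    show "AE \<omega> in M. 0 \<le> \<Lambda> t \<omega>" using ge by eventually_elim (use \<mu> in simp)
  qed
  then show "expectation (\<Lambda> t) = e t" using t by (simp add: e_def E'_def \<Lambda>'_def)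
  have "ennreal \<mu> = (\<integral>\<^sup>+\<omega>. ennreal \<mu> \<partial>M)" by (simp add: emeasure_space_1)
  also have "\<dots> \<le> (\<integral>\<^sup>+\<omega>. \<Lambda>' (t, \<omega>) \<partial>M)"
  proof (rule nn_integral_mono_AE)
    show "AE \<omega> in M. ennreal \<mu> \<le> \<Lambda>' (t, \<omega>)"
      using ge by eventually_elim (simp add: \<Lambda>'_def ennreal_leI)
  qed
  finally show "ennreal \<mu> \<le> E' t" using t by (simp add: E'_def)
qed

lemma E'_integral: "(\<integral>\<^sup>+t. E' t \<partial>lborel) < \<infinity>"
  using mean_intensity_bound unfolding E'_def[symmetric] by (rule order.strict_trans1) simp

lemma E'_finite: "AE t in lborel. E' t \<noteq> \<infinity>"
  using E'_measurable E'_integral by (intro nn_integral_PInf_AE) auto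

lemma AE_mean_ge: "AE t in lborel. t \<in> {0..T} \<longrightarrow> \<mu> \<le> e t"
  using E'_finite
proof eventually_elim
  case (elim t)
  show ?case
  proof
    assume "t \<in> {0..T}"
    then have "ennreal \<mu> \<le> E' t" by (rule expectation_intensity(2))
    also have "E' t = ennreal (e t)"
      unfolding e_def using elim by (simp add: less_top)
    finally show "\<mu> \<le> e t" using \<mu> by (simp add: ennreal_le_iff2)
  qed
qed

definition h :: "real \<times> real \<Rightarrow> real" where
  "h p = (if fst p \<in> {0..T} \<and> snd p \<le> e (fst p) then 1 / sqrt (T * e (fst p)) else 0)"

lemma e_nonneg: "0 \<le> e t"
  by (simp add: e_def)

lemma e_measurable: "e \<in> borel_measurable borel"
  unfolding e_def[abs_def] by (rule borel_measurable_enn2real[OF E'_measurable])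

lemma h_nonneg: "0 \<le> h p"
  using T e_nonneg by (simp add: h_def)

lemma hawkes_F_hat_eq: "hawkes_F_hat M N T \<Lambda> = compensated_integral dt_d\<theta> N h"
proof -
  have "(\<lambda>(t, \<theta>). indicator {0..T} t * (indicator {..expectation (\<Lambda> t)} \<theta> / sqrt (T * expectation (\<Lambda> t)))) = h"
    by (rule ext) (auto simp: h_def indicator_def expectation_intensity split: prod.splits)
  then show ?thesis unfolding hawkes_F_hat_def by simp
qed

text \<open>At time t the integrand is constant on marks in an interval of length \<open>e t\<close>
  and 0 above it; the successor in the exponent keeps that 0.\<close>

lemma h_moment:
  "(\<integral>\<^sup>+p. ennreal (h p ^ Suc k) \<partial>dt_d\<theta>)
    = (\<integral>\<^sup>+t. ennreal (e t * (1 / sqrt (T * e t)) ^ Suc k) * indicator {0..T} t \<partial>lborel)"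
proof -
  note [measurable] = e_measurable
  have "(\<integral>\<^sup>+p. ennreal (h p ^ Suc k) \<partial>dt_d\<theta>) = (\<integral>\<^sup>+t. (\<integral>\<^sup>+x\<in>{0..}. ennreal (h (t, x) ^ Suc k) \<partial>lborel) \<partial>lborel)"
    unfolding h_def[abs_def] by (rule nn_integral_dt_d\<theta>) measurable
  also have "\<dots> = (\<integral>\<^sup>+t. ennreal (e t * (1 / sqrt (T * e t)) ^ Suc k) * indicator {0..T} t \<partial>lborel)"
  proof (rule nn_integral_cong)
    fix t
    let ?c = "ennreal ((1 / sqrt (T * e t)) ^ Suc k)"
    have "(\<integral>\<^sup>+x\<in>{0..}. ennreal (h (t, x) ^ Suc k) \<partial>lborel)
        = (\<integral>\<^sup>+x. ?c * indicator {0..T} t * indicator {0..e t} x \<partial>lborel)"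
      by (intro nn_integral_cong) (auto simp: h_def indicator_def)
    also have "\<dots> = ?c * indicator {0..T} t * ennreal (e t)"
      using e_nonneg by (subst nn_integral_cmult_indicator) auto
    also have "\<dots> = ennreal (e t) * ?c * indicator {0..T} t" by (simp only: mult_ac)
    also have "ennreal (e t) * ?c = ennreal (e t * (1 / sqrt (T * e t)) ^ Suc k)"
      using e_nonneg T by (intro ennreal_mult[symmetric]) auto
    finally show "(\<integral>\<^sup>+x\<in>{0..}. ennreal (h (t, x) ^ Suc k) \<partial>lborel)
      = ennreal (e t * (1 / sqrt (T * e t)) ^ Suc k) * indicator {0..T} t" .
  qed
  finally show ?thesis .
qed

lemma h_measurable: "h \<in> borel_measurable dt_d\<theta>"
proof -
  note [measurable] = e_measurable measurable_fst_dt_d\<theta> measurable_snd_dt_d\<theta>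
  have "(\<lambda>p. e (fst p)) \<in> borel_measurable dt_d\<theta>"
    by (rule measurable_compose[OF measurable_fst_dt_d\<theta> e_measurable])
  then show ?thesis unfolding h_def[abs_def] by measurable
qed

text \<open>With s = \<open>sqrt (T * e t)\<close>, integrating the mark gives s / T, and s \<le> 1
  + s * s bounds this by \<open>1 / T + e t\<close>, which is integrable over \<open>{0..T}\<close>
  by the mean bound.\<close>

lemma h_integrable1: "integrable dt_d\<theta> h"
proof -
  have "(\<integral>\<^sup>+p. ennreal (h p ^ Suc 0) \<partial>dt_d\<theta>) \<le> (\<integral>\<^sup>+t. ennreal (1 / T) * indicator {0..T} t + E' t \<partial>lborel)"
    unfolding h_moment
  proof (rule nn_integral_mono_AE)
    show "AE t in lborel. ennreal (e t * (1 / sqrt (T * e t)) ^ Suc 0) * indicator {0..T} t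
        \<le> ennreal (1 / T) * indicator {0..T} t + E' t"
      using AE_mean_ge E'_finite
    proof eventually_elim
      case (elim t)
      show ?case
      proof (cases "t \<in> {0..T}")
        case True
        then have e: "0 < e t" using elim \<mu> by auto
        define s where "s = sqrt (T * e t)"
        have s: "0 < s" "s\<^sup>2 = T * e t" using e T by (simp_all add: s_def)
        have "e t * (1 / s) = s / T"
          using s T by (simp add: field_simps power2_eq_square)
        also have "\<dots> \<le> (1 + s\<^sup>2) / T"
        proof (rule divide_right_mono)
          have "0 \<le> (s - 1)\<^sup>2" by simp
          then have "2 * s \<le> s\<^sup>2 + 1" by (simp add: power2_eq_square algebra_simps)
          then show "s \<le> 1 + s\<^sup>2" using s by linarith
        qed (use T in simp)
        also have "\<dots> = 1 / T + e t" using T s by (simp add: add_divide_distrib)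
        finally have "ennreal (e t * (1 / s)) \<le> ennreal (1 / T + e t)" by (rule ennreal_leI)
        also have "\<dots> = ennreal (1 / T) + ennreal (e t)" using T e by (intro ennreal_plus) auto
        also have "ennreal (e t) = E' t" unfolding e_def using elim by (simp add: less_top)
        finally show ?thesis using True by (simp add: s_def)
      qed simp
    qed
  qed
  also have "\<dots> < \<infinity>"
    using E'_measurable E'_integral T by (simp add: nn_integral_add nn_integral_cmult_indicator ennreal_mult_less_top)
  finally show ?thesis
    using h_measurable h_nonneg by (intro integrableI_nonneg) auto
qed

text \<open>The weight is designed so that \<open>e t\<close> cancels and \<open>1 / T\<close> is
  left. Times with \<open>e t = 0\<close> would lose mass; \<open>AE_mean_ge\<close> makes them
  negligible.\<close>

lemma h_integral2: "has_bochner_integral dt_d\<theta> (\<lambda>p. (h p)\<^sup>2) 1"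
proof (rule has_bochner_integral_nn_integral)
  have "(\<integral>\<^sup>+p. ennreal (h p ^ Suc 1) \<partial>dt_d\<theta>) = (\<integral>\<^sup>+t. ennreal (1 / T) * indicator {0..T} t \<partial>lborel)"
    unfolding h_moment
  proof (rule nn_integral_cong_AE)
    show "AE t in lborel. ennreal (e t * (1 / sqrt (T * e t)) ^ Suc 1) * indicator {0..T} t
        = ennreal (1 / T) * indicator {0..T} t"
      using AE_mean_ge
    proof eventually_elim
      case (elim t)
      show ?case
      proof (cases "t \<in> {0..T}")
        case True
        then have e: "0 < e t" using elim \<mu> by auto
        then have "e t * (1 / sqrt (T * e t)) ^ Suc 1 = 1 / T"
          using T by (simp add: power2_eq_square[symmetric] power_divide numeral_2_eq_2[symmetric])
        then show ?thesis by simp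
      qed simp
    qed
  qed
  also have "\<dots> = 1" using T by (simp add: nn_integral_cmult_indicator ennreal_mult[symmetric])
  finally show "(\<integral>\<^sup>+p. ennreal ((h p)\<^sup>2) \<partial>dt_d\<theta>) = ennreal 1" by (simp add: numeral_2_eq_2)
qed (use h_measurable in auto)

text \<open>Integrating the mark leaves \<open>1 / (T * sqrt (T * e t))\<close>; the lower bound
  \<open>\<mu>\<close> on the mean intensity makes this uniform in t, and the rate in
  \<open>T\<close> appears.\<close>

lemma h_integral3:
  "integrable dt_d\<theta> (\<lambda>p. h p ^ 3)" "(\<integral>p. h p ^ 3 \<partial>dt_d\<theta>) \<le> 1 / sqrt (\<mu> * T)"
proof -
  have "(\<integral>\<^sup>+p. ennreal (h p ^ Suc 2) \<partial>dt_d\<theta>) \<le> (\<integral>\<^sup>+t. ennreal (1 / (T * sqrt (\<mu> * T))) * indicator {0..T} t \<partial>lborel)"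
    unfolding h_moment
  proof (rule nn_integral_mono_AE)
    show "AE t in lborel. ennreal (e t * (1 / sqrt (T * e t)) ^ Suc 2) * indicator {0..T} t
        \<le> ennreal (1 / (T * sqrt (\<mu> * T))) * indicator {0..T} t"
      using AE_mean_ge
    proof eventually_elim
      case (elim t)
      show ?case
      proof (cases "t \<in> {0..T}")
        case True
        then have e: "0 < e t" "\<mu> \<le> e t" using elim \<mu> by auto
        define s where "s = sqrt (T * e t)"
        have s: "0 < s" "s\<^sup>2 = T * e t" using e T by (simp_all add: s_def)
        have "e t * (1 / s) ^ Suc 2 = e t / (s\<^sup>2 * s)"
          by (simp add: power_divide power2_eq_square power3_eq_cube mult_ac)
        also have "\<dots> = 1 / (T * s)" using e T s by (simp add: field_simps)
        also have "\<dots> \<le> 1 / (T * sqrt (\<mu> * T))"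
        proof (rule divide_left_mono)
          have "sqrt (\<mu> * T) \<le> s" unfolding s_def using e T by (simp add: mult.commute)
          then show "T * sqrt (\<mu> * T) \<le> T * s" using T by simp
        qed (use T \<mu> s in auto)
        finally show ?thesis using True by (simp add: s_def ennreal_leI del: power_Suc)
      qed simp
    qed
  qed
  also have "\<dots> = ennreal (1 / sqrt (\<mu> * T))"
    using T \<mu> by (simp add: nn_integral_cmult_indicator ennreal_mult[symmetric])
  finally have le: "(\<integral>\<^sup>+p. ennreal (h p ^ 3) \<partial>dt_d\<theta>) \<le> ennreal (1 / sqrt (\<mu> * T))"
    by (simp only: numeral_3_eq_3 numeral_2_eq_2)
  show int: "integrable dt_d\<theta> (\<lambda>p. h p ^ 3)"
    using le h_measurable h_nonneg by (intro integrableI_nonneg) (auto intro: le_less_trans)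
  have "ennreal (\<integral>p. h p ^ 3 \<partial>dt_d\<theta>) = (\<integral>\<^sup>+p. ennreal (h p ^ 3) \<partial>dt_d\<theta>)"
    using int h_nonneg by (intro nn_integral_eq_integral[symmetric]) auto
  from ord_eq_le_trans[OF this le] show "(\<integral>p. h p ^ 3 \<partial>dt_d\<theta>) \<le> 1 / sqrt (\<mu> * T)"
    using T \<mu> by (subst (asm) ennreal_le_iff) auto
qed

text \<open>With variance exactly 1 the defect term drops out, together with the integral of
  \<open>h\<close> in its coefficient, and only the cubic term is left.\<close>

lemma hawkes_F_hat_bound:
  assumes u: "1-lipschitz_on UNIV u"
  shows "\<bar>(\<integral>\<omega>. u (hawkes_F_hat M N T \<Lambda> \<omega>) \<partial>M) - gauss_mean u\<bar> \<le> 22 / sqrt (\<mu> * T)"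
proof -
  have 2: "integrable dt_d\<theta> (\<lambda>p. (h p)\<^sup>2)" "(\<integral>p. (h p)\<^sup>2 \<partial>dt_d\<theta>) = 1"
    using h_integral2 by (auto simp: has_bochner_integral_iff)
  show ?thesis
    using poisson_stein_bound[OF h_nonneg h_integrable1 2(1) h_integral3(1) u] h_integral3(2)
    unfolding hawkes_F_hat_eq 2(2) by simp
qed

end

theorem proposition7p3:
  fixes \<mu> m :: real
  assumes "\<mu> > 0"
  shows "\<exists>C>0. \<forall>\<phi> :: real \<Rightarrow> real.
    (\<forall>t\<ge>0. \<phi> t \<ge> 0) \<and> (\<forall>K\<ge>0. bounded (\<phi> ` {0..K})) \<and>
    set_integrable lborel {0..} \<phi> \<and> (LBINT t:{0..}. \<phi> t) = 1 \<and>
    set_integrable lborel {0..} (\<lambda>t. t * \<phi> t) \<and> (LBINT t:{0..}. t * \<phi> t) = m \<longrightarrow>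
    (\<forall>(M :: 'w measure) (N :: 'w \<Rightarrow> (real \<times> real) measure) (M' :: 'v measure) (G :: 'v \<Rightarrow> real).
      poisson_random_measure M dt_d\<theta> N \<and>
      prob_space M' \<and> distributed M' lborel G std_normal_density \<longrightarrow>
      (\<forall>(T :: real) (a :: real) (\<Lambda> :: real \<Rightarrow> 'w \<Rightarrow> real).
        T > 1 \<and> 0 < a \<and> a < 1 \<and> T * (1 - a) = 1 \<and>
        hawkes_intensity M N \<mu> (\<lambda>t. a * \<phi> t) T \<Lambda> \<longrightarrow>
        wasserstein_dist M (hawkes_F_hat M N T \<Lambda>) M' G \<le> ennreal (C / sqrt T)))"
\<comment> \<open>22 comes from the Lipschitz constant of the derivative of the Stein solution,
  \<open>sqrt \<mu>\<close> from the lower bound on the mean intensity.\<close>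
proof (intro exI[of _ "22 / sqrt \<mu>"] conjI allI impI; (elim conjE)?)
  show "0 < 22 / sqrt \<mu>" using assms by simp
  fix \<phi> :: "real \<Rightarrow> real" and M :: "'w measure" and N :: "'w \<Rightarrow> (real \<times> real) measure"
    and M' :: "'v measure" and G :: "'v \<Rightarrow> real" and T a :: real and \<Lambda> :: "real \<Rightarrow> 'w \<Rightarrow> real"
  assume \<phi>: "\<forall>t\<ge>0. 0 \<le> \<phi> t" "\<forall>K\<ge>0. bounded (\<phi> ` {0..K})"
      "set_integrable lborel {0..} \<phi>" "(LBINT t:{0..}. \<phi> t) = 1"
    and N: "poisson_random_measure M dt_d\<theta> N" and G: "distributed M' lborel G (\<lambda>x. ennreal (std_normal_density x))"
    and T: "1 < T" and a: "0 < a" "a < 1"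
    and \<Lambda>: "hawkes_intensity M N \<mu> (\<lambda>t. a * \<phi> t) T \<Lambda>"
  \<comment> \<open>The hypotheses constrain \<open>\<phi>\<close> on the nonnegative axis alone;
    cutting it off there, and at 0 as well in \<open>\<psi>\<close>, yields a kernel on the whole
    line.\<close>
  define \<phi>' where "\<phi>' t = indicator {0..} t * \<phi> t" for t
  define \<psi> where "\<psi> t = a * (indicator {0<..} t * \<phi>' t)" for t
  have \<phi>': "integrable lborel \<phi>'" "(\<integral>t. \<phi>' t \<partial>lborel) = 1"
    using \<phi>(3,4) by (simp_all add: \<phi>'_def[abs_def] set_integrable_def set_lebesgue_integral_def)
  have \<phi>'_nonneg: "0 \<le> \<phi>' t" for t using \<phi>(1) by (simp add: \<phi>'_def indicator_def)
  have \<psi>m: "\<psi> \<in> borel_measurable borel"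
    using borel_measurable_integrable[OF \<phi>'(1)] unfolding \<psi>_def[abs_def] by simp
  have "bounded (\<phi> ` {0..T})" using \<phi>(2) T by simp
  then obtain B where B: "\<And>t. t \<in> {0..T} \<Longrightarrow> \<phi> t \<le> B"
    unfolding bounded_iff by (metis abs_le_D1 imageI real_norm_def)
  have B0: "0 \<le> B" using B[of 0] \<phi>(1) T order_trans[of 0 "\<phi> 0" B] by auto
  have \<psi>B: "\<psi> t \<le> B" if "t \<le> T" for t
  proof (cases "0 < t")
    case True
    have "a * \<phi> t \<le> 1 * \<phi> t" using a \<phi>(1) True by (intro mult_right_mono) auto
    also have "\<dots> \<le> B" using B that True by simp
    finally show ?thesis using True by (simp add: \<psi>_def \<phi>'_def)
  qed (simp add: \<psi>_def B0)
  have \<psi>a: "(\<integral>\<^sup>+t. ennreal (\<psi> t) \<partial>lborel) \<le> ennreal a"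
  proof -
    have "(\<integral>\<^sup>+t. ennreal (\<psi> t) \<partial>lborel) \<le> (\<integral>\<^sup>+t. ennreal (a * \<phi>' t) \<partial>lborel)"
      using a \<phi>'_nonneg by (intro nn_integral_mono ennreal_leI) (auto simp: \<psi>_def indicator_def)
    also have "\<dots> = ennreal (\<integral>t. a * \<phi>' t \<partial>lborel)"
      using a \<phi>' \<phi>'_nonneg by (intro nn_integral_eq_integral) auto
    finally show ?thesis using \<phi>' by simp
  qed
  interpret planar_poisson M N T
    using N T by unfold_locales simp_all
  interpret hawkes_process M N T \<mu> a B \<psi> \<Lambda>
  proof unfold_locales
    show "(\<lambda>x. \<Lambda> (fst x) (snd x)) \<in> borel_measurable PS"
      using \<Lambda> by (simp add: hawkes_intensity_def split_beta')
    \<comment> \<open>The condition s < t says that \<open>t - s\<close> is positive, which the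
      support of \<open>\<psi>\<close> encodes.\<close>
    have eq: "(case p of (s, \<theta>) \<Rightarrow> ennreal (a * \<phi> (t - s)) * indicator {0<..<t} s * indicator {..\<Lambda> s \<omega>} \<theta>)
        = ennreal (\<psi> (t - fst p)) * indicator {0<..} (fst p) * indicator {..\<Lambda> (fst p) \<omega>} (snd p)" for p t \<omega>
      by (cases p) (auto simp: \<psi>_def \<phi>'_def indicator_def)
    have "AE \<omega> in M. \<forall>t\<in>{0..T}. ennreal (\<Lambda> t \<omega>) =
        ennreal \<mu> + (\<integral>\<^sup>+(s, \<theta>). ennreal (a * \<phi> (t - s)) * indicator {0<..<t} s *
                            indicator {..\<Lambda> s \<omega>} \<theta> \<partial>N \<omega>)"
      using \<Lambda> by (simp add: hawkes_intensity_def)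
    moreover have "(\<integral>\<^sup>+(s, \<theta>). ennreal (a * \<phi> (t - s)) * indicator {0<..<t} s * indicator {..\<Lambda> s \<omega>} \<theta> \<partial>N \<omega>)
        = (\<integral>\<^sup>+p. ennreal (\<psi> (t - fst p)) * indicator {0<..} (fst p) * indicator {..\<Lambda> (fst p) \<omega>} (snd p) \<partial>N \<omega>)" for t \<omega>
      by (rule nn_integral_cong[OF eq])
    ultimately show "AE \<omega> in M. \<forall>t\<in>{0..T}. ennreal (\<Lambda> t \<omega>) = ennreal \<mu> +
        (\<integral>\<^sup>+p. ennreal (\<psi> (t - fst p)) * indicator {0<..} (fst p) * indicator {..\<Lambda> (fst p) \<omega>} (snd p) \<partial>N \<omega>)"
      by (simp only:)
  qed (use assms a \<psi>m \<psi>B \<psi>a in \<open>auto simp: \<psi>_def\<close>)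
  show "wasserstein_dist M (hawkes_F_hat M N T \<Lambda>) M' G \<le> ennreal (22 / sqrt \<mu> / sqrt T)"
    unfolding wasserstein_dist_def
  proof (rule SUP_least)
    fix u :: "real \<Rightarrow> real" assume "u \<in> {u. 1-lipschitz_on UNIV u}"
    then have u: "1-lipschitz_on UNIV u" by simp
    note um = lipschitz_measurable[OF u]
    have "(\<integral>\<omega>. u (G \<omega>) \<partial>M') = gauss_mean u"
      unfolding gauss_mean_def using um by (intro distributed_integral[OF G, symmetric]) auto
    then show "ennreal \<bar>(\<integral>\<omega>. u (hawkes_F_hat M N T \<Lambda> \<omega>) \<partial>M) - (\<integral>\<omega>. u (G \<omega>) \<partial>M')\<bar> \<le> ennreal (22 / sqrt \<mu> / sqrt T)"
      using hawkes_F_hat_bound[OF u] by (intro ennreal_leI) (simp add: real_sqrt_mult)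
  qed
qed

end
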